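(* Let $\mu$ be a finite sum of point masses on the unit circle $\mathbb T$ and, for $\lambda$ in the open unit disc $\mathbb D$, denote by $\widehat k_\lambda^{\mu}$ the normalized reproducing kernel of $\mathcal D(\mu)$ at the point $\lambda$. Then, for any sequence $(\lambda_n)_{n\geq 1}$ in $\mathbb D$, the sequence $(\widehat k_{\lambda_n}^\mu)_{n\geq 1}$ satisfies the Feichtinger Conjecture; that is, if $(\widehat k_{\lambda_n}^\mu)_{n\geq 1}$ is a Bessel sequence in $\mathcal D(\mu)$, then it can be partitioned into finitely many Riesz sequences.
   Context: $\mathbb D$ is the open unit disc of $\mathbb C$ and $\mathbb T$ its boundary. A finite sum of point masses is a measure $\mu=\sum_{j=1}^N c_j\delta_{\zeta_j}$ with $N\ge1$, $c_j>0$, $\zeta_j\in\mathbb T$. For a positive finite Borel measure $\mu$ on $\mathbb T$ (nonzero), $\mathcal D(\mu)$ is the Hilbert space of analytic functions $f$ on $\mathbb D$ such that $$\|f\|^2_{\mathcal D(\mu)}=|f(0)|^2+\int_{\mathbb D} |f'(z)|^2 P_\mu(z)\, dA(z)<+\infty,\qquad P_\mu(z) = \int_{\mathbb T} \frac{1-|z|^2}{|\zeta-z|^2}\, d\mu(\zeta)\quad (z\in\mathbb D),$$ where $dA$ is area measure on $\mathbb D$. The reproducing kernel $k_\lambda^\mu\in\mathcal D(\mu)$ at $\lambda\in\mathbb D$ is determined by $f(\lambda)=\langle f,k^\mu_\lambda\rangle$ for all $f\in\mathcal D(\mu)$, and $\widehat k^\mu_\lambda=k^\mu_\lambda/\|k^\mu_\lambda\|$.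 A (finite or countable) family $(x_n)_{n\in I}$ in a Hilbert space is a Riesz sequence if there are constants $A,B>0$ such that $A\sum |a_n|^2\leq \| \sum a_n x_n\|^2\leq B\sum |a_n|^2$ for all finitely supported complex families $(a_n)_{n\in I}$; it is a Bessel sequence if (at least) the right-hand inequality holds for some $B>0$. "Can be partitioned into finitely many Riesz sequences" means that the index set $\{1,2,3,\dots\}$ is a union of finitely many pairwise disjoint subsets $I_1,\dots,I_r$ such that each subfamily indexed by $I_j$ is a Riesz sequence. *)

theory Defs
  imports "HOL-Complex_Analysis.Complex_Analysis"
begin

text \<open>Borel measures on the unit circle are measures whose underlying measurable space is
  \<^term>\<open>sphere (0::complex) 1\<close> with its Borel sets. The points \<open>\<zeta> j\<close> need not be distinct.\<close>

definition finite_sum_of_point_masses :: "complex measure \<Rightarrow> bool" where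
  "finite_sum_of_point_masses \<mu> \<longleftrightarrow>
     sets \<mu> = sets (restrict_space borel (sphere 0 1)) \<and>
     (\<exists>(N::nat) (c :: nat \<Rightarrow> real) (\<zeta> :: nat \<Rightarrow> complex).
        N \<ge> 1 \<and> (\<forall>j\<in>{1..N}. c j > 0 \<and> \<zeta> j \<in> sphere 0 1) \<and>
        (\<forall>A\<in>sets \<mu>. emeasure \<mu> A = (\<Sum>j=1..N. ennreal (c j) * indicator A (\<zeta> j))))"

definition poisson :: "complex measure \<Rightarrow> complex \<Rightarrow> real" where
  "poisson \<mu> z = (LINT \<zeta>|\<mu>. (1 - (cmod z)\<^sup>2) / (cmod (\<zeta> - z))\<^sup>2)"

text \<open>Functions on the disc are represented by functions on the whole plane that vanish off the
  disc, so that equality of elements is equality on the disc.\<close>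

definition dirichlet_space :: "complex measure \<Rightarrow> (complex \<Rightarrow> complex) set" where
  "dirichlet_space \<mu> =
     {f. f holomorphic_on ball 0 1 \<and> (\<forall>z. z \<notin> ball 0 1 \<longrightarrow> f z = 0) \<and>
         (\<integral>\<^sup>+z\<in>ball 0 1. ennreal ((cmod (deriv f z))\<^sup>2 * poisson \<mu> z) \<partial>lborel) < \<infinity>}"

definition dirichlet_norm :: "complex measure \<Rightarrow> (complex \<Rightarrow> complex) \<Rightarrow> real" where
  "dirichlet_norm \<mu> f =
     sqrt ((cmod (f 0))\<^sup>2 + (LINT z:ball 0 1|lborel. (cmod (deriv f z))\<^sup>2 * poisson \<mu> z))"

text \<open>The inner product obtained from the norm by polarization, conjugate-linear in the second
  argument.\<close>

definition dirichlet_inner ::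
    "complex measure \<Rightarrow> (complex \<Rightarrow> complex) \<Rightarrow> (complex \<Rightarrow> complex) \<Rightarrow> complex" where
  "dirichlet_inner \<mu> f g =
     f 0 * cnj (g 0) +
     (LINT z:ball 0 1|lborel. deriv f z * cnj (deriv g z) * complex_of_real (poisson \<mu> z))"

definition dirichlet_kernel :: "complex measure \<Rightarrow> complex \<Rightarrow> complex \<Rightarrow> complex" where
  "dirichlet_kernel \<mu> l =
     (THE k. k \<in> dirichlet_space \<mu> \<and> (\<forall>f\<in>dirichlet_space \<mu>. f l = dirichlet_inner \<mu> f k))"

definition normalized_kernel :: "complex measure \<Rightarrow> complex \<Rightarrow> complex \<Rightarrow> complex" where
  "normalized_kernel \<mu> l =
     (\<lambda>z. dirichlet_kernel \<mu> l z / complex_of_real (dirichlet_norm \<mu> (dirichlet_kernel \<mu> l)))"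

text \<open>In the next two definitions the family \<open>x\<close> is meant to lie in \<^term>\<open>dirichlet_space \<mu>\<close>;
  finitely supported coefficient families are those supported in some finite \<open>F \<subseteq> I\<close>.\<close>

definition bessel_sequence ::
    "complex measure \<Rightarrow> 'i set \<Rightarrow> ('i \<Rightarrow> complex \<Rightarrow> complex) \<Rightarrow> bool" where
  "bessel_sequence \<mu> I x \<longleftrightarrow>
     (\<exists>B>0. \<forall>F (a :: 'i \<Rightarrow> complex). finite F \<and> F \<subseteq> I \<longrightarrow>
        (dirichlet_norm \<mu> (\<lambda>z. \<Sum>n\<in>F. a n * x n z))\<^sup>2 \<le> B * (\<Sum>n\<in>F. (cmod (a n))\<^sup>2))"

definition riesz_sequence ::
    "complex measure \<Rightarrow> 'i set \<Rightarrow> ('i \<Rightarrow> complex \<Rightarrow> complex) \<Rightarrow> bool" where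
  "riesz_sequence \<mu> I x \<longleftrightarrow>
     (\<exists>A>0. \<exists>B>0. \<forall>F (a :: 'i \<Rightarrow> complex). finite F \<and> F \<subseteq> I \<longrightarrow>
        A * (\<Sum>n\<in>F. (cmod (a n))\<^sup>2) \<le> (dirichlet_norm \<mu> (\<lambda>z. \<Sum>n\<in>F. a n * x n z))\<^sup>2 \<and>
        (dirichlet_norm \<mu> (\<lambda>z. \<Sum>n\<in>F. a n * x n z))\<^sup>2 \<le> B * (\<Sum>n\<in>F. (cmod (a n))\<^sup>2))"

end

(*
  Let q be the product of z - p over the atoms p. For g in the disc algebra the function q g lies in
  D(mu) with norm at most a constant times the Hardy space norm of g, and for every f in D(mu) a
  radial integration of f' gives |f(l)| <= C (1 + |q(l)| / sqrt(1 - |l|^2)) ||f||.  Testing the Bessel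
  condition on f = 1 shows that the kernel norms tend to infinity, so all but finitely many points
  satisfy ||k_l|| <= C |q(l)| / sqrt(1 - |l|^2).  For these points, testing on f = q g shows that the
  normalized Szego kernels form a Bessel sequence in the Hardy space.  Applied to Szego kernels this
  bounds the sums of 1 - rho^2 (rho the pseudohyperbolic distance), so finitely many colours separate
  the points and the Blaschke products of each colour class are bounded below at its points.  Finite
  interpolation problems in the Hardy space are then solvable with uniform bounds; multiplying a
  solution by q solves them in D(mu), and by duality this is the lower Riesz bound.
*)

theory Submission
  imports Defs
begin

section \<open>Area integrals over discs\<close>

text \<open>The upper estimate of the kernel norm works in two opposite directions. It makes the
  evaluations of \<open>q g\<close> in D(mu) dominate those of g in the Hardy space, which carries
  the Bessel condition over; and it keeps the data bounded when an interpolation problem in D(mu) is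
  divided by q. The obstacle is the additive 1 in the evaluation estimate. It dominates when a point
  approaches an atom radially: there the kernel norms stay bounded and the comparison with q times
  the Hardy space breaks down. The Bessel condition leaves only finitely many points of this kind,
  and they become classes of their own. A Riesz bound speaks of finite sums only, so it is enough to
  interpolate on finite sets with a constant that does not depend on the set. The interpolants are
  then rational with poles off the closed disc, which is why the disc algebra with means over the
  circle can stand for the Hardy space. The kernel is given by a definite description, so its
  existence and uniqueness have to be established before anything can be said about it; this is done
  through a minimal norm problem.\<close>

lemma emeasure_complex_ball: "r \<ge> 0 \<Longrightarrow> emeasure lborel (ball (c::complex) r) = ennreal (pi * r\<^sup>2)"
  by (simp add: emeasure_ball unit_ball_vol_2)

lemma nn_integral_lborel_translate:
  fixes f :: "complex \<Rightarrow> ennreal"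
  assumes [measurable]: "f \<in> borel_measurable borel"
  shows "(\<integral>\<^sup>+z. f (c + z) \<partial>lborel) = (\<integral>\<^sup>+z. f z \<partial>lborel)"
proof -
  have "(\<integral>\<^sup>+z. f z \<partial>lborel) = (\<integral>\<^sup>+z. f z \<partial>distr lborel borel ((+) c))"
    by (simp add: lborel_distr_plus)
  also have "\<dots> = (\<integral>\<^sup>+z. f (c + z) \<partial>lborel)"
    by (subst nn_integral_distr) auto
  finally show ?thesis by simp
qed

text \<open>Uniqueness of translation-invariant measures: the double integral of
  \<open>1\<^sub>E (x + u y) 1\<^sub>B (y)\<close> over \<open>x\<close> and \<open>y\<close> is computed in both orders, with \<open>B\<close> the
  rotation-invariant unit disc.\<close>

lemma lborel_distr_rotation:
  fixes u :: complex
  assumes u: "cmod u = 1"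
  shows "distr lborel borel (\<lambda>z. u * z) = lborel"
proof (rule measure_eqI)
  fix E :: "complex set" assume "E \<in> sets (distr lborel borel (\<lambda>z. u * z))"
  then have E[measurable]: "E \<in> sets borel" by simp
  let ?B = "ball (0::complex) 1"
  have [measurable]: "?B \<in> sets borel" by simp
  have u0: "u \<noteq> 0" using u by auto
  define X where "X = (\<integral>\<^sup>+y. \<integral>\<^sup>+x. indicator E (x + u * y) * indicator ?B y \<partial>lborel \<partial>lborel :: ennreal)"
  have "X = (\<integral>\<^sup>+y. emeasure lborel E * indicator ?B y \<partial>lborel)"
  proof -
    have "(\<integral>\<^sup>+x. indicator E (x + u * y) * indicator ?B y \<partial>lborel) = emeasure lborel E * indicator ?B y" for y
      using nn_integral_lborel_translate[of "indicator E" "u * y"]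
      by (simp add: nn_integral_multc add.commute)
    then show ?thesis by (simp add: X_def)
  qed
  then have 1: "X = emeasure lborel E * ennreal pi"
    by (subst (asm) nn_integral_cmult) (auto simp: emeasure_complex_ball borel_measurable_indicator)
  have "X = (\<integral>\<^sup>+x. \<integral>\<^sup>+y. indicator E (x + u * y) * indicator ?B y \<partial>lborel \<partial>lborel)"
    unfolding X_def by (rule lborel_pair.Fubini') measurable
  also have "\<dots> = (\<integral>\<^sup>+x. \<integral>\<^sup>+y. indicator E (u * y) * indicator (ball (u * y) 1) x \<partial>lborel \<partial>lborel)"
  \<comment> \<open>The shift of \<open>y\<close> by \<open>- x / u\<close> removes \<open>x\<close>
    from the argument of \<open>E\<close>. As \<open>u\<close> has modulus one, the condition on the
    disc then says that \<open>x\<close> lies in the unit disc about \<open>u * y\<close>, whose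
    area is independent of \<open>y\<close>.\<close>
  proof (rule nn_integral_cong)
    fix x :: complex
    have "(\<integral>\<^sup>+y. indicator E (x + u * y) * indicator ?B y \<partial>lborel) =
      (\<integral>\<^sup>+y. indicator E (x + u * (- x / u + y)) * indicator ?B (- x / u + y) \<partial>lborel)"
      by (rule nn_integral_lborel_translate[symmetric]) simp
    also have "\<dots> = (\<integral>\<^sup>+y. indicator E (u * y) * indicator (ball (u * y) 1) x \<partial>lborel)"
    proof (rule nn_integral_cong)
      fix y :: complex
      have "cmod (- x / u + y) = cmod (u * (- x / u + y))"
        by (simp add: norm_mult u)
      also have "u * (- x / u + y) = u * y - x"
        using u0 by (simp add: field_simps)
      finally have "(indicator ?B (- x / u + y) :: ennreal) = indicator (ball (u * y) 1) x"
        by (auto simp: indicator_def dist_norm norm_minus_commute)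
      moreover have "x + u * (- x / u + y) = u * y"
        using u0 by (simp add: field_simps)
      ultimately show "indicator E (x + u * (- x / u + y)) * indicator ?B (- x / u + y) =
          (indicator E (u * y) * indicator (ball (u * y) 1) x :: ennreal)" by simp
    qed
    finally show "(\<integral>\<^sup>+y. indicator E (x + u * y) * indicator ?B y \<partial>lborel) =
      (\<integral>\<^sup>+y. indicator E (u * y) * indicator (ball (u * y) 1) x \<partial>lborel)" .
  qed
  also have "\<dots> = (\<integral>\<^sup>+y. \<integral>\<^sup>+x. indicator E (u * y) * indicator (ball (u * y) 1) x \<partial>lborel \<partial>lborel)"
  proof (rule lborel_pair.Fubini')
    have "(\<lambda>(y, x). indicator E (u * y) * (if dist (u * y) x < 1 then 1 else 0) :: ennreal) \<in>
        borel_measurable (lborel \<Otimes>\<^sub>M lborel)"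
      by measurable
    then show "(\<lambda>(y, x). indicator E (u * y) * indicator (ball (u * y) 1) x :: ennreal) \<in>
        borel_measurable (lborel \<Otimes>\<^sub>M lborel)"
      by (simp add: indicator_def ball_def)
  qed
  also have "\<dots> = (\<integral>\<^sup>+y. indicator E (u * y) * ennreal pi \<partial>lborel)"
    by (intro nn_integral_cong, subst nn_integral_cmult_indicator) (auto simp: emeasure_complex_ball)
  also have "\<dots> = (\<integral>\<^sup>+y. indicator E (u * y) \<partial>lborel) * ennreal pi"
    by (rule nn_integral_multc) simp
  also have "(\<integral>\<^sup>+y. indicator E (u * y) \<partial>lborel) = (\<integral>\<^sup>+y. indicator E y \<partial>distr lborel borel (\<lambda>z. u * z))"
    by (subst nn_integral_distr) auto
  also have "\<dots> = emeasure (distr lborel borel (\<lambda>z. u * z)) E"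
    by simp
  finally have eq: "emeasure (distr lborel borel (\<lambda>z. u * z)) E * ennreal pi = emeasure lborel E * ennreal pi"
    using 1 by simp
  have "a * ennreal pi / ennreal pi = a" for a
    by (rule ennreal_mult_divide_eq) auto
  with arg_cong[OF eq, of "\<lambda>a. a / ennreal pi"]
  show "emeasure (distr lborel borel (\<lambda>z. u * z)) E = emeasure lborel E"
    by (simp only:)
qed simp

lemma integral_rotation_eq_zero:
  fixes F :: "complex \<Rightarrow> complex"
  assumes [measurable]: "F \<in> borel_measurable borel"
    and "cmod u = 1" "\<And>z. F (u * z) = - F z"
  shows "(LINT z|lborel. F z) = 0"
proof -
  have "(LINT z|lborel. F z) = (LINT z|distr lborel borel (\<lambda>z. u * z). F z)"
    by (simp add: lborel_distr_rotation assms)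
  also have "\<dots> = (LINT z|lborel. F (u * z))"
    by (rule integral_distr) auto
  also have "\<dots> = - (LINT z|lborel. F z)"
    by (simp add: assms)
  finally show ?thesis by simp
qed

lemma integral_monomials_eq_zero:
  fixes m n :: nat and w :: "real \<Rightarrow> real"
  assumes "m \<noteq> n" and [measurable]: "w \<in> borel_measurable borel"
  shows "(LINT z|lborel. complex_of_real (w (cmod z)) * (z ^ m * cnj z ^ n)) = 0"
proof (rule integral_rotation_eq_zero)
  define k where "k = real m - real n"
  \<comment> \<open>Rotation by the angle pi / (m - n) keeps |z| and multiplies z^m cnj(z)^n by
    exp(i pi) = -1. The difference is taken in the reals because it may be negative.\<close>
  let ?u = "cis (pi / k)"
  have k: "k \<noteq> 0" using assms(1) by (simp add: k_def)
  show "cmod ?u = 1" by simp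
  have "?u ^ m * cnj ?u ^ n = cis (real m * (pi / k)) * cis (- (real n * (pi / k)))"
    by (simp only: cis_cnj Complex.DeMoivre mult_minus_right)
  also have "\<dots> = cis (k * (pi / k))"
    by (simp add: cis_mult k_def left_diff_distrib diff_divide_distrib algebra_simps)
  also have "\<dots> = - 1" using k by simp
  finally have *: "?u ^ m * cnj ?u ^ n = - 1" .
  show "complex_of_real (w (cmod (?u * z))) * ((?u * z) ^ m * cnj (?u * z) ^ n) =
     - (complex_of_real (w (cmod z)) * (z ^ m * cnj z ^ n))" for z
  proof -
    have "complex_of_real (w (cmod (?u * z))) * ((?u * z) ^ m * cnj (?u * z) ^ n) =
      (?u ^ m * cnj ?u ^ n) * (complex_of_real (w (cmod z)) * (z ^ m * cnj z ^ n))"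
      by (simp add: norm_mult power_mult_distrib mult_ac)
    then show ?thesis by (simp add: *)
  qed
  have [measurable]: "cnj \<in> borel_measurable borel"
    by (intro borel_measurable_continuous_onI continuous_intros)
  show "(\<lambda>z. complex_of_real (w (cmod z)) * (z ^ m * cnj z ^ n)) \<in> borel_measurable borel"
    by measurable
qed

text \<open>A substitute for integration in polar coordinates.\<close>

lemma distr_cmod_square:
  "distr (restrict_space lborel (ball (0::complex) 1)) borel (\<lambda>z. (cmod z)\<^sup>2) =
     scale_measure (ennreal pi) (distr (restrict_space lborel {0<..<1::real}) borel (\<lambda>t. t))"
\<comment> \<open>It is |z|^2 and not |z| that is pushed forward because the annulus x < |z|^2 < 1
  has area pi (1 - x), so that the image is a multiple of Lebesgue measure.\<close>
proof (rule measure_eqI_lessThan)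
  let ?B = "ball (0::complex) 1"
  let ?M = "distr (restrict_space lborel ?B) borel (\<lambda>z. (cmod z)\<^sup>2)"
  let ?N = "scale_measure (ennreal pi) (distr (restrict_space lborel {0<..<1::real}) borel (\<lambda>t. t))"
  have m[measurable]: "(\<lambda>z. (cmod z)\<^sup>2) \<in> measurable (restrict_space lborel ?B) borel"
    by (intro measurable_restrict_space1) simp
  have m2[measurable]: "(\<lambda>t. t) \<in> measurable (restrict_space lborel {0<..<1::real}) borel"
    by (intro measurable_restrict_space1) simp
  have M: "emeasure ?M {x<..} = emeasure lborel (?B \<inter> {z. x < (cmod z)\<^sup>2})" for x
    by (subst emeasure_distr[OF m])
       (auto simp: emeasure_restrict_space space_restrict_space intro!: arg_cong[where f="emeasure lborel"])
  have N: "emeasure ?N {x<..} = ennreal pi * emeasure lborel ({0<..<1} \<inter> {x<..})" for x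
    by (simp add: emeasure_distr[OF m2], subst emeasure_restrict_space)
       (auto simp: space_restrict_space intro!: arg_cong[where f="\<lambda>A. ennreal pi * emeasure lborel A"])
  show "emeasure ?M {x<..} < \<infinity>" for x
  proof -
    have "emeasure ?M {x<..} \<le> emeasure lborel ?B"
      unfolding M by (intro emeasure_mono) auto
    also have "\<dots> < \<infinity>" by (simp add: emeasure_complex_ball)
    finally show ?thesis .
  qed
  show "emeasure ?M {x<..} = emeasure ?N {x<..}" for x
  proof -
    consider "x < 0" | "x \<ge> 1" | "0 \<le> x" "x < 1" by linarith
    then show ?thesis
    proof cases
      case 1
      then have "?B \<inter> {z. x < (cmod z)\<^sup>2} = ?B"
        by (auto intro: less_le_trans[OF _ zero_le_power2])
      moreover have "{0<..<1} \<inter> {x<..} = {0<..<1::real}" using 1 by auto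
      ultimately show ?thesis unfolding M N by (simp add: emeasure_complex_ball)
    next
      case 2
      then have "?B \<inter> {z. x < (cmod z)\<^sup>2} = {}"
      proof -
        have "\<not> x < (cmod z)\<^sup>2" if "cmod z < 1" for z :: complex
          using that 2 abs_square_less_1[of "cmod z"] by simp
        then show ?thesis by auto
      qed
      moreover have "{0<..<1} \<inter> {x<..} = ({}::real set)" using 2 by auto
      ultimately show ?thesis unfolding M N by (simp only:) simp
    next
      case 3
      have "x < (cmod z)\<^sup>2 \<longleftrightarrow> \<not> cmod z \<le> sqrt x" for z :: complex
      proof -
        have "(cmod z)\<^sup>2 \<le> x" if "cmod z \<le> sqrt x"
          using power_mono[OF that norm_ge_zero, of 2] 3 by simp
        then show ?thesis using real_le_rsqrt[of "cmod z" x] by linarith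
      qed
      then have "?B \<inter> {z. x < (cmod z)\<^sup>2} = ?B - cball 0 (sqrt x)"
        by (simp only: set_eq_iff Int_iff mem_Collect_eq Diff_iff mem_cball_0 simp_thms)
      moreover have "emeasure lborel (?B - cball 0 (sqrt x)) = emeasure lborel ?B - emeasure lborel (cball (0::complex) (sqrt x))"
      proof (rule emeasure_Diff)
        have "sqrt x < 1" using 3 by simp
        then show "cball 0 (sqrt x) \<subseteq> ?B" by (simp add: cball_subset_ball_iff)
      qed (use 3 in \<open>simp_all add: emeasure_cball\<close>)
      moreover have "{0<..<1} \<inter> {x<..} = {x<..<1::real}" using 3 by auto
      moreover have "emeasure lborel ?B - emeasure lborel (cball (0::complex) (sqrt x)) = ennreal (pi - pi * x)"
        using 3 by (simp add: emeasure_complex_ball emeasure_cball unit_ball_vol_2 ennreal_minus)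
      moreover have "ennreal pi * emeasure lborel {x<..<1::real} = ennreal (pi - pi * x)"
        using 3 by (simp add: ennreal_mult[symmetric] right_diff_distrib)
      ultimately show ?thesis unfolding M N by (simp only:)
    qed
  qed
qed auto

lemma nn_integral_disc_radial:
  fixes \<phi> :: "real \<Rightarrow> ennreal"
  assumes [measurable]: "\<phi> \<in> borel_measurable borel"
  shows "(\<integral>\<^sup>+z\<in>ball (0::complex) 1. \<phi> ((cmod z)\<^sup>2) \<partial>lborel) = ennreal pi * (\<integral>\<^sup>+t\<in>{0<..<1}. \<phi> t \<partial>lborel)"
proof -
  have "(\<integral>\<^sup>+z\<in>ball (0::complex) 1. \<phi> ((cmod z)\<^sup>2) \<partial>lborel) =
      (\<integral>\<^sup>+z. \<phi> ((cmod z)\<^sup>2) \<partial>restrict_space lborel (ball (0::complex) 1))"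
    by (subst nn_integral_restrict_space) auto
  also have "\<dots> = (\<integral>\<^sup>+t. \<phi> t \<partial>distr (restrict_space lborel (ball (0::complex) 1)) borel (\<lambda>z. (cmod z)\<^sup>2))"
    by (subst nn_integral_distr) (auto intro!: measurable_restrict_space1)
  also have "\<dots> = ennreal pi * (\<integral>\<^sup>+t. \<phi> t \<partial>distr (restrict_space lborel {0<..<1::real}) borel (\<lambda>t. t))"
    unfolding distr_cmod_square by (subst nn_integral_scale_measure) auto
  also have "(\<integral>\<^sup>+t. \<phi> t \<partial>distr (restrict_space lborel {0<..<1::real}) borel (\<lambda>t. t)) = (\<integral>\<^sup>+t\<in>{0<..<1}. \<phi> t \<partial>lborel)"
    by (subst nn_integral_distr) (auto intro!: measurable_restrict_space1 simp: nn_integral_restrict_space)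
  finally show ?thesis .
qed

text \<open>With t = |z|^2 this is pi times a Beta integral. Its denominators are the weights
  \<open>(n + 1) * (n + 2)\<close> against which the coefficient sums telescope later.\<close>

lemma nn_integral_disc_moment:
  "(\<integral>\<^sup>+z\<in>ball (0::complex) 1. ennreal ((1 - (cmod z)\<^sup>2) * (cmod z)\<^sup>2 ^ n) \<partial>lborel) =
     ennreal (pi / (real (n + 1) * real (n + 2)))"
proof -
  have "(\<integral>\<^sup>+t\<in>{0..1}. ennreal ((1 - t) * t ^ n) \<partial>lborel) =
      ennreal ((1 ^ (n+1) / real (n+1) - 1 ^ (n+2) / real (n+2)) - (0 ^ (n+1) / real (n+1) - 0 ^ (n+2) / real (n+2)))"
  proof (rule nn_integral_FTC_Icc)
    show "((\<lambda>t. t ^ (n+1) / real (n+1) - t ^ (n+2) / real (n+2)) has_real_derivative ((1 - t) * t ^ n)) (at t)"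
      if "t \<in> {0..1}" for t :: real
      by (rule derivative_eq_intros refl | simp)+ (simp add: field_simps)
  qed auto
  also have "(1 ^ (n+1) / real (n+1) - 1 ^ (n+2) / real (n+2)) - (0 ^ (n+1) / real (n+1) - 0 ^ (n+2) / real (n+2)) = 1 / (real (n + 1) * real (n + 2))"
    by (simp add: field_simps)
  finally have 1: "(\<integral>\<^sup>+t\<in>{0..1}. ennreal ((1 - t) * t ^ n) \<partial>lborel) = ennreal (1 / (real (n + 1) * real (n + 2)))" .
  have "(\<integral>\<^sup>+t\<in>{0<..<1}. ennreal ((1 - t) * t ^ n) \<partial>lborel) = (\<integral>\<^sup>+t\<in>{0..1}. ennreal ((1 - t) * t ^ n) \<partial>lborel)"
  proof (rule nn_integral_cong_AE)
    show "AE t in lborel. ennreal ((1 - t) * t ^ n) * indicator {0<..<1} t = ennreal ((1 - t) * t ^ n) * indicator {0..1} t"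
      using AE_lborel_singleton[of "0::real"] AE_lborel_singleton[of "1::real"]
      by eventually_elim (auto simp: indicator_def)
  qed
  then show ?thesis using 1
    by (subst nn_integral_disc_radial[of "\<lambda>t. ennreal ((1 - t) * t ^ n)"]) (auto simp: ennreal_mult[symmetric])
qed

text \<open>The weight is kept general because it occurs in two forms: 1 - |z|^2 cut off at the unit
  circle, and the indicator of a smaller disc.\<close>

lemma integrable_disc_monomials:
  fixes m n :: nat and w :: "real \<Rightarrow> real"
  assumes [measurable]: "w \<in> borel_measurable borel"
    and w0: "\<And>t. t \<ge> r \<Longrightarrow> w t = 0" and w1: "\<And>t. \<bar>w t\<bar> \<le> 1"
  shows "integrable lborel (\<lambda>z. complex_of_real (w (cmod z)) * (z ^ m * cnj z ^ n))"
proof (rule integrableI_bounded_set[where A="cball 0 (max 0 r)" and B="max 0 r ^ m * max 0 r ^ n"])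
  have [measurable]: "cnj \<in> borel_measurable borel"
    by (intro borel_measurable_continuous_onI continuous_intros)
  show "(\<lambda>z. complex_of_real (w (cmod z)) * (z ^ m * cnj z ^ n)) \<in> borel_measurable lborel"
    by measurable
  show "emeasure lborel (cball (0::complex) (max 0 r)) < \<infinity>"
    by (simp add: emeasure_cball)
  show "AE z in lborel. z \<in> cball 0 (max 0 r) \<longrightarrow>
      cmod (complex_of_real (w (cmod z)) * (z ^ m * cnj z ^ n)) \<le> max 0 r ^ m * max 0 r ^ n"
  proof (intro AE_I2 impI)
    fix z :: complex assume "z \<in> cball 0 (max 0 r)"
    then have z: "cmod z \<le> max 0 r" by simp
    have "cmod (complex_of_real (w (cmod z)) * (z ^ m * cnj z ^ n)) = \<bar>w (cmod z)\<bar> * (cmod z ^ m * cmod z ^ n)"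
      by (simp add: norm_mult norm_power)
    also have "\<dots> \<le> 1 * (max 0 r ^ m * max 0 r ^ n)"
      using z w1 by (intro mult_mono power_mono) auto
    finally show "cmod (complex_of_real (w (cmod z)) * (z ^ m * cnj z ^ n)) \<le> max 0 r ^ m * max 0 r ^ n" by simp
  qed
  show "AE z in lborel. z \<notin> cball 0 (max 0 r) \<longrightarrow> complex_of_real (w (cmod z)) * (z ^ m * cnj z ^ n) = 0"
    using w0 by (auto intro!: AE_I2)
qed auto

lemma nn_integral_disc_polynomial:
  fixes a :: "nat \<Rightarrow> complex"
  shows "(\<integral>\<^sup>+z\<in>ball (0::complex) 1. ennreal ((1 - (cmod z)\<^sup>2) * (cmod (\<Sum>n<N. a n * z ^ n))\<^sup>2) \<partial>lborel) =
     ennreal (pi * (\<Sum>n<N. (cmod (a n))\<^sup>2 / (real (n + 1) * real (n + 2))))"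
proof -
  \<comment> \<open>The cutoff at -1 keeps \<open>w\<close> between 0 and 1 on the whole line,
    whereas 1 - t^2 alone is unbounded below.\<close>
  define w :: "real \<Rightarrow> real" where "w t = indicator {-1<..<1} t * (1 - t\<^sup>2)" for t
  have [measurable]: "w \<in> borel_measurable borel"
    unfolding w_def by measurable
  have w0: "w t = 0" if "t \<ge> 1" for t using that by (simp add: w_def indicator_def)
  have w1: "0 \<le> w t \<and> \<bar>w t\<bar> \<le> 1" for t
    using abs_square_less_1[of t] zero_le_power2[of t] by (auto simp: w_def indicator_def)
  have w_ball: "w (cmod z) = indicator (ball 0 1) z * (1 - (cmod z)\<^sup>2)" for z :: complex
    by (auto simp: w_def indicator_def intro: less_le_trans[of "-1" 0])
  let ?p = "\<lambda>z. \<Sum>n<N. a n * z ^ n"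
  let ?W = "\<lambda>m n z. complex_of_real (w (cmod z)) * (z ^ m * cnj z ^ n)"
  have int: "integrable lborel (?W m n)" for m n
    by (rule integrable_disc_monomials[where r=1]) (use w0 w1 in \<open>simp_all add: w1\<close>)
  have diag: "integral\<^sup>L lborel (?W n n) = complex_of_real (pi / (real (n + 1) * real (n + 2)))" for n
  proof -
    have eq: "?W n n z = complex_of_real (w (cmod z) * (cmod z)\<^sup>2 ^ n)" for z
      by (simp add: power_mult_distrib[symmetric] complex_norm_square[symmetric])
    have "(\<integral>\<^sup>+z. ennreal (w (cmod z) * (cmod z)\<^sup>2 ^ n) \<partial>lborel) =
        (\<integral>\<^sup>+z\<in>ball (0::complex) 1. ennreal ((1 - (cmod z)\<^sup>2) * (cmod z)\<^sup>2 ^ n) \<partial>lborel)"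
      by (intro nn_integral_cong) (auto simp: w_ball indicator_def)
    also have "\<dots> = ennreal (pi / (real (n + 1) * real (n + 2)))"
      by (rule nn_integral_disc_moment)
    finally have "(LINT z|lborel. w (cmod (z::complex)) * (cmod z)\<^sup>2 ^ n) = pi / (real (n + 1) * real (n + 2))"
      using w1 by (subst integral_eq_nn_integral) auto
    then show ?thesis unfolding eq by (subst integral_complex_of_real) simp
  qed
  have expand: "complex_of_real (w (cmod z) * (cmod (?p z))\<^sup>2) = (\<Sum>m<N. \<Sum>n<N. a m * cnj (a n) * ?W m n z)" for z
  proof -
    have "complex_of_real (w (cmod z) * (cmod (?p z))\<^sup>2) = complex_of_real (w (cmod z)) * (?p z * cnj (?p z))"
      by (simp only: of_real_mult complex_norm_square)
    then show ?thesis
      by (simp only: cnj_sum complex_cnj_mult complex_cnj_power sum_product, simp only: sum_distrib_left mult_ac)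
  qed
  have int2: "integrable lborel (\<lambda>z. complex_of_real (w (cmod z) * (cmod (?p z))\<^sup>2))"
    unfolding expand using int by (intro Bochner_Integration.integrable_sum integrable_mult_right)
  have "(LINT z|lborel. complex_of_real (w (cmod z) * (cmod (?p z))\<^sup>2)) =
      (\<Sum>m<N. \<Sum>n<N. a m * cnj (a n) * integral\<^sup>L lborel (?W m n))"
    unfolding expand using int by (simp add: Bochner_Integration.integral_sum)
  also have "\<dots> = (\<Sum>m<N. \<Sum>n<N. if n = m then a m * cnj (a m) * complex_of_real (pi / (real (m + 1) * real (m + 2))) else 0)"
  proof (intro sum.cong refl)
    fix m n
    show "a m * cnj (a n) * integral\<^sup>L lborel (?W m n) =
       (if n = m then a m * cnj (a m) * complex_of_real (pi / (real (m + 1) * real (m + 2))) else 0)"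
      using integral_monomials_eq_zero[of m n w] by (auto simp: diag)
  qed
  also have "\<dots> = (\<Sum>m<N. complex_of_real (pi * ((cmod (a m))\<^sup>2 / (real (m + 1) * real (m + 2)))))"
    by (intro sum.cong refl) (simp add: complex_norm_square[symmetric])
  finally have "(LINT z|lborel. complex_of_real (w (cmod z) * (cmod (?p z))\<^sup>2)) =
      complex_of_real (pi * (\<Sum>n<N. (cmod (a n))\<^sup>2 / (real (n + 1) * real (n + 2))))"
    by (simp add: sum_distrib_left)
  then have val: "(LINT z|lborel. w (cmod z) * (cmod (?p z))\<^sup>2) = pi * (\<Sum>n<N. (cmod (a n))\<^sup>2 / (real (n + 1) * real (n + 2)))"
    unfolding integral_complex_of_real of_real_eq_iff .
  have "(\<integral>\<^sup>+z\<in>ball (0::complex) 1. ennreal ((1 - (cmod z)\<^sup>2) * (cmod (?p z))\<^sup>2) \<partial>lborel) =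
     (\<integral>\<^sup>+z. ennreal (w (cmod z) * (cmod (?p z))\<^sup>2) \<partial>lborel)"
    by (intro nn_integral_cong) (auto simp: w_ball indicator_def)
  also have "\<dots> = ennreal (LINT z|lborel. w (cmod z) * (cmod (?p z))\<^sup>2)"
    using int2 w1 by (intro nn_integral_eq_integral) (simp_all only: complex_of_real_integrable_eq, auto)
  finally show ?thesis by (simp only: val)
qed

text \<open>Fatou's lemma for the partial sums, which converge pointwise in the disc; an upper bound
  is all that is asked of the limit.\<close>

lemma nn_integral_disc_power_series_le:
  fixes a :: "nat \<Rightarrow> complex"
  assumes sums: "\<And>z. z \<in> ball 0 1 \<Longrightarrow> (\<lambda>n. a n * z ^ n) sums h z"
    and le: "\<And>N. (\<Sum>n<N. (cmod (a n))\<^sup>2 / (real (n + 1) * real (n + 2))) \<le> C"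
  shows "(\<integral>\<^sup>+z\<in>ball (0::complex) 1. ennreal ((1 - (cmod z)\<^sup>2) * (cmod (h z))\<^sup>2) \<partial>lborel) \<le> ennreal (pi * C)"
proof -
  let ?p = "\<lambda>N z. \<Sum>n<N. a n * z ^ n"
  let ?u = "\<lambda>N z. ennreal ((1 - (cmod z)\<^sup>2) * (cmod (?p N z))\<^sup>2) * indicator (ball 0 1) z"
  have lim: "(\<lambda>N. ?u N z) \<longlonglongrightarrow> ennreal ((1 - (cmod z)\<^sup>2) * (cmod (h z))\<^sup>2) * indicator (ball 0 1) z" for z
  proof (cases "z \<in> ball 0 1")
    case True
    then have "(\<lambda>N. ?p N z) \<longlonglongrightarrow> h z" using sums by (simp add: sums_def)
    then show ?thesis using True by (auto intro!: tendsto_intros tendsto_ennrealI)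
  qed auto
  have "(\<integral>\<^sup>+z\<in>ball (0::complex) 1. ennreal ((1 - (cmod z)\<^sup>2) * (cmod (h z))\<^sup>2) \<partial>lborel) =
     (\<integral>\<^sup>+z. liminf (\<lambda>N. ?u N z) \<partial>lborel)"
    using lim_imp_Liminf[OF sequentially_bot lim] by simp
  also have "\<dots> \<le> liminf (\<lambda>N. \<integral>\<^sup>+z. ?u N z \<partial>lborel)"
    by (intro nn_integral_liminf borel_measurable_times_ennreal borel_measurable_indicator) measurable
  also have "\<dots> = liminf (\<lambda>N. ennreal (pi * (\<Sum>n<N. (cmod (a n))\<^sup>2 / (real (n + 1) * real (n + 2)))))"
    by (simp only: nn_integral_disc_polynomial)
  also have "\<dots> \<le> liminf (\<lambda>N. ennreal (pi * C))"
    using le by (intro Liminf_mono always_eventually allI ennreal_leI mult_left_mono) auto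
  finally show ?thesis by (simp add: Liminf_const)
qed

text \<open>The mean value property is applied to the holomorphic function h^2 rather than to the
  subharmonic |h|^2: over a disc about \<open>c\<close> every term of its power series except the
  constant one integrates to zero, and the modulus is moved inside afterwards.\<close>

lemma ball_mean_value_le:
  assumes hol: "h holomorphic_on ball c R" and r: "0 < r" "r < R"
  shows "ennreal ((cmod (h c))\<^sup>2 * (pi * r\<^sup>2)) \<le> (\<integral>\<^sup>+z\<in>ball c r. ennreal ((cmod (h z))\<^sup>2) \<partial>lborel)"
proof -
  define g where "g z = (h (c + z))\<^sup>2" for z
  have hol_g: "g holomorphic_on ball 0 R"
  proof -
    have "(\<lambda>z. h (c + z)) holomorphic_on ball 0 R"
      by (rule holomorphic_on_compose_gen[OF _ hol, of "\<lambda>z. c + z", unfolded o_def])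
         (auto intro!: holomorphic_intros simp: dist_norm)
    then show ?thesis unfolding g_def by (rule holomorphic_on_power)
  qed
  define b where "b n = (deriv ^^ n) g 0 / fact n" for n
  have sums: "(\<lambda>n. b n * z ^ n) sums g z" if "z \<in> ball 0 R" for z
    using holomorphic_power_series[OF hol_g that] by (simp add: b_def)
  have b0: "b 0 = g 0" by (simp add: b_def)
  define w :: "real \<Rightarrow> real" where "w = indicator {..<r}"
  have [measurable]: "w \<in> borel_measurable borel" unfolding w_def by simp
  have w_ball: "w (cmod z) = indicator (ball 0 r) z" for z :: complex
    by (simp add: w_def indicator_def)
  let ?s = "\<lambda>N z. complex_of_real (w (cmod z)) * (\<Sum>n<N. b n * z ^ n)"
  have int: "integrable lborel (\<lambda>z. complex_of_real (w (cmod z)) * z ^ n)" for n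
    using integrable_disc_monomials[of w r n 0] by (auto simp: w_def indicator_def)
  have s_eq: "?s N z = (\<Sum>n<N. b n * (complex_of_real (w (cmod z)) * z ^ n))" for N z
    by (simp add: sum_distrib_left mult_ac)
  \<comment> \<open>\<open>Suc N\<close> guarantees that the constant term is present in the partial
    sum.\<close>
  have val: "integral\<^sup>L lborel (?s (Suc N)) = g 0 * complex_of_real (pi * r\<^sup>2)" for N
  proof -
    have z: "(LINT z|lborel. complex_of_real (w (cmod z)) * z ^ n) = 0" if "n \<noteq> 0" for n
      using integral_monomials_eq_zero[of n 0 w] that by simp
    have 0: "(LINT z|lborel. w (cmod (z::complex))) = pi * r\<^sup>2"
      using r by (simp add: w_ball measure_def emeasure_complex_ball)
    have "integral\<^sup>L lborel (?s (Suc N)) = (\<Sum>n<Suc N. b n * (LINT z|lborel. complex_of_real (w (cmod z)) * z ^ n))"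
      unfolding s_eq using int by (simp add: Bochner_Integration.integral_sum)
    also have "\<dots> = b 0 * (LINT z|lborel. complex_of_real (w (cmod z)) * z ^ 0)"
      unfolding sum.lessThan_Suc_shift by (simp only: z nat.simps not_False_eq_True, simp)
    finally show ?thesis by (simp only: b0 power_0 mult_1_right integral_complex_of_real 0)
  qed
  \<comment> \<open>The series converges at a radius strictly between r and R, hence absolutely at
    r; its absolute sum there is a constant majorant for all partial sums on the disc.\<close>
  define S where "S = (\<Sum>n. cmod (b n) * r ^ n)"
  have summable: "summable (\<lambda>n. cmod (b n) * r ^ n)"
  proof -
    define \<rho> where "\<rho> = (r + R) / 2"
    have \<rho>: "r < \<rho>" "\<rho> < R" using r by (auto simp: \<rho>_def)
    have "summable (\<lambda>n. b n * complex_of_real \<rho> ^ n)"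
      using sums[of "complex_of_real \<rho>"] \<rho> r by (auto simp: summable_def)
    then have "summable (\<lambda>n. norm (b n * complex_of_real r ^ n))"
      using \<rho> r by (intro powser_insidea[where x="complex_of_real \<rho>"]) auto
    then show ?thesis using r by (simp add: norm_mult norm_power)
  qed
  have dom: "cmod (?s N z) \<le> S * indicator (ball 0 r) z" for N z
  proof (cases "z \<in> ball 0 r")
    case True
    then have z: "cmod z \<le> r" by simp
    have "cmod (\<Sum>n<N. b n * z ^ n) \<le> (\<Sum>n<N. cmod (b n) * r ^ n)"
      using z by (intro sum_norm_le) (auto simp: norm_mult norm_power intro!: mult_left_mono power_mono)
    also have "\<dots> \<le> S"
      unfolding S_def using r by (intro sum_le_suminf summable) auto
    finally show ?thesis using True by (simp add: w_ball)
  qed (simp add: w_ball)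
  have int_S: "integrable lborel (\<lambda>z::complex. S * indicator (ball 0 r) z)"
    using r by (intro integrable_mult_right integrable_real_indicator) (auto simp: emeasure_complex_ball)
  have lim: "(\<lambda>N. ?s N z) \<longlonglongrightarrow> indicator (ball 0 r) z *\<^sub>R g z" for z
  proof (cases "z \<in> ball 0 r")
    case True
    then show ?thesis using sums[of z] r by (auto simp: w_ball sums_def)
  qed (simp add: w_ball)
  have meas_s: "?s N \<in> borel_measurable lborel" for N by measurable
  have meas_g: "(\<lambda>z. indicator (ball 0 r) z *\<^sub>R g z) \<in> borel_measurable lborel"
    using borel_measurable_LIMSEQ_metric[OF meas_s lim] .
  have int_g: "integrable lborel (\<lambda>z. indicator (ball 0 r) z *\<^sub>R g z)"
    by (rule integrable_dominated_convergence[OF meas_g meas_s int_S]) (rule AE_I2, rule lim dom)+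
  have "(\<lambda>N. integral\<^sup>L lborel (?s N)) \<longlonglongrightarrow> (LINT z|lborel. indicator (ball 0 r) z *\<^sub>R g z)"
    by (rule integral_dominated_convergence[OF meas_g meas_s int_S]) (rule AE_I2, rule lim dom)+
  then have "(\<lambda>N. integral\<^sup>L lborel (?s (Suc N))) \<longlonglongrightarrow> (LINT z|lborel. indicator (ball 0 r) z *\<^sub>R g z)"
    by (rule LIMSEQ_Suc)
  then have eq: "(LINT z|lborel. indicator (ball 0 r) z *\<^sub>R g z) = g 0 * complex_of_real (pi * r\<^sup>2)"
    unfolding val by (rule LIMSEQ_unique[OF _ tendsto_const])
  have "ennreal ((cmod (h c))\<^sup>2 * (pi * r\<^sup>2)) = ennreal (norm (LINT z|lborel. indicator (ball 0 r) z *\<^sub>R g z))"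
    unfolding eq by (simp add: g_def norm_mult norm_power)
  also have "\<dots> \<le> (\<integral>\<^sup>+z. norm (indicator (ball 0 r) z *\<^sub>R g z) \<partial>lborel)"
    by (rule integral_norm_bound_ennreal[OF int_g])
  also have "\<dots> = (\<integral>\<^sup>+z. ennreal ((cmod (h (c + z)))\<^sup>2) * indicator (ball c r) (c + z) \<partial>lborel)"
    by (intro nn_integral_cong) (auto simp: g_def indicator_def norm_power dist_norm)
  also have "\<dots> = (\<integral>\<^sup>+z\<in>ball c r. ennreal ((cmod (h z))\<^sup>2) \<partial>lborel)"
  proof (rule nn_integral_lborel_translate)
    have "continuous_on (ball c r) (\<lambda>z. (cmod (h z))\<^sup>2)"
      using r by (intro continuous_intros holomorphic_on_imp_continuous_on holomorphic_on_subset[OF hol]) auto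
    then have "(\<lambda>z. indicator (ball c r) z *\<^sub>R (cmod (h z))\<^sup>2) \<in> borel_measurable borel"
      by (intro borel_measurable_continuous_on_indicator) auto
    then have "(\<lambda>z. ennreal (indicator (ball c r) z *\<^sub>R (cmod (h z))\<^sup>2)) \<in> borel_measurable borel" by simp
    also have "(\<lambda>z. ennreal (indicator (ball c r) z *\<^sub>R (cmod (h z))\<^sup>2)) = (\<lambda>z. ennreal ((cmod (h z))\<^sup>2) * indicator (ball c r) z)"
      by (auto simp: indicator_def)
    finally show "(\<lambda>z. ennreal ((cmod (h z))\<^sup>2) * indicator (ball c r) z) \<in> borel_measurable borel" .
  qed
  finally show ?thesis .
qed

section \<open>Means over the unit circle and the disc algebra\<close>

text \<open>The parametrization is that of \<open>circlepath 0 1\<close>, so that contour integrals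
  translate directly, and the total mass is one.\<close>

definition circle_mean :: "(complex \<Rightarrow> 'a::banach) \<Rightarrow> 'a" where
  "circle_mean F = integral {0..1} (\<lambda>t. F (exp (2 * of_real pi * \<i> * of_real t)))"

lemma circle_mean_integrable:
  fixes F :: "complex \<Rightarrow> 'a::banach"
  assumes "continuous_on (sphere 0 1) F"
  shows "(\<lambda>t. F (exp (2 * of_real pi * \<i> * of_real t))) integrable_on {0..1}"
  by (rule integrable_continuous_real, rule continuous_on_compose2[OF assms]) (auto intro!: continuous_intros)

lemma circle_mean_cong:
  assumes "\<And>z. cmod z = 1 \<Longrightarrow> F z = G z"
  shows "circle_mean F = circle_mean G"
  unfolding circle_mean_def by (intro integral_cong assms) simp

lemma circle_mean_add:
  assumes "continuous_on (sphere 0 1) F" "continuous_on (sphere 0 1) G"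
  shows "circle_mean (\<lambda>z. F z + G z) = circle_mean F + circle_mean G"
  unfolding circle_mean_def by (intro integral_add circle_mean_integrable assms)

lemma circle_mean_diff:
  assumes "continuous_on (sphere 0 1) F" "continuous_on (sphere 0 1) G"
  shows "circle_mean (\<lambda>z. F z - G z) = circle_mean F - circle_mean G"
  unfolding circle_mean_def by (intro integral_diff circle_mean_integrable assms)

lemma circle_mean_sum:
  assumes "finite A" "\<And>i. i \<in> A \<Longrightarrow> continuous_on (sphere 0 1) (F i)"
  shows "circle_mean (\<lambda>z. \<Sum>i\<in>A. F i z) = (\<Sum>i\<in>A. circle_mean (F i))"
  unfolding circle_mean_def by (intro integral_sum circle_mean_integrable assms)

lemma circle_mean_cmult:
  fixes F :: "complex \<Rightarrow> complex"
  shows "circle_mean (\<lambda>z. c * F z) = c * circle_mean F"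
  unfolding circle_mean_def by (rule integral_mult_right)

lemma circle_mean_cmult_real:
  fixes F :: "complex \<Rightarrow> real"
  shows "circle_mean (\<lambda>z. c * F z) = c * circle_mean F"
  unfolding circle_mean_def by (rule integral_mult_right)

lemma circle_mean_mono:
  fixes F :: "complex \<Rightarrow> real"
  assumes "continuous_on (sphere 0 1) F" "continuous_on (sphere 0 1) G"
    and "\<And>z. cmod z = 1 \<Longrightarrow> F z \<le> G z"
  shows "circle_mean F \<le> circle_mean G"
  unfolding circle_mean_def by (intro integral_le circle_mean_integrable assms) auto

lemma circle_mean_nonneg:
  fixes F :: "complex \<Rightarrow> real"
  assumes "continuous_on (sphere 0 1) F" "\<And>z. F z \<ge> 0"
  shows "circle_mean F \<ge> 0"
  unfolding circle_mean_def by (intro integral_nonneg circle_mean_integrable assms)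

lemma circle_mean_of_real:
  fixes F :: "complex \<Rightarrow> real"
  assumes "continuous_on (sphere 0 1) F"
  shows "circle_mean (\<lambda>z. complex_of_real (F z)) = complex_of_real (circle_mean F)"
  unfolding circle_mean_def
  using integral_linear[OF circle_mean_integrable[OF assms] bounded_linear_of_real] by (simp add: o_def)

lemma circle_mean_cnj:
  fixes F :: "complex \<Rightarrow> complex"
  shows "circle_mean (\<lambda>z. cnj (F z)) = cnj (circle_mean F)"
  unfolding circle_mean_def by (simp add: integral_cnj)

text \<open>Along this parametrization dz = 2 pi i z dt, hence the extra factor \<open>z\<close> and
  the normalization.\<close>

lemma circle_mean_contour:
  assumes "(F has_contour_integral I) (circlepath 0 1)"
  shows "circle_mean (\<lambda>z. z * F z) = I / (2 * of_real pi * \<i>)"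
proof -
  let ?e = "\<lambda>t. exp (2 * of_real pi * \<i> * complex_of_real t)"
  have "((\<lambda>t. F (circlepath 0 1 t) * vector_derivative (circlepath 0 1) (at t within {0..1})) has_integral I) {0..1}"
    using assms by (simp add: has_contour_integral_def)
  then have "((\<lambda>t. (2 * of_real pi * \<i>) * (?e t * F (?e t))) has_integral I) {0..1}"
    by (rule has_integral_eq[rotated]) (subst vector_derivative_circlepath01, simp_all add: circlepath mult_ac)
  then have "integral {0..1} (\<lambda>t. (2 * of_real pi * \<i>) * (?e t * F (?e t))) = I"
    by (rule integral_unique)
  then have "(2 * of_real pi * \<i>) * circle_mean (\<lambda>z. z * F z) = I"
    unfolding circle_mean_def by (subst (asm) integral_mult_right)
  then show ?thesis by (simp add: field_simps)
qed

text \<open>The part of the Hardy space in which all computations take place: its members have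
  continuous boundary values, so the squared Hardy norm is the circle mean of the squared modulus.
  Values off the closed disc are left free.\<close>

definition disc_algebra :: "(complex \<Rightarrow> complex) set" where
  "disc_algebra = {g. continuous_on (cball 0 1) g \<and> g holomorphic_on ball 0 1}"

lemma disc_algebra_const: "(\<lambda>z. c) \<in> disc_algebra"
  and disc_algebra_id: "(\<lambda>z. z) \<in> disc_algebra"
  and disc_algebra_add: "f \<in> disc_algebra \<Longrightarrow> g \<in> disc_algebra \<Longrightarrow> (\<lambda>z. f z + g z) \<in> disc_algebra"
  and disc_algebra_diff: "f \<in> disc_algebra \<Longrightarrow> g \<in> disc_algebra \<Longrightarrow> (\<lambda>z. f z - g z) \<in> disc_algebra"
  and disc_algebra_mult: "f \<in> disc_algebra \<Longrightarrow> g \<in> disc_algebra \<Longrightarrow> (\<lambda>z. f z * g z) \<in> disc_algebra"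
  and disc_algebra_power: "f \<in> disc_algebra \<Longrightarrow> (\<lambda>z. f z ^ n) \<in> disc_algebra"
  and disc_algebra_sum: "(\<And>i. i \<in> A \<Longrightarrow> F i \<in> disc_algebra) \<Longrightarrow> (\<lambda>z. \<Sum>i\<in>A. F i z) \<in> disc_algebra"
  and disc_algebra_prod: "(\<And>i. i \<in> A \<Longrightarrow> F i \<in> disc_algebra) \<Longrightarrow> (\<lambda>z. \<Prod>i\<in>A. F i z) \<in> disc_algebra"
  by (auto simp: disc_algebra_def intro!: continuous_intros holomorphic_intros)

lemma one_minus_cnj_mult_nonzero:
  assumes "cmod w < 1" "cmod z \<le> 1"
  shows "1 - cnj w * z \<noteq> 0"
proof
  assume "1 - cnj w * z = 0"
  then have "cmod (cnj w * z) = 1" by (metis norm_one right_minus_eq)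
  moreover have "cmod (cnj w * z) < 1"
    using assms mult_mono[of "cmod w" "cmod w" "cmod z" 1] by (simp add: norm_mult)
  ultimately show False by simp
qed

lemma disc_algebra_divide:
  assumes "f \<in> disc_algebra" "cmod w < 1"
  shows "(\<lambda>z. f z / (1 - cnj w * z)) \<in> disc_algebra"
  using assms one_minus_cnj_mult_nonzero[OF assms(2)]
  by (auto simp: disc_algebra_def intro!: continuous_intros holomorphic_intros)

lemmas disc_algebra_intros = disc_algebra_const disc_algebra_id disc_algebra_add disc_algebra_diff
  disc_algebra_mult disc_algebra_power disc_algebra_sum disc_algebra_prod disc_algebra_divide

lemma disc_algebra_continuous_on_sphere: "g \<in> disc_algebra \<Longrightarrow> continuous_on (sphere 0 1) g"
  unfolding disc_algebra_def by (auto intro: continuous_on_subset)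

lemma circle_mean_reproducing:
  assumes g: "g \<in> disc_algebra" and w: "cmod w < 1"
  shows "circle_mean (\<lambda>z. g z * cnj (1 / (1 - cnj w * z))) = g w"
proof -
  have "((\<lambda>u. g u / (u - w)) has_contour_integral (2 * of_real pi * \<i> * g w)) (circlepath 0 1)"
    using g w by (intro Cauchy_integral_circlepath) (auto simp: disc_algebra_def)
  from circle_mean_contour[OF this] have "circle_mean (\<lambda>z. z * (g z / (z - w))) = g w" by simp
  also have "circle_mean (\<lambda>z. z * (g z / (z - w))) = circle_mean (\<lambda>z. g z * cnj (1 / (1 - cnj w * z)))"
  \<comment> \<open>On the circle cnj z = 1/z, which turns the Cauchy kernel z / (z - w) into the
    conjugate of 1 / (1 - cnj w z).\<close>
  proof (rule circle_mean_cong)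
    fix z :: complex assume z: "cmod z = 1"
    then have zz: "z * cnj z = 1" by (simp add: complex_norm_square[symmetric])
    have "z * (1 - w * cnj z) = z - w" using zz by (simp add: algebra_simps)
    moreover have "1 - w * cnj z \<noteq> 0"
      using one_minus_cnj_mult_nonzero[OF w, of z] z complex_cnj_cancel_iff[of "1 - cnj w * z" 0] by simp
    moreover have "z \<noteq> 0" using z by auto
    ultimately have "z / (z - w) = 1 / (1 - w * cnj z)"
      by (metis div_by_1 mult.right_neutral mult_divide_mult_cancel_left)
    moreover have "z * (g z / (z - w)) = g z * (z / (z - w))" by simp
    ultimately show "z * (g z / (z - w)) = g z * cnj (1 / (1 - cnj w * z))"
      by simp
  qed
  finally show ?thesis .
qed

lemma circle_mean_coefficient:
  assumes g: "g \<in> disc_algebra"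
  shows "circle_mean (\<lambda>z. g z * cnj z ^ n) = (deriv ^^ n) g 0 / fact n"
proof -
  have "((\<lambda>u. g u / (u - 0) ^ Suc n) has_contour_integral ((2 * pi * \<i>) / fact n * (deriv ^^ n) g 0)) (circlepath 0 1)"
    using g by (intro Cauchy_has_contour_integral_higher_derivative_circlepath) (auto simp: disc_algebra_def)
  from circle_mean_contour[OF this]
  have "circle_mean (\<lambda>z. z * (g z / (z - 0) ^ Suc n)) = (deriv ^^ n) g 0 / fact n" by simp
  also have "circle_mean (\<lambda>z. z * (g z / (z - 0) ^ Suc n)) = circle_mean (\<lambda>z. g z * cnj z ^ n)"
  proof (rule circle_mean_cong)
    fix z :: complex assume z: "cmod z = 1"
    then have zz: "z * cnj z = 1" by (simp add: complex_norm_square[symmetric])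
    then have "z ^ n * cnj z ^ n = 1" by (simp flip: power_mult_distrib)
    moreover have "z \<noteq> 0" using z by auto
    ultimately show "z * (g z / (z - 0) ^ Suc n) = g z * cnj z ^ n"
      by (simp add: field_simps)
  qed
  finally show ?thesis .
qed

lemma circle_mean_monomials: "circle_mean (\<lambda>z. z ^ m * cnj z ^ n) = (if m = n then 1 else 0)"
proof -
  have le: "circle_mean (\<lambda>z. z ^ m * cnj z ^ n) = (if m = n then 1 else 0)" if "n \<le> m" for m n
  proof -
    have "circle_mean (\<lambda>z. z ^ m * cnj z ^ n) = circle_mean (\<lambda>z. z ^ (m - n) * cnj z ^ 0)"
    proof (rule circle_mean_cong)
      fix z :: complex assume z: "cmod z = 1"
      then have zz: "z * cnj z = 1" by (simp add: complex_norm_square[symmetric])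
      have "z ^ m = z ^ (m - n) * z ^ n" using that by (simp flip: power_add)
      moreover have "z ^ n * cnj z ^ n = 1" using zz by (simp flip: power_mult_distrib)
      ultimately show "z ^ m * cnj z ^ n = z ^ (m - n) * cnj z ^ 0" by (simp add: mult.assoc)
    qed
    also have "\<dots> = (deriv ^^ 0) (\<lambda>z. z ^ (m - n)) 0 / fact 0"
      by (intro circle_mean_coefficient disc_algebra_intros)
    finally show ?thesis using that by auto
  qed
  show ?thesis
  proof (cases "n \<le> m")
    case False
    have "circle_mean (\<lambda>z. z ^ m * cnj z ^ n) = cnj (circle_mean (\<lambda>z. z ^ n * cnj z ^ m))"
      by (simp add: circle_mean_cnj[symmetric] mult.commute)
    then show ?thesis using le[of m n] False by simp
  qed (use le in auto)
qed

text \<open>Expand the nonnegative mean of |g - p|^2, where p is a Taylor polynomial of g: the mean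
  of g cnj p and that of |p|^2 both equal the coefficient sum, so one copy of it is subtracted from
  the mean of |g|^2.\<close>

lemma bessel_coefficients:
  assumes g: "g \<in> disc_algebra"
  shows "(\<Sum>n<N. (cmod ((deriv ^^ n) g 0 / fact n))\<^sup>2) \<le> circle_mean (\<lambda>z. (cmod (g z))\<^sup>2)"
proof -
  define b where "b n = (deriv ^^ n) g 0 / fact n" for n
  define p where "p z = (\<Sum>n<N. b n * z ^ n)" for z
  have cg: "continuous_on (sphere 0 1) g" by (rule disc_algebra_continuous_on_sphere[OF g])
  have cp: "continuous_on (sphere 0 1) p" unfolding p_def by (intro continuous_intros)
  let ?S = "\<Sum>n<N. (cmod (b n))\<^sup>2"
  have gp: "circle_mean (\<lambda>z. g z * cnj (p z)) = of_real ?S"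
  proof -
    have "circle_mean (\<lambda>z. g z * cnj (p z)) = circle_mean (\<lambda>z. \<Sum>n<N. cnj (b n) * (g z * cnj z ^ n))"
      by (simp add: p_def sum_distrib_left mult_ac)
    also have "\<dots> = (\<Sum>n<N. cnj (b n) * b n)"
      by (subst circle_mean_sum)
        (auto intro!: continuous_intros cg simp only: circle_mean_cmult circle_mean_coefficient[OF g] b_def)
    also have "\<dots> = of_real ?S"
      by (simp only: of_real_sum complex_norm_square mult.commute)
    finally show ?thesis .
  qed
  have pp: "circle_mean (\<lambda>z. p z * cnj (p z)) = of_real ?S"
  proof -
    have "circle_mean (\<lambda>z. p z * cnj (p z)) = circle_mean (\<lambda>z. \<Sum>m<N. \<Sum>n<N. b m * cnj (b n) * (z ^ m * cnj z ^ n))"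
      by (simp add: p_def sum_product mult_ac)
    also have "\<dots> = (\<Sum>m<N. \<Sum>n<N. b m * cnj (b n) * circle_mean (\<lambda>z. z ^ m * cnj z ^ n))"
      by (subst circle_mean_sum, simp, intro continuous_intros, intro sum.cong refl, subst circle_mean_sum)
         (auto intro!: continuous_intros simp only: circle_mean_cmult)
    also have "\<dots> = (\<Sum>m<N. \<Sum>n<N. if m = n then b m * cnj (b m) else 0)"
      by (intro sum.cong refl) (simp add: circle_mean_monomials)
    also have "\<dots> = of_real ?S"
      by (simp add: complex_norm_square del: of_real_power)
    finally show ?thesis .
  qed
  have gg: "circle_mean (\<lambda>z. g z * cnj (g z)) = of_real (circle_mean (\<lambda>z. (cmod (g z))\<^sup>2))"
    by (subst circle_mean_of_real[symmetric]) (intro continuous_intros cg, simp only: complex_norm_square)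
  have "complex_of_real (circle_mean (\<lambda>z. (cmod (g z - p z))\<^sup>2)) =
      circle_mean (\<lambda>z. g z * cnj (g z) - g z * cnj (p z) - cnj (g z * cnj (p z)) + p z * cnj (p z))"
    by (subst circle_mean_of_real[symmetric])
       (intro continuous_intros cg cp, simp only: complex_norm_square, simp add: algebra_simps)
  also have "\<dots> = of_real (circle_mean (\<lambda>z. (cmod (g z))\<^sup>2)) - of_real ?S - of_real ?S + of_real ?S"
    apply (subst circle_mean_add, intro continuous_intros cg cp, intro continuous_intros cg cp)
    apply (subst circle_mean_diff, intro continuous_intros cg cp, intro continuous_intros cg cp)
    apply (subst circle_mean_diff, intro continuous_intros cg cp, intro continuous_intros cg cp)
    by (simp only: gp pp gg circle_mean_cnj complex_cnj_complex_of_real)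
  also have "\<dots> = complex_of_real (circle_mean (\<lambda>z. (cmod (g z))\<^sup>2) - ?S)"
    by (simp only: of_real_diff of_real_add) simp
  finally have "circle_mean (\<lambda>z. (cmod (g z - p z))\<^sup>2) = circle_mean (\<lambda>z. (cmod (g z))\<^sup>2) - ?S"
    by (simp only: of_real_eq_iff)
  moreover have "circle_mean (\<lambda>z. (cmod (g z - p z))\<^sup>2) \<ge> 0"
    by (intro circle_mean_nonneg continuous_intros cg cp) auto
  ultimately show ?thesis by (simp add: b_def)
qed

section \<open>Local Dirichlet integrals\<close>

text \<open>With \<open>S\<^sub>n = \<Sum>k\<le>n. b\<^sub>k p\<^sup>k\<close> the weighted squares of the Taylor coefficients of
  \<open>((z - p) g)' / (1 - cnj p z)\<close> telescope against \<open>|S\<^sub>n|\<^sup>2 / (n + 1)\<close>.\<close>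

lemma telescoping_coefficient_sum:
  fixes b :: "nat \<Rightarrow> complex"
  assumes p: "cmod p = 1"
  defines "a \<equiv> \<lambda>n. (\<Sum>k\<le>n. b k * cnj p ^ (n - k)) - p * (of_nat (Suc n) * b (Suc n))"
  shows "(\<Sum>n<N. (cmod (a n))\<^sup>2 / (real (n + 1) * real (n + 2))) =
    (\<Sum>n<Suc N. (cmod (b n))\<^sup>2) - (cmod (\<Sum>k\<le>N. b k * p ^ k))\<^sup>2 / real (N + 1)"
proof (induction N)
  case 0
  then show ?case by simp
next
  case (Suc N)
  define S where "S = (\<Sum>k\<le>N. b k * p ^ k)"
  define d where "d = b (Suc N) * p ^ Suc N"
  define x where "x = real (N + 1)"
  have x: "x > 0" by (simp add: x_def)
  have pp: "p ^ k * cnj p ^ k = 1" for k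
    using p by (simp add: power_mult_distrib[symmetric] complex_norm_square[symmetric])
  \<comment> \<open>The unimodular factor p^N changes no modulus and turns the coefficient of the
    Cauchy product into the partial sum \<open>S\<close>.\<close>
  have "p ^ N * (\<Sum>k\<le>N. b k * cnj p ^ (N - k)) = S"
    unfolding S_def sum_distrib_left
  proof (intro sum.cong refl)
    fix k assume "k \<in> {..N}"
    then have "p ^ N = p ^ k * p ^ (N - k)" by (simp flip: power_add)
    then have "p ^ N * (b k * cnj p ^ (N - k)) = b k * p ^ k * (p ^ (N - k) * cnj p ^ (N - k))"
      by (simp only: mult_ac)
    then show "p ^ N * (b k * cnj p ^ (N - k)) = b k * p ^ k" by (simp only: pp mult_1_right)
  qed
  then have "p ^ N * a N = S - of_real x * d"
    unfolding a_def d_def x_def by (simp add: algebra_simps)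
  then have aN: "cmod (a N) = cmod (S - of_real x * d)"
    using p by (metis norm_mult norm_power mult_1 power_one)
  have dN: "cmod d = cmod (b (Suc N))"
    using p by (simp add: d_def norm_mult norm_power)
  \<comment> \<open>Divided by x (x + 1), with x = N + 1, the right-hand side is the new squared
    coefficient plus the increment of -|S|^2 / x, exactly one step of the telescoping.\<close>
  have "(cmod (S - of_real x * d))\<^sup>2 = x * (x + 1) * (cmod d)\<^sup>2 - x * (cmod (S + d))\<^sup>2 + (x + 1) * (cmod S)\<^sup>2"
    by (simp only: cmod_power2) (simp add: power2_eq_square algebra_simps)
  then have "(cmod (a N))\<^sup>2 / (x * (x + 1)) = (cmod d)\<^sup>2 - (cmod (S + d))\<^sup>2 / (x + 1) + (cmod S)\<^sup>2 / x"
    using x by (simp add: aN field_simps)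
  moreover have "(\<Sum>k\<le>Suc N. b k * p ^ k) = S + d" by (simp add: S_def d_def)
  ultimately show ?case
    using Suc.IH by (simp add: S_def[symmetric] dN x_def add_ac)
qed

text \<open>As z - p = -p (1 - cnj p z), the limit is ((z - p) g)' divided by 1 - cnj p z. Its first
  summand is a Cauchy product with a geometric series, the second a differentiated series.\<close>

lemma power_series_linear_factor:
  assumes g: "g holomorphic_on ball 0 1" and z: "z \<in> ball 0 1" and p: "cmod p = 1"
  defines "b \<equiv> \<lambda>n. (deriv ^^ n) g 0 / fact n"
  shows "(\<lambda>n. ((\<Sum>k\<le>n. b k * cnj p ^ (n - k)) - p * (of_nat (Suc n) * b (Suc n))) * z ^ n) sums
    (g z / (1 - cnj p * z) - p * deriv g z)"
proof -
  have sums: "(\<lambda>n. b n * w ^ n) sums g w" if "w \<in> ball 0 1" for w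
    using holomorphic_power_series[OF g that] by (simp add: b_def)
  have summable: "summable (\<lambda>n. norm (b n * z ^ n))"
  proof -
    define \<rho> where "\<rho> = (1 + cmod z) / 2"
    have \<rho>: "cmod z < \<rho>" "\<rho> < 1" "0 < \<rho>" using z by (auto simp: \<rho>_def add_pos_nonneg)
    have "summable (\<lambda>n. b n * complex_of_real \<rho> ^ n)"
      using sums[of "complex_of_real \<rho>"] \<rho> by (auto simp: summable_def)
    then show ?thesis using \<rho> by (intro powser_insidea[where x="complex_of_real \<rho>"]) auto
  qed
  have pz: "norm (cnj p * z) < 1" using p z by (simp add: norm_mult)
  have "(\<lambda>n. \<Sum>k\<le>n. (b k * z ^ k) * (cnj p * z) ^ (n - k)) sums
      ((\<Sum>n. b n * z ^ n) * (\<Sum>n. (cnj p * z) ^ n))"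
    using summable summable_geometric[of "norm (cnj p * z)"] pz
    by (intro Cauchy_product_sums) (auto simp: norm_power norm_mult)
  also have "(\<Sum>n. b n * z ^ n) * (\<Sum>n. (cnj p * z) ^ n) = g z / (1 - cnj p * z)"
    using sums_unique[OF sums[OF z]] suminf_geometric[OF pz] by simp
  also have "(\<lambda>n. \<Sum>k\<le>n. (b k * z ^ k) * (cnj p * z) ^ (n - k)) = (\<lambda>n. (\<Sum>k\<le>n. b k * cnj p ^ (n - k)) * z ^ n)"
  proof
    fix n
    show "(\<Sum>k\<le>n. (b k * z ^ k) * (cnj p * z) ^ (n - k)) = (\<Sum>k\<le>n. b k * cnj p ^ (n - k)) * z ^ n"
      unfolding sum_distrib_right
    proof (intro sum.cong refl)
      fix k assume "k \<in> {..n}"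
      then have "z ^ n = z ^ k * z ^ (n - k)" by (simp flip: power_add)
      then show "b k * z ^ k * (cnj p * z) ^ (n - k) = b k * cnj p ^ (n - k) * z ^ n"
        by (simp add: power_mult_distrib)
    qed
  qed
  finally have 1: "(\<lambda>n. (\<Sum>k\<le>n. b k * cnj p ^ (n - k)) * z ^ n) sums (g z / (1 - cnj p * z))" .
  have "(\<lambda>n. (deriv ^^ n) (deriv g) 0 / fact n * (z - 0) ^ n) sums deriv g z"
    by (rule holomorphic_power_series[OF holomorphic_deriv[OF g] z]) simp
  moreover have "(deriv ^^ n) (deriv g) 0 / fact n = of_nat (Suc n) * b (Suc n)" for n
  proof -
    have "(deriv ^^ n) (deriv g) = (deriv ^^ Suc n) g"
      by (simp add: funpow_Suc_right del: funpow.simps)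
    then show ?thesis by (simp add: b_def field_simps del: funpow.simps of_nat_Suc)
  qed
  ultimately have 2: "(\<lambda>n. of_nat (Suc n) * b (Suc n) * z ^ n) sums deriv g z" by simp
  show ?thesis
    using sums_diff[OF 1 sums_mult[OF 2, of p]] by (simp add: algebra_simps)
qed

lemma norm_diff_unit: "cmod p = 1 \<Longrightarrow> cmod (p - z) = cmod (1 - cnj p * z)"
proof -
  assume p: "cmod p = 1"
  then have "cnj p * (p - z) = 1 - cnj p * z"
    by (simp add: right_diff_distrib mult.commute[of "cnj p" p] complex_norm_square[symmetric])
  then show ?thesis using p by (metis complex_mod_cnj mult_1 norm_mult)
qed

text \<open>One half of the classical formula equating the local Dirichlet integral of (z - p) g at
  p with the squared Hardy norm of g; the factor pi comes from unnormalized area. The Poisson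
  denominator |p - z| = |1 - cnj p z| is absorbed into h, and the negative term of the telescoped
  sum is dropped.\<close>

lemma nn_integral_linear_factor_le:
  assumes g: "g \<in> disc_algebra" and p: "cmod p = 1"
  shows "(\<integral>\<^sup>+z\<in>ball 0 1. ennreal ((cmod (deriv (\<lambda>z. (z - p) * g z) z))\<^sup>2 * ((1 - (cmod z)\<^sup>2) / (cmod (p - z))\<^sup>2)) \<partial>lborel)
    \<le> ennreal (pi * circle_mean (\<lambda>z. (cmod (g z))\<^sup>2))"
proof -
  define h where "h z = g z / (1 - cnj p * z) - p * deriv g z" for z
  have hol: "g holomorphic_on ball 0 1" using g by (simp add: disc_algebra_def)
  have eq: "(cmod (deriv (\<lambda>z. (z - p) * g z) z))\<^sup>2 * ((1 - (cmod z)\<^sup>2) / (cmod (p - z))\<^sup>2) = (1 - (cmod z)\<^sup>2) * (cmod (h z))\<^sup>2"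
    if z: "z \<in> ball 0 1" for z
  proof -
    have "(g has_field_derivative deriv g z) (at z)"
      using holomorphic_derivI[OF hol _ z] by simp
    then have "((\<lambda>z. (z - p) * g z) has_field_derivative (g z + (z - p) * deriv g z)) (at z)"
      by (auto intro!: derivative_eq_intros)
    then have "deriv (\<lambda>z. (z - p) * g z) z = g z + (z - p) * deriv g z"
      by (rule DERIV_imp_deriv)
    also have "\<dots> = (1 - cnj p * z) * h z"
    proof -
      have "p \<noteq> z" using p z by auto
      then have nz: "1 - cnj p * z \<noteq> 0"
        using norm_diff_unit[OF p, of z] by (metis eq_iff_diff_eq_0 norm_eq_zero)
      have "(1 - cnj p * z) * p = p - z"
      proof -
        have "p * cnj p = 1" using p by (simp add: complex_norm_square[symmetric])
        moreover have "(1 - cnj p * z) * p = p - (p * cnj p) * z" by (simp add: algebra_simps)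
        ultimately show ?thesis by simp
      qed
      then have "(1 - cnj p * z) * (p * deriv g z) = (p - z) * deriv g z" by (simp only: mult.assoc[symmetric])
      moreover have "(1 - cnj p * z) * h z = g z - (1 - cnj p * z) * (p * deriv g z)"
        unfolding h_def right_diff_distrib using nz by (metis nonzero_mult_div_cancel_left times_divide_eq_right)
      ultimately show ?thesis by (simp add: algebra_simps)
    qed
    finally have "cmod (deriv (\<lambda>z. (z - p) * g z) z) = cmod (p - z) * cmod (h z)"
      by (simp add: norm_mult norm_diff_unit[OF p])
    moreover have "cmod (p - z) \<noteq> 0" using p z by auto
    ultimately show ?thesis by (simp add: power_mult_distrib)
  qed
  have "(\<integral>\<^sup>+z\<in>ball 0 1. ennreal ((cmod (deriv (\<lambda>z. (z - p) * g z) z))\<^sup>2 * ((1 - (cmod z)\<^sup>2) / (cmod (p - z))\<^sup>2)) \<partial>lborel)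
    = (\<integral>\<^sup>+z\<in>ball 0 1. ennreal ((1 - (cmod z)\<^sup>2) * (cmod (h z))\<^sup>2) \<partial>lborel)"
    by (intro nn_integral_cong) (use eq in \<open>auto simp: indicator_def\<close>)
  also have "\<dots> \<le> ennreal (pi * circle_mean (\<lambda>z. (cmod (g z))\<^sup>2))"
  proof (rule nn_integral_disc_power_series_le)
    show "(\<lambda>n. ((\<Sum>k\<le>n. (deriv ^^ k) g 0 / fact k * cnj p ^ (n - k)) -
        p * (of_nat (Suc n) * ((deriv ^^ Suc n) g 0 / fact (Suc n)))) * z ^ n) sums h z" if "z \<in> ball 0 1" for z
      unfolding h_def by (rule power_series_linear_factor[OF hol that p])
    show "(\<Sum>n<N. (cmod ((\<Sum>k\<le>n. (deriv ^^ k) g 0 / fact k * cnj p ^ (n - k)) -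
        p * (of_nat (Suc n) * ((deriv ^^ Suc n) g 0 / fact (Suc n)))))\<^sup>2 / (real (n + 1) * real (n + 2))) \<le>
        circle_mean (\<lambda>z. (cmod (g z))\<^sup>2)" for N
      unfolding telescoping_coefficient_sum[OF p, of "\<lambda>k. (deriv ^^ k) g 0 / fact k"]
      by (rule order_trans[OF _ bessel_coefficients[OF g, of "Suc N"]]) simp
  qed
  finally show ?thesis .
qed

section \<open>Pointwise bounds from a local Dirichlet integral\<close>

lemma deriv_bound_of_local_dirichlet_integral:
  assumes hol: "f holomorphic_on ball 0 1" and p: "cmod p = 1" and I: "I \<ge> 0"
    and le: "(\<integral>\<^sup>+z\<in>ball 0 1. ennreal ((cmod (deriv f z))\<^sup>2 * ((1 - (cmod z)\<^sup>2) / (cmod (p - z))\<^sup>2)) \<partial>lborel) \<le> ennreal I"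
    and z: "cmod z < 1"
  shows "cmod (deriv f z) \<le> 2 * sqrt I * cmod (p - z) / ((1 - cmod z) * sqrt (1 - cmod z))"
proof -
  define h where "h z = deriv f z / (1 - cnj p * z)" for z
  have nz: "1 - cnj p * w \<noteq> 0" if "cmod w < 1" for w
    using norm_diff_unit[OF p, of w] p that by auto
  have hol_h: "h holomorphic_on ball 0 1"
    unfolding h_def using nz by (intro holomorphic_intros holomorphic_deriv[OF hol]) auto
  \<comment> \<open>Half the distance to the circle: on \<open>ball z r\<close> the weight 1 - |w|^2
    is at least r, so passing from the weighted integral to the mean of |h|^2 costs a factor 1/r.
    Together with the area this gives r^3, hence the exponent 3/2 in the conclusion.\<close>
  define r where "r = (1 - cmod z) / 2"
  have r: "0 < r" "r < 1 - cmod z" using z by (auto simp: r_def)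
  have sub: "ball z (1 - cmod z) \<subseteq> ball 0 1"
    by (auto simp: dist_norm) (smt (verit) norm_triangle_sub norm_minus_commute)
  have w: "r \<le> 1 - (cmod w)\<^sup>2" "cmod w < 1" if "w \<in> ball z r" for w
  proof -
    have "cmod w < cmod z + r"
      using that norm_triangle_sub[of w z] by (simp add: dist_norm norm_minus_commute)
    then have "r \<le> 1 - cmod w" unfolding r_def by argo
    moreover from this show "cmod w < 1" using r by simp
    moreover from this have "(cmod w)\<^sup>2 \<le> cmod w"
      by (simp add: power2_eq_square mult_left_le)
    ultimately show "r \<le> 1 - (cmod w)\<^sup>2" by simp
  qed
  have "ennreal ((cmod (h z))\<^sup>2 * (pi * r\<^sup>2)) \<le> (\<integral>\<^sup>+w\<in>ball z r. ennreal ((cmod (h w))\<^sup>2) \<partial>lborel)"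
    by (rule ball_mean_value_le[OF holomorphic_on_subset[OF hol_h sub] r])
  also have "\<dots> \<le> (\<integral>\<^sup>+w. ennreal (1 / r) * (ennreal ((cmod (deriv f w))\<^sup>2 * ((1 - (cmod w)\<^sup>2) / (cmod (p - w))\<^sup>2)) * indicator (ball 0 1) w) \<partial>lborel)"
  proof (rule nn_integral_mono)
    fix w
    show "ennreal ((cmod (h w))\<^sup>2) * indicator (ball z r) w \<le>
      ennreal (1 / r) * (ennreal ((cmod (deriv f w))\<^sup>2 * ((1 - (cmod w)\<^sup>2) / (cmod (p - w))\<^sup>2)) * indicator (ball 0 1) w)"
    proof (cases "w \<in> ball z r")
      case True
      have "(cmod (h w))\<^sup>2 = (cmod (deriv f w))\<^sup>2 / (cmod (p - w))\<^sup>2"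
        by (simp add: h_def norm_divide power_divide norm_diff_unit[OF p])
      moreover have "(cmod (h w))\<^sup>2 \<le> 1 / r * ((1 - (cmod w)\<^sup>2) * (cmod (h w))\<^sup>2)"
        using mult_right_mono[OF w(1)[OF True], of "(cmod (h w))\<^sup>2"] r
        by (simp add: pos_le_divide_eq mult.commute)
      ultimately have "(cmod (h w))\<^sup>2 \<le> 1 / r * ((cmod (deriv f w))\<^sup>2 * ((1 - (cmod w)\<^sup>2) / (cmod (p - w))\<^sup>2))"
        by (simp add: mult_ac)
      then have "ennreal ((cmod (h w))\<^sup>2) \<le> ennreal (1 / r * ((cmod (deriv f w))\<^sup>2 * ((1 - (cmod w)\<^sup>2) / (cmod (p - w))\<^sup>2)))"
        by (rule ennreal_leI)
      then show ?thesis using True w(2)[OF True] r by (simp add: ennreal_mult'[symmetric])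
    qed simp
  qed
  also have "\<dots> = ennreal (1 / r) * (\<integral>\<^sup>+w\<in>ball 0 1. ennreal ((cmod (deriv f w))\<^sup>2 * ((1 - (cmod w)\<^sup>2) / (cmod (p - w))\<^sup>2)) \<partial>lborel)"
  proof (rule nn_integral_cmult)
    have "continuous_on (ball 0 1) (\<lambda>w. (cmod (deriv f w))\<^sup>2 * ((1 - (cmod w)\<^sup>2) / (cmod (p - w))\<^sup>2))"
      using p by (intro continuous_intros holomorphic_on_imp_continuous_on holomorphic_deriv[OF hol]) auto
    then have "(\<lambda>w. indicator (ball 0 1) w *\<^sub>R ((cmod (deriv f w))\<^sup>2 * ((1 - (cmod w)\<^sup>2) / (cmod (p - w))\<^sup>2))) \<in> borel_measurable borel"
      by (intro borel_measurable_continuous_on_indicator) auto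
    then have "(\<lambda>w. ennreal (indicator (ball 0 1) w *\<^sub>R ((cmod (deriv f w))\<^sup>2 * ((1 - (cmod w)\<^sup>2) / (cmod (p - w))\<^sup>2)))) \<in> borel_measurable lborel" by simp
    also have "(\<lambda>w. ennreal (indicator (ball 0 1) w *\<^sub>R ((cmod (deriv f w))\<^sup>2 * ((1 - (cmod w)\<^sup>2) / (cmod (p - w))\<^sup>2)))) =
       (\<lambda>w. ennreal ((cmod (deriv f w))\<^sup>2 * ((1 - (cmod w)\<^sup>2) / (cmod (p - w))\<^sup>2)) * indicator (ball 0 1) w)"
      by (auto simp: indicator_def)
    finally show "(\<lambda>w. ennreal ((cmod (deriv f w))\<^sup>2 * ((1 - (cmod w)\<^sup>2) / (cmod (p - w))\<^sup>2)) * indicator (ball 0 1) w) \<in> borel_measurable lborel" .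
  qed
  also have "\<dots> \<le> ennreal (1 / r) * ennreal I"
    by (intro mult_left_mono le) simp
  also have "\<dots> = ennreal (I / r)" using r I by (simp add: ennreal_mult[symmetric])
  finally have "(cmod (h z))\<^sup>2 * (pi * r\<^sup>2) \<le> I / r" using r I by simp
  then have "(cmod (h z))\<^sup>2 * (pi * r ^ 3) \<le> I" using r by (simp add: field_simps power3_eq_cube power2_eq_square)
  \<comment> \<open>Replacing pi by 2 rounds the constant: with r^3 = (1 - |z|)^3 / 8 the bound
    becomes 4 I, whose root is 2 sqrt I.\<close>
  moreover have "(cmod (h z))\<^sup>2 * (2 * r ^ 3) \<le> (cmod (h z))\<^sup>2 * (pi * r ^ 3)"
    using pi_gt3 r by (intro mult_left_mono mult_right_mono) auto
  ultimately have "(cmod (h z))\<^sup>2 * (2 * r ^ 3) \<le> I" by linarith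
  then have "(cmod (h z))\<^sup>2 * (1 - cmod z) ^ 3 \<le> 4 * I" by (simp add: r_def power_divide)
  then have "sqrt ((cmod (h z))\<^sup>2 * ((1 - cmod z)\<^sup>2 * (1 - cmod z))) \<le> sqrt (2\<^sup>2 * I)"
    by (intro real_sqrt_le_mono) (simp add: power3_eq_cube power2_eq_square mult_ac)
  then have "cmod (h z) * ((1 - cmod z) * sqrt (1 - cmod z)) \<le> 2 * sqrt I"
    using z by (simp add: real_sqrt_mult)
  then have "cmod (h z) \<le> 2 * sqrt I / ((1 - cmod z) * sqrt (1 - cmod z))"
    using z by (simp add: pos_le_divide_eq)
  then have "cmod (p - z) * cmod (h z) \<le> cmod (p - z) * (2 * sqrt I / ((1 - cmod z) * sqrt (1 - cmod z)))"
    by (intro mult_left_mono) auto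
  moreover have "cmod (deriv f z) = cmod (p - z) * cmod (h z)"
    using nz[OF z] by (simp add: h_def norm_divide norm_diff_unit[OF p])
  ultimately show ?thesis by (simp add: mult_ac)
qed

text \<open>The derivative bound is integrated along the radius from 0 to z. With s = 1 - t |z| it
  splits into multiples of |p - z| s^(-3/2) and s^(-1/2); the first produces |p - z| / sqrt(1 -
  |z|), the second stays bounded and leaves the summand 1.\<close>

lemma evaluation_bound_of_local_dirichlet_integral:
  assumes hol: "f holomorphic_on ball 0 1" and p: "cmod p = 1" and I: "I \<ge> 0"
    and le: "(\<integral>\<^sup>+z\<in>ball 0 1. ennreal ((cmod (deriv f z))\<^sup>2 * ((1 - (cmod z)\<^sup>2) / (cmod (p - z))\<^sup>2)) \<partial>lborel) \<le> ennreal I"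
    and z: "cmod z < 1"
  shows "cmod (f z - f 0) \<le> 4 * sqrt I * (1 + cmod (p - z) / sqrt (1 - cmod z))"
proof -
  define D where "D = cmod (p - z)"
  \<comment> \<open>\<open>\<phi>\<close> is a primitive of the bound \<open>\<phi>'\<close> for the
    speed of f along the radius, so the mean value inequality compares the increments of f and
    \<open>\<phi>\<close>.\<close>
  define \<phi> where "\<phi> t = 2 * sqrt I * (2 * D / sqrt (1 - t * cmod z) - 2 * sqrt (1 - t * cmod z))" for t
  define \<phi>' where "\<phi>' t = 2 * sqrt I * ((D * cmod z / ((1 - t * cmod z) * sqrt (1 - t * cmod z))) + cmod z / sqrt (1 - t * cmod z))" for t
  have s: "1 - t * cmod z > 0" if "0 \<le> t" "t \<le> 1" for t
    using that z mult_right_mono[of t 1 "cmod z"] by simp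
  have tz: "cmod (of_real t * z) < 1" if "0 \<le> t" "t \<le> 1" for t
    using s[OF that] that by (simp add: norm_mult)
  have d\<phi>: "(\<phi> has_real_derivative \<phi>' t) (at t)" if "0 \<le> t" "t \<le> 1" for t
    unfolding \<phi>_def \<phi>'_def using s[OF that]
    by (auto intro!: derivative_eq_intros simp: field_simps)
  have df: "((\<lambda>t. f (of_real t * z)) has_vector_derivative (z * deriv f (of_real t * z))) (at t)" if "0 \<le> t" "t \<le> 1" for t
  proof -
    have "(f has_field_derivative deriv f (of_real t * z)) (at (of_real t * z))"
      using tz[OF that] by (intro holomorphic_derivI[OF hol]) auto
    moreover have "((\<lambda>t. of_real t * z) has_vector_derivative z) (at t)"
      by (auto intro!: derivative_eq_intros)
    ultimately show ?thesis
      using field_vector_diff_chain_at[of "\<lambda>t. of_real t * z" z t f] by (simp add: o_def)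
  qed
  have "norm (f (of_real 1 * z) - f (of_real 0 * z)) \<le> \<phi> 1 - \<phi> 0"
  proof (rule differentiable_bound_general[where f="\<lambda>t. f (of_real t * z)" and \<phi>=\<phi> and f'="\<lambda>t. z * deriv f (of_real t * z)" and \<phi>'=\<phi>'])
    show "continuous_on {0..1} (\<lambda>t. f (of_real t * z))"
      using df by (intro continuous_at_imp_continuous_on ballI has_vector_derivative_continuous) auto
    show "continuous_on {0..1} \<phi>"
      using d\<phi> by (intro continuous_at_imp_continuous_on ballI DERIV_isCont) auto
    fix t :: real assume t: "0 < t" "t < 1"
    show "(\<phi> has_vector_derivative \<phi>' t) (at t)"
      using d\<phi>[of t] t by (simp add: has_real_derivative_iff_has_vector_derivative)
    show "((\<lambda>t. f (of_real t * z)) has_vector_derivative (z * deriv f (of_real t * z))) (at t)"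
      using df[of t] t by simp
    let ?s = "1 - t * cmod z"
    have s0: "?s > 0" using s t by simp
    have nt: "cmod (of_real t * z) = t * cmod z" using t by (simp add: norm_mult)
    \<comment> \<open>Measuring the distance to p from the endpoint z costs at most (1 - t) |z|,
      which does not exceed 1 - t |z|; this keeps the final bound in terms of |p - z|.\<close>
    have "cmod (p - of_real t * z) \<le> D + ?s"
    proof -
      have "p - of_real t * z = (p - z) + of_real (1 - t) * z" by (simp add: algebra_simps)
      then have "cmod (p - of_real t * z) \<le> D + cmod (of_real (1 - t) * z)"
        unfolding D_def by (metis norm_triangle_ineq)
      also have "cmod (of_real (1 - t) * z) = (1 - t) * cmod z" using t by (simp only: norm_mult norm_of_real)
      also have "\<dots> \<le> ?s" using z t by (simp add: algebra_simps)
      finally show ?thesis by simp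
    qed
    then have "2 * sqrt I * cmod (p - of_real t * z) / (?s * sqrt ?s) \<le> 2 * sqrt I * (D + ?s) / (?s * sqrt ?s)"
      using s0 I by (intro divide_right_mono mult_left_mono) auto
    also have "\<dots> = 2 * sqrt I * (D / (?s * sqrt ?s) + 1 / sqrt ?s)"
      using s0 by (simp add: add_divide_distrib distrib_left)
    finally have "cmod (deriv f (of_real t * z)) \<le> 2 * sqrt I * (D / (?s * sqrt ?s) + 1 / sqrt ?s)"
      using deriv_bound_of_local_dirichlet_integral[OF hol p I le tz[of t]] t unfolding nt by linarith
    then have "cmod z * cmod (deriv f (of_real t * z)) \<le> cmod z * (2 * sqrt I * (D / (?s * sqrt ?s) + 1 / sqrt ?s))"
      by (intro mult_left_mono) auto
    also have "\<dots> = \<phi>' t" by (simp add: \<phi>'_def algebra_simps)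
    finally show "norm (z * deriv f (of_real t * z)) \<le> \<phi>' t" by (simp add: norm_mult)
  qed simp
  also have "\<phi> 1 - \<phi> 0 = 4 * sqrt I * (D / sqrt (1 - cmod z) - D + (1 - sqrt (1 - cmod z)))"
    by (simp add: \<phi>_def algebra_simps)
  also have "\<dots> \<le> 4 * sqrt I * (1 + D / sqrt (1 - cmod z))"
    using I z by (intro mult_left_mono) (auto simp: D_def intro: order_trans[where y=0])
  finally show ?thesis by (simp add: D_def)
qed

section \<open>Interpolation by Szego kernels\<close>

text \<open>Normalized in the Hardy space: the circle mean of its squared modulus is one.\<close>

definition szego :: "complex \<Rightarrow> complex \<Rightarrow> complex" where
  "szego l z = complex_of_real (sqrt (1 - (cmod l)\<^sup>2)) / (1 - cnj l * z)"

text \<open>A Blaschke factor without the customary unimodular constant; its modulus on the disc is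
  the pseudohyperbolic distance.\<close>

definition blaschke :: "complex \<Rightarrow> complex \<Rightarrow> complex" where
  "blaschke l z = (z - l) / (1 - cnj l * z)"

lemma disc_algebra_szego: "cmod l < 1 \<Longrightarrow> szego l \<in> disc_algebra"
  unfolding szego_def[abs_def] by (intro disc_algebra_intros)

lemma disc_algebra_blaschke: "cmod l < 1 \<Longrightarrow> blaschke l \<in> disc_algebra"
  unfolding blaschke_def[abs_def] by (intro disc_algebra_intros)

lemma one_minus_square_pos: "cmod l < 1 \<Longrightarrow> 0 < 1 - (cmod l)\<^sup>2"
  by (simp add: abs_square_less_1)

lemma circle_mean_szego:
  assumes g: "g \<in> disc_algebra" and l: "cmod l < 1"
  shows "circle_mean (\<lambda>z. g z * cnj (szego l z)) = complex_of_real (sqrt (1 - (cmod l)\<^sup>2)) * g l"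
proof -
  have "circle_mean (\<lambda>z. g z * cnj (szego l z)) =
      circle_mean (\<lambda>z. complex_of_real (sqrt (1 - (cmod l)\<^sup>2)) * (g z * cnj (1 / (1 - cnj l * z))))"
    by (rule circle_mean_cong) (simp add: szego_def)
  then show ?thesis by (simp only: circle_mean_cmult circle_mean_reproducing[OF g l])
qed

lemma szego_diagonal: "cmod l < 1 \<Longrightarrow> complex_of_real (sqrt (1 - (cmod l)\<^sup>2)) * szego l l = 1"
proof -
  assume l: "cmod l < 1"
  have "1 - cnj l * l = complex_of_real (1 - (cmod l)\<^sup>2)"
    unfolding of_real_diff complex_norm_square by (simp add: mult.commute)
  then have "complex_of_real (sqrt (1 - (cmod l)\<^sup>2)) * szego l l =
      complex_of_real (sqrt (1 - (cmod l)\<^sup>2) * sqrt (1 - (cmod l)\<^sup>2)) / complex_of_real (1 - (cmod l)\<^sup>2)"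
    unfolding szego_def by (simp only: of_real_mult times_divide_eq_right)
  also have "sqrt (1 - (cmod l)\<^sup>2) * sqrt (1 - (cmod l)\<^sup>2) = 1 - (cmod l)\<^sup>2"
    using one_minus_square_pos[OF l] by simp
  finally show ?thesis using one_minus_square_pos[OF l] by (simp only: divide_self_if of_real_eq_0_iff) simp
qed

lemma circle_mean_norm_square:
  fixes g :: "complex \<Rightarrow> complex"
  assumes "continuous_on (sphere 0 1) g"
  shows "complex_of_real (circle_mean (\<lambda>z. (cmod (g z))\<^sup>2)) = circle_mean (\<lambda>z. g z * cnj (g z))"
  by (subst circle_mean_of_real[symmetric]) (intro continuous_intros assms, simp only: complex_norm_square)

lemma circle_mean_szego_norm: "cmod l < 1 \<Longrightarrow> circle_mean (\<lambda>z. (cmod (szego l z))\<^sup>2) = 1"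
proof -
  assume l: "cmod l < 1"
  have "complex_of_real (circle_mean (\<lambda>z. (cmod (szego l z))\<^sup>2)) = 1"
    unfolding circle_mean_norm_square[OF disc_algebra_continuous_on_sphere[OF disc_algebra_szego[OF l]]]
      circle_mean_szego[OF disc_algebra_szego[OF l] l] by (rule szego_diagonal[OF l])
  then show ?thesis by simp
qed

lemma norm_one_minus_cnj_mult:
  "(cmod (1 - cnj l * z))\<^sup>2 - (cmod (z - l))\<^sup>2 = (1 - (cmod l)\<^sup>2) * (1 - (cmod z)\<^sup>2)"
  by (simp only: cmod_power2) (simp add: power2_eq_square algebra_simps)

text \<open>The right-hand side is the summand of the Carleson sum for the test function
  \<open>szego l\<close>, so a Carleson bound becomes a bound on sums of 1 - rho^2.\<close>

lemma one_minus_blaschke_square: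
  assumes "cmod l < 1" "cmod z < 1"
  shows "1 - (cmod (blaschke l z))\<^sup>2 = (1 - (cmod z)\<^sup>2) * (cmod (szego l z))\<^sup>2"
proof -
  have "(cmod (1 - cnj l * z))\<^sup>2 \<noteq> 0" using one_minus_cnj_mult_nonzero[of l z] assms by simp
  then have "1 - (cmod (blaschke l z))\<^sup>2 = ((cmod (1 - cnj l * z))\<^sup>2 - (cmod (z - l))\<^sup>2) / (cmod (1 - cnj l * z))\<^sup>2"
    unfolding blaschke_def norm_divide power_divide by (simp add: diff_divide_distrib)
  also have "\<dots> = (1 - (cmod z)\<^sup>2) * (cmod (szego l z))\<^sup>2"
    unfolding norm_one_minus_cnj_mult szego_def norm_divide power_divide
    using one_minus_square_pos[OF assms(1)] by simp
  finally show ?thesis .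
qed

lemma blaschke_norm_commute: "cmod (blaschke l z) = cmod (blaschke z l)"
proof -
  have "cmod (1 - cnj l * z) = cmod (cnj (1 - cnj l * z))" by (rule complex_mod_cnj[symmetric])
  also have "cnj (1 - cnj l * z) = 1 - cnj z * l" by (simp add: mult.commute)
  finally show ?thesis by (simp add: blaschke_def norm_divide norm_minus_commute)
qed

text \<open>On the circle (z - l) cnj z = 1 - l cnj z. Hence a Blaschke factor trades the kernel for
  its conjugate, up to a factor that is the same for all l.\<close>

lemma blaschke_on_circle:
  assumes l: "cmod l < 1" and z: "cmod z = 1"
  shows "cmod (blaschke l z) = 1"
    and "szego l z = blaschke l z * (cnj z * cnj (szego l z))"
proof -
  have nz: "1 - cnj l * z \<noteq> 0" using one_minus_cnj_mult_nonzero[OF l, of z] z by simp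
  have "(cmod (z - l))\<^sup>2 = (cmod (1 - cnj l * z))\<^sup>2"
    using norm_one_minus_cnj_mult[of l z] z by simp
  then have "cmod (z - l) = cmod (1 - cnj l * z)" by simp
  then show "cmod (blaschke l z) = 1" using nz by (simp add: blaschke_def norm_divide)
  have "1 - l * cnj z = cnj (1 - cnj l * z)" by simp
  then have nz': "1 - l * cnj z \<noteq> 0" using nz by (metis complex_cnj_zero_iff)
  have "z * cnj z = 1" using z by (simp add: complex_norm_square[symmetric])
  then have "(z - l) * cnj z = 1 - l * cnj z" by (simp add: algebra_simps)
  then have "(z - l) * cnj z / (1 - l * cnj z) = 1" using nz' by simp
  then have "complex_of_real (sqrt (1 - (cmod l)\<^sup>2)) / (1 - cnj l * z) =
     complex_of_real (sqrt (1 - (cmod l)\<^sup>2)) / (1 - cnj l * z) * ((z - l) * cnj z / (1 - l * cnj z))"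
    by simp
  moreover have "cnj (szego l z) = complex_of_real (sqrt (1 - (cmod l)\<^sup>2)) / (1 - l * cnj z)"
    by (simp add: szego_def)
  ultimately show "szego l z = blaschke l z * (cnj z * cnj (szego l z))"
    by (simp add: szego_def[of l z] blaschke_def mult_ac)
qed

text \<open>The adjoint form of the Carleson bound. Test it on the combination g itself: its squared
  norm M is a pairing of the coefficients with the values of g, so Cauchy-Schwarz gives M^2 \<le> C
  M times the coefficient sum, and M cancels unless it is zero.\<close>

lemma szego_combination_le:
  fixes lam :: "'i \<Rightarrow> complex"
  assumes F: "finite F" and l: "\<And>n. n \<in> F \<Longrightarrow> cmod (lam n) < 1"
    and C: "\<And>g. g \<in> disc_algebra \<Longrightarrow>
      (\<Sum>n\<in>F. (1 - (cmod (lam n))\<^sup>2) * (cmod (g (lam n)))\<^sup>2) \<le> C * circle_mean (\<lambda>z. (cmod (g z))\<^sup>2)"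
    and C0: "C \<ge> 0"
  shows "circle_mean (\<lambda>z. (cmod (\<Sum>n\<in>F. b n * szego (lam n) z))\<^sup>2) \<le> C * (\<Sum>n\<in>F. (cmod (b n))\<^sup>2)"
proof -
  define g where "g z = (\<Sum>n\<in>F. b n * szego (lam n) z)" for z
  define s where "s n = sqrt (1 - (cmod (lam n))\<^sup>2)" for n
  have s: "(s n)\<^sup>2 = 1 - (cmod (lam n))\<^sup>2" if "n \<in> F" for n
    using one_minus_square_pos[OF l[OF that]] by (simp add: s_def)
  have g: "g \<in> disc_algebra" unfolding g_def by (intro disc_algebra_intros disc_algebra_szego l)
  have cg: "continuous_on (sphere 0 1) g" by (rule disc_algebra_continuous_on_sphere[OF g])
  have cs: "continuous_on (sphere 0 1) (szego (lam n))" if "n \<in> F" for n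
    by (rule disc_algebra_continuous_on_sphere[OF disc_algebra_szego[OF l[OF that]]])
  define M where "M = circle_mean (\<lambda>z. (cmod (g z))\<^sup>2)"
  have M: "M \<ge> 0" unfolding M_def by (intro circle_mean_nonneg continuous_intros cg) auto
  let ?S = "\<Sum>n\<in>F. (cmod (b n))\<^sup>2"
  have "complex_of_real M = circle_mean (\<lambda>z. g z * cnj (g z))"
    unfolding M_def by (rule circle_mean_norm_square[OF cg])
  also have "\<dots> = circle_mean (\<lambda>z. \<Sum>n\<in>F. cnj (b n) * (g z * cnj (szego (lam n) z)))"
    by (rule circle_mean_cong) (simp only: g_def[of "_"] cnj_sum complex_cnj_mult sum_distrib_left mult_ac)
  also have "\<dots> = (\<Sum>n\<in>F. cnj (b n) * circle_mean (\<lambda>z. g z * cnj (szego (lam n) z)))"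
    by (subst circle_mean_sum[OF F]) (intro continuous_intros cg cs, assumption, simp only: circle_mean_cmult)
  also have "\<dots> = (\<Sum>n\<in>F. cnj (b n) * (complex_of_real (s n) * g (lam n)))"
    by (intro sum.cong refl) (simp add: circle_mean_szego[OF g l] s_def)
  finally have "M = cmod (\<Sum>n\<in>F. cnj (b n) * (complex_of_real (s n) * g (lam n)))"
    using M by (metis norm_of_real abs_of_nonneg)
  also have "\<dots> \<le> (\<Sum>n\<in>F. cmod (b n) * cmod (complex_of_real (s n) * g (lam n)))"
    by (rule sum_norm_le) (simp add: norm_mult)
  finally have "M\<^sup>2 \<le> (\<Sum>n\<in>F. cmod (b n) * cmod (complex_of_real (s n) * g (lam n)))\<^sup>2"
    using M by (intro power_mono)
  also have "\<dots> \<le> ?S * (\<Sum>n\<in>F. (cmod (complex_of_real (s n) * g (lam n)))\<^sup>2)"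
    by (rule Cauchy_Schwarz_ineq_sum)
  also have "(\<Sum>n\<in>F. (cmod (complex_of_real (s n) * g (lam n)))\<^sup>2) = (\<Sum>n\<in>F. (1 - (cmod (lam n))\<^sup>2) * (cmod (g (lam n)))\<^sup>2)"
    by (intro sum.cong refl) (simp add: norm_mult power_mult_distrib s)
  also have "?S * \<dots> \<le> ?S * (C * M)"
    unfolding M_def by (intro mult_left_mono C g sum_nonneg) simp
  finally have *: "M * M \<le> (C * ?S) * M" by (simp add: power2_eq_square mult_ac)
  show ?thesis
  proof (cases "M = 0")
    case True
    have "0 \<le> C * ?S" using C0 by (intro mult_nonneg_nonneg sum_nonneg) auto
    then show ?thesis using True by (simp add: M_def g_def)
  next
    case False
    then have "M \<le> C * ?S" using * M by (simp add: mult_le_cancel_right)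
    then show ?thesis by (simp add: M_def g_def)
  qed
qed

text \<open>The interpolant is a combination of \<open>B\<^sub>n szego (lam n)\<close>, where \<open>B\<^sub>n\<close> is the Blaschke product over
  \<open>F - {n}\<close>. On the circle it equals, up to a unimodular factor, the conjugate of a combination of Szego
  kernels, so the Bessel bound for kernels applies to it.\<close>

lemma szego_interpolation:
  fixes lam :: "'i \<Rightarrow> complex"
  assumes F: "finite F" and l: "\<And>n. n \<in> F \<Longrightarrow> cmod (lam n) < 1"
    and C: "\<And>g. g \<in> disc_algebra \<Longrightarrow>
      (\<Sum>n\<in>F. (1 - (cmod (lam n))\<^sup>2) * (cmod (g (lam n)))\<^sup>2) \<le> C * circle_mean (\<lambda>z. (cmod (g z))\<^sup>2)"
    and C0: "C \<ge> 0" and \<delta>: "\<delta> > 0"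
    and sep: "\<And>n. n \<in> F \<Longrightarrow> \<delta> \<le> (\<Prod>m\<in>F - {n}. cmod (blaschke (lam m) (lam n)))"
  shows "\<exists>g\<in>disc_algebra. (\<forall>n\<in>F. complex_of_real (sqrt (1 - (cmod (lam n))\<^sup>2)) * g (lam n) = b n) \<and>
    circle_mean (\<lambda>z. (cmod (g z))\<^sup>2) \<le> C / \<delta>\<^sup>2 * (\<Sum>n\<in>F. (cmod (b n))\<^sup>2)"
proof -
  define B where "B n z = (\<Prod>m\<in>F - {n}. blaschke (lam m) z)" for n z
  have B_ge: "\<delta> \<le> cmod (B n (lam n))" if "n \<in> F" for n
    using sep[OF that] by (simp add: B_def prod_norm)
  define \<beta> where "\<beta> n = b n / B n (lam n)" for n
  have \<beta>_le: "cmod (\<beta> n) \<le> cmod (b n) / \<delta>" if "n \<in> F" for n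
    using B_ge[OF that] \<delta> by (simp add: \<beta>_def norm_divide frac_le)
  define g where "g z = (\<Sum>n\<in>F. \<beta> n * (B n z * szego (lam n) z))" for z
  have g: "g \<in> disc_algebra"
    unfolding g_def B_def by (intro disc_algebra_intros disc_algebra_szego disc_algebra_blaschke l) auto
  have "complex_of_real (sqrt (1 - (cmod (lam n))\<^sup>2)) * g (lam n) = b n" if n: "n \<in> F" for n
  proof -
    have "B m (lam n) = 0" if "m \<in> F" "m \<noteq> n" for m
      unfolding B_def using F n that by (intro prod_zero) (auto simp: blaschke_def intro!: bexI[of _ n])
    then have "g (lam n) = \<beta> n * (B n (lam n) * szego (lam n) (lam n))"
      unfolding g_def using F n by (subst sum.remove[OF F n]) auto
    moreover have "B n (lam n) \<noteq> 0" using B_ge[OF n] \<delta> by auto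
    ultimately have "complex_of_real (sqrt (1 - (cmod (lam n))\<^sup>2)) * g (lam n) =
        b n * (complex_of_real (sqrt (1 - (cmod (lam n))\<^sup>2)) * szego (lam n) (lam n))"
      by (simp add: \<beta>_def)
    then show ?thesis using szego_diagonal[OF l[OF n]] by simp
  qed
  moreover have "circle_mean (\<lambda>z. (cmod (g z))\<^sup>2) \<le> C / \<delta>\<^sup>2 * (\<Sum>n\<in>F. (cmod (b n))\<^sup>2)"
  proof -
    have "circle_mean (\<lambda>z. (cmod (g z))\<^sup>2) = circle_mean (\<lambda>z. (cmod (\<Sum>n\<in>F. cnj (\<beta> n) * szego (lam n) z))\<^sup>2)"
    proof (rule circle_mean_cong)
      fix z :: complex assume z: "cmod z = 1"
      \<comment> \<open>Each product \<open>B n\<close> is \<open>P\<close> with one factor removed,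
        and that factor conjugates the kernel at \<open>lam n\<close>. What remains is
        \<open>P * cnj z\<close>, which is common to all terms and unimodular.\<close>
      define P where "P = (\<Prod>m\<in>F. blaschke (lam m) z)"
      have P: "cmod P = 1"
        unfolding P_def prod_norm[symmetric] using blaschke_on_circle(1)[OF l z] by simp
      have "g z = (\<Sum>n\<in>F. P * cnj z * cnj (cnj (\<beta> n) * szego (lam n) z))"
        unfolding g_def
      proof (intro sum.cong refl)
        fix n assume n: "n \<in> F"
        have "P = blaschke (lam n) z * B n z" unfolding P_def B_def by (rule prod.remove[OF F n])
        moreover have "B n z * szego (lam n) z = B n z * (blaschke (lam n) z * (cnj z * cnj (szego (lam n) z)))"
          using blaschke_on_circle(2)[OF l[OF n] z] by simp
        ultimately show "\<beta> n * (B n z * szego (lam n) z) = P * cnj z * cnj (cnj (\<beta> n) * szego (lam n) z)"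
          by (simp add: mult_ac)
      qed
      also have "\<dots> = P * cnj z * cnj (\<Sum>n\<in>F. cnj (\<beta> n) * szego (lam n) z)"
        by (simp add: sum_distrib_left)
      finally have "cmod (g z) = cmod (\<Sum>n\<in>F. cnj (\<beta> n) * szego (lam n) z)"
        using P z by (simp only: norm_mult complex_mod_cnj mult_1)
      then show "(cmod (g z))\<^sup>2 = (cmod (\<Sum>n\<in>F. cnj (\<beta> n) * szego (lam n) z))\<^sup>2" by simp
    qed
    also have "\<dots> \<le> C * (\<Sum>n\<in>F. (cmod (cnj (\<beta> n)))\<^sup>2)"
      by (rule szego_combination_le[OF F l C C0])
    also have "\<dots> \<le> C * (\<Sum>n\<in>F. (cmod (b n) / \<delta>)\<^sup>2)"
      using \<beta>_le by (intro mult_left_mono sum_mono power_mono C0) auto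
    also have "\<dots> = C / \<delta>\<^sup>2 * (\<Sum>n\<in>F. (cmod (b n))\<^sup>2)"
      by (simp add: power_divide sum_divide_distrib[symmetric])
    finally show ?thesis .
  qed
  ultimately show ?thesis using g by blast
qed

section \<open>Separation of the points and colouring\<close>

lemma sum_one_minus_blaschke_le:
  fixes lam :: "'i \<Rightarrow> complex"
  assumes l: "\<And>n. n \<in> F \<Longrightarrow> cmod (lam n) < 1" and a: "cmod a < 1"
    and C: "\<And>g. g \<in> disc_algebra \<Longrightarrow>
      (\<Sum>n\<in>F. (1 - (cmod (lam n))\<^sup>2) * (cmod (g (lam n)))\<^sup>2) \<le> C * circle_mean (\<lambda>z. (cmod (g z))\<^sup>2)"
  shows "(\<Sum>n\<in>F. 1 - (cmod (blaschke a (lam n)))\<^sup>2) \<le> C"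
  using C[OF disc_algebra_szego[OF a]] circle_mean_szego_norm[OF a] one_minus_blaschke_square[OF a l] by simp

text \<open>For y = 1 - x^2 \<le> 1/2 one has ln(1 - y) \<ge> -y - 2y^2 \<ge> -2y, that is exp(-y)
  \<le> x. The factors must stay away from zero for such a comparison, hence the bound 1/2.\<close>

lemma exp_le_prod:
  fixes x :: "'i \<Rightarrow> real"
  assumes F: "finite F" and x: "\<And>m. m \<in> F \<Longrightarrow> 0 \<le> x m" "\<And>m. m \<in> F \<Longrightarrow> 1 / 2 \<le> (x m)\<^sup>2" "\<And>m. m \<in> F \<Longrightarrow> (x m)\<^sup>2 \<le> 1"
    and le: "(\<Sum>m\<in>F. 1 - (x m)\<^sup>2) \<le> C"
  shows "exp (- C) \<le> (\<Prod>m\<in>F. x m)"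
proof -
  have "exp (- (1 - (x m)\<^sup>2)) \<le> x m" if m: "m \<in> F" for m
  proof -
    define y where "y = 1 - (x m)\<^sup>2"
    have y: "0 \<le> y" "y \<le> 1 / 2" using x(2,3)[OF m] by (auto simp: y_def)
    have "- y - 2 * y\<^sup>2 \<le> ln (1 - y)" by (rule ln_one_minus_pos_lower_bound[OF y])
    moreover have "2 * y\<^sup>2 \<le> y" using y mult_left_mono[of y "1/2" y] by (simp add: power2_eq_square)
    ultimately have "- (2 * y) \<le> ln (1 - y)" by linarith
    then have "exp (- (2 * y)) \<le> 1 - y" using y by (subst (asm) ln_ge_iff) auto
    then have "(exp (- y))\<^sup>2 \<le> (x m)\<^sup>2" by (simp add: y_def exp_double[symmetric])
    then show ?thesis using x(1)[OF m] by (auto simp: y_def[symmetric] dest: power2_le_imp_le)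
  qed
  then have "(\<Prod>m\<in>F. exp (- (1 - (x m)\<^sup>2))) \<le> (\<Prod>m\<in>F. x m)" by (intro prod_mono) auto
  moreover have "(\<Prod>m\<in>F. exp (- (1 - (x m)\<^sup>2))) = exp (\<Sum>m\<in>F. - (1 - (x m)\<^sup>2))" by (rule exp_sum[OF F, symmetric])
  moreover have "exp (- C) \<le> exp (\<Sum>m\<in>F. - (1 - (x m)\<^sup>2))" using le unfolding sum_negf by simp
  ultimately show ?thesis by linarith
qed

text \<open>Greedy colouring in the order of the indices: among the K + 1 colours 0, ..., K one is
  free, since at most K neighbours come earlier. Degrees are bounded through finite sets of
  neighbours because that is how the Carleson sums control them.\<close>

lemma bounded_degree_colouring:
  fixes R :: "nat \<Rightarrow> nat \<Rightarrow> bool"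
  assumes deg: "\<And>n F. n \<in> S \<Longrightarrow> finite F \<Longrightarrow> F \<subseteq> {m \<in> S. R n m} \<Longrightarrow> card F \<le> K"
    and sym: "\<And>m n. R m n \<Longrightarrow> R n m"
  shows "\<exists>col. (\<forall>n\<in>S. col n \<le> K) \<and> (\<forall>m\<in>S. \<forall>n\<in>S. m \<noteq> n \<longrightarrow> R m n \<longrightarrow> col m \<noteq> (col n :: nat))"
proof -
  define colour where "colour = (\<lambda>f n. LEAST c::nat. c \<notin> f ` {m \<in> S. m < n \<and> R n m})"
  define col where "col = wfrec less_than colour"
  have col: "col n = (LEAST c. c \<notin> col ` {m \<in> S. m < n \<and> R n m})" for n
  proof -
    have "col n = colour (cut col less_than n) n"
      using wfrec[OF wf_less_than, of colour n] by (simp add: col_def)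
    also have "cut col less_than n ` {m \<in> S. m < n \<and> R n m} = col ` {m \<in> S. m < n \<and> R n m}"
      by (intro image_cong refl) (simp add: cut_def)
    then have "colour (cut col less_than n) n = (LEAST c. c \<notin> col ` {m \<in> S. m < n \<and> R n m})"
      by (simp add: colour_def)
    finally show ?thesis .
  qed
  have ex: "\<exists>c\<le>K. c \<notin> col ` {m \<in> S. m < n \<and> R n m}" if n: "n \<in> S" for n
  proof (rule ccontr)
    assume "\<not> ?thesis"
    then have "{..K} \<subseteq> col ` {m \<in> S. m < n \<and> R n m}" by auto
    moreover have fin: "finite {m \<in> S. m < n \<and> R n m}" by (rule finite_subset[of _ "{..<n}"]) auto
    ultimately have "card {..K} \<le> card {m \<in> S. m < n \<and> R n m}"
      by (meson card_image_le card_mono finite_imageI le_trans)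
    also have "\<dots> \<le> K" by (rule deg[OF n fin]) auto
    finally show False by simp
  qed
  have le: "col n \<le> K" if "n \<in> S" for n
    using ex[OF that] Least_le[of "\<lambda>c. c \<notin> col ` {m \<in> S. m < n \<and> R n m}"] order_trans unfolding col[of n] by blast
  have notin: "col n \<notin> col ` {m \<in> S. m < n \<and> R n m}" if "n \<in> S" for n
    using ex[OF that] LeastI[of "\<lambda>c. c \<notin> col ` {m \<in> S. m < n \<and> R n m}"] unfolding col[of n] by blast
  have "col m \<noteq> col n" if "m \<in> S" "n \<in> S" "m \<noteq> n" "R m n" for m n
  proof (cases "m < n")
    case True
    then have "col m \<in> col ` {m \<in> S. m < n \<and> R n m}" using that sym[OF that(4)] by (intro imageI) simp
    then show ?thesis using notin[OF that(2)] by metis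
  next
    case False
    then have "n < m" using that by simp
    then have "col n \<in> col ` {n \<in> S. n < m \<and> R m n}" using that by (intro imageI) simp
    then show ?thesis using notin[OF that(1)] by metis
  qed
  then show ?thesis using le by blast
qed

section \<open>The space of a finite sum of point masses\<close>

text \<open>Put c = -t I with t real and choose t = 1/b, or t large if b = 0. With a = 0 the same
  inequality yields the orthogonality relation of a norm minimizer, besides Cauchy-Schwarz.\<close>

lemma square_le_of_nonneg_quadratic:
  fixes I :: complex
  assumes ge: "\<And>c. 0 \<le> a + 2 * Re (cnj c * I) + (cmod c)\<^sup>2 * b" and b: "b \<ge> 0"
  shows "(cmod I)\<^sup>2 \<le> a * b"
proof -
  have *: "0 \<le> a - 2 * t * (cmod I)\<^sup>2 + t\<^sup>2 * (cmod I)\<^sup>2 * b" for t :: real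
  proof -
    have "Re (cnj (- of_real t * I) * I) = - t * (cmod I)\<^sup>2"
      by (simp only: cmod_power2) (simp add: power2_eq_square algebra_simps)
    moreover have "(cmod (- of_real t * I))\<^sup>2 = t\<^sup>2 * (cmod I)\<^sup>2"
      by (simp add: norm_mult power_mult_distrib)
    ultimately show ?thesis using ge[of "- of_real t * I"] by simp
  qed
  show ?thesis
  proof (cases "b = 0")
    case True
    have "cmod I = 0"
    proof (rule ccontr)
      assume "cmod I \<noteq> 0"
      then show False
        using *[of "(\<bar>a\<bar> + 1) / (cmod I)\<^sup>2"] True by simp
    qed
    then show ?thesis using True by simp
  next
    case False
    then have "b > 0" using b by simp
    then show ?thesis using *[of "1 / b"] by (simp add: field_simps power2_eq_square)
  qed
qed

lemma set_integrable_of_nn_integral: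
  fixes F :: "complex \<Rightarrow> real"
  assumes "set_borel_measurable lborel A F" "\<And>z. z \<in> A \<Longrightarrow> F z \<ge> 0"
    and "(\<integral>\<^sup>+z\<in>A. ennreal (F z) \<partial>lborel) < \<infinity>"
  shows "set_integrable lborel A F"
    and "(\<integral>\<^sup>+z\<in>A. ennreal (F z) \<partial>lborel) = ennreal (LINT z:A|lborel. F z)"
proof -
  have eq: "(\<integral>\<^sup>+z\<in>A. ennreal (F z) \<partial>lborel) = (\<integral>\<^sup>+z. ennreal (indicator A z *\<^sub>R F z) \<partial>lborel)"
    by (intro nn_integral_cong) (auto simp: indicator_def)
  have nonneg: "AE z in lborel. 0 \<le> indicator A z *\<^sub>R F z"
    using assms(2) by (auto simp: indicator_def)
  show int: "set_integrable lborel A F"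
    using assms nonneg unfolding set_integrable_def set_borel_measurable_def eq by (intro integrableI_nonneg) auto
  show "(\<integral>\<^sup>+z\<in>A. ennreal (F z) \<partial>lborel) = ennreal (LINT z:A|lborel. F z)"
    unfolding eq set_lebesgue_integral_def
    using int nonneg unfolding set_integrable_def by (rule nn_integral_eq_integral)
qed

lemma set_borel_measurable_continuous_on:
  fixes f :: "complex \<Rightarrow> 'a::real_normed_vector"
  assumes "continuous_on A f" "A \<in> sets borel"
  shows "set_borel_measurable lborel A f"
  using borel_measurable_continuous_on_indicator[OF assms(2,1)] by (simp add: set_borel_measurable_def)

text \<open>Coinciding atoms are merged into a set with weights, so that the atoms have positive
  mutual distances. The measure enters the norm through its Poisson integral alone, hence
  \<open>poisson_eq\<close> is the only link to it.\<close>

locale point_mass_measure =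
  fixes \<mu> :: "complex measure" and Z :: "complex set" and w :: "complex \<Rightarrow> real"
  assumes finite_Z: "finite Z" and Z_nonempty: "Z \<noteq> {}"
    and Z_unit: "p \<in> Z \<Longrightarrow> cmod p = 1" and w_pos: "p \<in> Z \<Longrightarrow> w p > 0"
    and poisson_eq: "cmod z < 1 \<Longrightarrow> poisson \<mu> z = (\<Sum>p\<in>Z. w p * ((1 - (cmod z)\<^sup>2) / (cmod (p - z))\<^sup>2))"
begin

section \<open>Vector space structure and inner product\<close>

abbreviation "D \<equiv> dirichlet_space \<mu>"
abbreviation "N \<equiv> dirichlet_norm \<mu>"
abbreviation "IP \<equiv> dirichlet_inner \<mu>"

lemma poisson_summand_nonneg: "cmod z < 1 \<Longrightarrow> p \<in> Z \<Longrightarrow> 0 \<le> w p * ((1 - (cmod z)\<^sup>2) / (cmod (p - z))\<^sup>2)"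
  using w_pos[of p] abs_square_le_1[of "cmod z"] by simp

lemma poisson_nonneg: "cmod z < 1 \<Longrightarrow> poisson \<mu> z \<ge> 0"
  unfolding poisson_eq by (intro sum_nonneg poisson_summand_nonneg)

lemma continuous_on_poisson: "continuous_on (ball 0 1) (poisson \<mu>)"
proof -
  have "continuous_on (ball 0 1) (\<lambda>z. \<Sum>p\<in>Z. w p * ((1 - (cmod z)\<^sup>2) / (cmod (p - z))\<^sup>2))"
    using Z_unit by (intro continuous_intros) auto
  then show ?thesis
    by (rule continuous_on_cong[THEN iffD1, rotated 2]) (simp_all add: poisson_eq)
qed

lemma D_holomorphic: "f \<in> D \<Longrightarrow> f holomorphic_on ball 0 1"
  and D_outside: "f \<in> D \<Longrightarrow> cmod z \<ge> 1 \<Longrightarrow> f z = 0"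
  by (auto simp: dirichlet_space_def)

lemma D_continuous_deriv: "f \<in> D \<Longrightarrow> continuous_on (ball 0 1) (deriv f)"
  by (intro holomorphic_on_imp_continuous_on holomorphic_deriv D_holomorphic) auto

lemma energy_measurable:
  assumes "f holomorphic_on ball 0 1"
  shows "set_borel_measurable lborel (ball 0 1) (\<lambda>z. (cmod (deriv f z))\<^sup>2 * poisson \<mu> z)"
  using holomorphic_on_imp_continuous_on[OF holomorphic_deriv[OF assms open_ball]]
  by (intro set_borel_measurable_continuous_on continuous_intros continuous_on_poisson) auto

lemma energy_integrable:
  assumes "f \<in> D"
  shows "set_integrable lborel (ball 0 1) (\<lambda>z. (cmod (deriv f z))\<^sup>2 * poisson \<mu> z)"
    and "(\<integral>\<^sup>+z\<in>ball 0 1. ennreal ((cmod (deriv f z))\<^sup>2 * poisson \<mu> z) \<partial>lborel) =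
      ennreal (LINT z:ball 0 1|lborel. (cmod (deriv f z))\<^sup>2 * poisson \<mu> z)"
  using set_integrable_of_nn_integral[OF energy_measurable[OF D_holomorphic[OF assms]]] assms poisson_nonneg
  by (auto simp: dirichlet_space_def)

lemma energy_nonneg: "0 \<le> (LINT z:ball 0 1|lborel. (cmod (deriv f z))\<^sup>2 * poisson \<mu> z)"
  using poisson_nonneg unfolding set_lebesgue_integral_def by (intro integral_nonneg_AE AE_I2) (auto simp: indicator_def)

lemma norm_square: "(N f)\<^sup>2 = (cmod (f 0))\<^sup>2 + (LINT z:ball 0 1|lborel. (cmod (deriv f z))\<^sup>2 * poisson \<mu> z)"
  using energy_nonneg[of f] by (simp add: dirichlet_norm_def)

lemma N_nonneg: "N f \<ge> 0"
  using energy_nonneg[of f] by (simp add: dirichlet_norm_def)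

lemma inner_integrable:
  assumes "f \<in> D" "g \<in> D"
  shows "set_integrable lborel (ball 0 1) (\<lambda>z. deriv f z * cnj (deriv g z) * complex_of_real (poisson \<mu> z))"
  unfolding set_integrable_def
proof (rule Bochner_Integration.integrable_bound)
  show "integrable lborel (\<lambda>z. indicator (ball 0 1) z *\<^sub>R ((cmod (deriv f z))\<^sup>2 * poisson \<mu> z) +
      indicator (ball 0 1) z *\<^sub>R ((cmod (deriv g z))\<^sup>2 * poisson \<mu> z))"
    using energy_integrable(1)[OF assms(1)] energy_integrable(1)[OF assms(2)]
    unfolding set_integrable_def by (rule Bochner_Integration.integrable_add)
  show "(\<lambda>z. indicator (ball 0 1) z *\<^sub>R (deriv f z * cnj (deriv g z) * complex_of_real (poisson \<mu> z))) \<in> borel_measurable lborel"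
    unfolding set_borel_measurable_def[symmetric]
    by (intro set_borel_measurable_continuous_on continuous_intros continuous_on_poisson
        D_continuous_deriv[OF assms(1)] D_continuous_deriv[OF assms(2)]) auto
  show "AE z in lborel. norm (indicator (ball 0 1) z *\<^sub>R (deriv f z * cnj (deriv g z) * complex_of_real (poisson \<mu> z))) \<le>
      norm (indicator (ball 0 1) z *\<^sub>R ((cmod (deriv f z))\<^sup>2 * poisson \<mu> z) + indicator (ball 0 1) z *\<^sub>R ((cmod (deriv g z))\<^sup>2 * poisson \<mu> z))"
  proof (intro AE_I2)
    fix z :: complex
    show "norm (indicator (ball 0 1) z *\<^sub>R (deriv f z * cnj (deriv g z) * complex_of_real (poisson \<mu> z))) \<le>
      norm (indicator (ball 0 1) z *\<^sub>R ((cmod (deriv f z))\<^sup>2 * poisson \<mu> z) + indicator (ball 0 1) z *\<^sub>R ((cmod (deriv g z))\<^sup>2 * poisson \<mu> z))"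
    proof (cases "z \<in> ball 0 1")
      case True
      then have p: "poisson \<mu> z \<ge> 0" using poisson_nonneg by simp
      have "0 \<le> (cmod (deriv f z) - cmod (deriv g z))\<^sup>2" by simp
      then have "2 * (cmod (deriv f z) * cmod (deriv g z)) \<le> (cmod (deriv f z))\<^sup>2 + (cmod (deriv g z))\<^sup>2"
        unfolding power2_diff by linarith
      moreover have "0 \<le> cmod (deriv f z) * cmod (deriv g z)" by simp
      ultimately have "cmod (deriv f z) * cmod (deriv g z) \<le> (cmod (deriv f z))\<^sup>2 + (cmod (deriv g z))\<^sup>2" by linarith
      then have "cmod (deriv f z) * cmod (deriv g z) * poisson \<mu> z \<le> ((cmod (deriv f z))\<^sup>2 + (cmod (deriv g z))\<^sup>2) * poisson \<mu> z"
        using p by (rule mult_right_mono)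
      then show ?thesis using True p by (simp add: norm_mult distrib_right)
    qed simp
  qed
qed

lemma deriv_lincomb:
  assumes "f \<in> D" "g \<in> D" "z \<in> ball 0 1"
  shows "deriv (\<lambda>z. f z + c * g z) z = deriv f z + c * deriv g z"
  using holomorphic_derivI[OF D_holomorphic[OF assms(1)] open_ball assms(3)]
    holomorphic_derivI[OF D_holomorphic[OF assms(2)] open_ball assms(3)]
  by (intro DERIV_imp_deriv) (auto intro!: derivative_eq_intros)

lemma D_lincomb:
  assumes f: "f \<in> D" and g: "g \<in> D"
  shows "(\<lambda>z. f z + c * g z) \<in> D"
proof -
  have "(\<integral>\<^sup>+z\<in>ball 0 1. ennreal ((cmod (deriv (\<lambda>z. f z + c * g z) z))\<^sup>2 * poisson \<mu> z) \<partial>lborel) \<le>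
    (\<integral>\<^sup>+z. ennreal (indicator (ball 0 1) z *\<^sub>R (2 * ((cmod (deriv f z))\<^sup>2 * poisson \<mu> z) + 2 * (cmod c)\<^sup>2 * ((cmod (deriv g z))\<^sup>2 * poisson \<mu> z))) \<partial>lborel)"
  proof (rule nn_integral_mono)
    fix z
    show "ennreal ((cmod (deriv (\<lambda>z. f z + c * g z) z))\<^sup>2 * poisson \<mu> z) * indicator (ball 0 1) z \<le>
      ennreal (indicator (ball 0 1) z *\<^sub>R (2 * ((cmod (deriv f z))\<^sup>2 * poisson \<mu> z) + 2 * (cmod c)\<^sup>2 * ((cmod (deriv g z))\<^sup>2 * poisson \<mu> z)))"
    proof (cases "z \<in> ball 0 1")
      case True
      have "(cmod (deriv f z + c * deriv g z))\<^sup>2 \<le> (cmod (deriv f z) + cmod (c * deriv g z))\<^sup>2"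
        by (intro power_mono norm_triangle_ineq) simp
      also have "\<dots> \<le> 2 * (cmod (deriv f z))\<^sup>2 + 2 * (cmod (c * deriv g z))\<^sup>2"
        using zero_le_power2[of "cmod (deriv f z) - cmod (c * deriv g z)"]
        by (simp only: power2_sum power2_diff)
      finally have "(cmod (deriv f z + c * deriv g z))\<^sup>2 * poisson \<mu> z \<le>
          (2 * (cmod (deriv f z))\<^sup>2 + 2 * (cmod (c * deriv g z))\<^sup>2) * poisson \<mu> z"
        using poisson_nonneg[of z] True by (intro mult_right_mono) auto
      then show ?thesis using True
        by (simp add: deriv_lincomb[OF f g True] norm_mult power_mult_distrib algebra_simps ennreal_leI)
    qed simp
  qed
  also have "\<dots> < \<infinity>"
  proof -
    have "set_integrable lborel (ball 0 1) (\<lambda>z. 2 * ((cmod (deriv f z))\<^sup>2 * poisson \<mu> z) + 2 * (cmod c)\<^sup>2 * ((cmod (deriv g z))\<^sup>2 * poisson \<mu> z))"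
      by (intro set_integral_add set_integrable_mult_right energy_integrable(1) f g)
    then have "(\<integral>\<^sup>+z. ennreal (norm (indicator (ball 0 1) z *\<^sub>R (2 * ((cmod (deriv f z))\<^sup>2 * poisson \<mu> z) + 2 * (cmod c)\<^sup>2 * ((cmod (deriv g z))\<^sup>2 * poisson \<mu> z)))) \<partial>lborel) < \<infinity>"
      unfolding set_integrable_def integrable_iff_bounded by blast
    then show ?thesis
      by (rule le_less_trans[rotated]) (intro nn_integral_mono ennreal_leI, simp only: real_norm_def abs_ge_self)
  qed
  finally show ?thesis
    using f g by (auto simp: dirichlet_space_def intro!: holomorphic_intros)
qed

lemma inner_lincomb_left:
  assumes f: "f \<in> D" and g: "g \<in> D" and h: "h \<in> D"
  shows "IP (\<lambda>z. f z + c * g z) h = IP f h + c * IP g h"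
proof -
  have "(LINT z:ball 0 1|lborel. deriv (\<lambda>z. f z + c * g z) z * cnj (deriv h z) * complex_of_real (poisson \<mu> z)) =
    (LINT z:ball 0 1|lborel. deriv f z * cnj (deriv h z) * complex_of_real (poisson \<mu> z) + c * (deriv g z * cnj (deriv h z) * complex_of_real (poisson \<mu> z)))"
    by (intro set_lebesgue_integral_cong) (auto simp: deriv_lincomb[OF f g] algebra_simps)
  also have "\<dots> = (LINT z:ball 0 1|lborel. deriv f z * cnj (deriv h z) * complex_of_real (poisson \<mu> z)) +
      c * (LINT z:ball 0 1|lborel. deriv g z * cnj (deriv h z) * complex_of_real (poisson \<mu> z))"
    by (subst set_integral_add(2)) (auto intro!: inner_integrable f g h)
  finally show ?thesis by (simp add: dirichlet_inner_def algebra_simps)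
qed

lemma inner_commute: "IP g f = cnj (IP f g)"
proof -
  have "(LINT z:ball 0 1|lborel. deriv g z * cnj (deriv f z) * complex_of_real (poisson \<mu> z)) =
    cnj (LINT z:ball 0 1|lborel. deriv f z * cnj (deriv g z) * complex_of_real (poisson \<mu> z))"
    unfolding set_lebesgue_integral_def Bochner_Integration.integral_cnj[symmetric]
    by (intro Bochner_Integration.integral_cong refl) (simp add: scaleR_conv_of_real mult_ac)
  then show ?thesis by (simp add: dirichlet_inner_def)
qed

lemma inner_self: "IP f f = complex_of_real ((N f)\<^sup>2)"
proof -
  have "(LINT z:ball 0 1|lborel. deriv f z * cnj (deriv f z) * complex_of_real (poisson \<mu> z)) =
     (LINT z:ball 0 1|lborel. complex_of_real ((cmod (deriv f z))\<^sup>2 * poisson \<mu> z))"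
    by (simp only: complex_norm_square of_real_mult)
  then show ?thesis
    unfolding norm_square dirichlet_inner_def of_real_add complex_norm_square set_integral_complex_of_real by simp
qed

lemma inner_lincomb_right:
  assumes f: "f \<in> D" and g: "g \<in> D" and h: "h \<in> D"
  shows "IP h (\<lambda>z. f z + c * g z) = IP h f + cnj c * IP h g"
  by (simp add: inner_commute[of h "\<lambda>z. f z + c * g z"] inner_lincomb_left[OF f g h] inner_commute[of h f] inner_commute[of h g])

lemma norm_square_lincomb:
  assumes f: "f \<in> D" and g: "g \<in> D"
  shows "(N (\<lambda>z. f z + c * g z))\<^sup>2 = (N f)\<^sup>2 + 2 * Re (cnj c * IP f g) + (cmod c)\<^sup>2 * (N g)\<^sup>2"
proof -
  have "complex_of_real ((N (\<lambda>z. f z + c * g z))\<^sup>2) =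
     IP f f + cnj c * IP f g + cnj (cnj c * IP f g) + c * cnj c * IP g g"
    unfolding inner_self[symmetric] inner_lincomb_left[OF f g D_lincomb[OF f g]] inner_lincomb_right[OF f g f] inner_lincomb_right[OF f g g]
    by (simp add: algebra_simps inner_commute[of g f])
  also have "\<dots> = complex_of_real ((N f)\<^sup>2 + 2 * Re (cnj c * IP f g) + (cmod c)\<^sup>2 * (N g)\<^sup>2)"
    unfolding inner_self complex_norm_square[symmetric]
    using complex_add_cnj[of "cnj c * IP f g"] by (simp add: add.assoc)
  finally show ?thesis by (simp only: of_real_eq_iff)
qed

lemma cauchy_schwarz:
  assumes f: "f \<in> D" and g: "g \<in> D"
  shows "(cmod (IP f g))\<^sup>2 \<le> (N f)\<^sup>2 * (N g)\<^sup>2"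
proof (rule square_le_of_nonneg_quadratic)
  show "0 \<le> (N f)\<^sup>2 + 2 * Re (cnj c * IP f g) + (cmod c)\<^sup>2 * (N g)\<^sup>2" for c
    unfolding norm_square_lincomb[OF f g, symmetric] by simp
qed simp

lemma D_zero: "(\<lambda>z. 0) \<in> D"
  by (simp add: dirichlet_space_def)

text \<open>The constant function 1, cut off outside the disc as elements of the space have to be.
  It makes the minimal norm problem feasible and is the test function for exceptional
  points.\<close>

lemma D_one: "(\<lambda>z. indicator (ball 0 1) z) \<in> D"
proof -
  have "deriv (indicator (ball 0 1)) z = (0::complex)" if "z \<in> ball 0 1" for z :: complex
  proof (rule DERIV_imp_deriv)
    have "((\<lambda>z. 1) has_field_derivative 0) (at z)" by simp
    then show "(indicator (ball 0 1) has_field_derivative (0::complex)) (at z)"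
      by (rule has_field_derivative_transform_within_open[where S="ball 0 1"]) (use that in auto)
  qed
  then have "(\<integral>\<^sup>+z\<in>ball 0 1. ennreal ((cmod (deriv (indicator (ball 0 1)) z))\<^sup>2 * poisson \<mu> z) \<partial>lborel) = (\<integral>\<^sup>+(z::complex). 0 \<partial>lborel)"
    by (intro nn_integral_cong) (auto simp: indicator_def)
  moreover have "(\<lambda>z. indicator (ball 0 1) z :: complex) holomorphic_on ball 0 1"
    by (rule holomorphic_transform[of "\<lambda>z. 1"]) auto
  ultimately show ?thesis by (simp add: dirichlet_space_def)
qed

lemma D_cmult: "g \<in> D \<Longrightarrow> (\<lambda>z. c * g z) \<in> D"
  using D_lincomb[OF D_zero, of g c] by simp

lemma D_sum: "finite A \<Longrightarrow> (\<And>i. i \<in> A \<Longrightarrow> x i \<in> D) \<Longrightarrow> (\<lambda>z. \<Sum>i\<in>A. a i * x i z) \<in> D"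
proof (induction A rule: finite_induct)
  case (insert i A)
  then show ?case
    using D_lincomb[of "\<lambda>z. \<Sum>i\<in>A. a i * x i z" "x i" "a i"] by (simp add: add.commute)
qed (simp add: D_zero)

lemma inner_sum_right:
  "finite A \<Longrightarrow> (\<And>i. i \<in> A \<Longrightarrow> x i \<in> D) \<Longrightarrow> f \<in> D \<Longrightarrow>
    IP f (\<lambda>z. \<Sum>i\<in>A. a i * x i z) = (\<Sum>i\<in>A. cnj (a i) * IP f (x i))"
proof (induction A rule: finite_induct)
  case empty
  then show ?case by (simp add: dirichlet_inner_def)
next
  case (insert i A)
  then show ?case
    using inner_lincomb_right[of "\<lambda>z. \<Sum>i\<in>A. a i * x i z" "x i" f "a i"] D_sum[of A x a] by (simp add: add.commute)
qed

section \<open>Point evaluations and existence of the kernel\<close>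

lemma evaluation_bound:
  assumes f: "f \<in> D" and p: "p \<in> Z" and z: "cmod z < 1"
  shows "cmod (f z) \<le> (1 + 4 / sqrt (w p)) * (1 + cmod (p - z) / sqrt (1 - cmod z)) * N f"
proof -
  define J where "J = (LINT z:ball 0 1|lborel. (cmod (deriv f z))\<^sup>2 * poisson \<mu> z)"
  have J: "J \<ge> 0" "J \<le> (N f)\<^sup>2" by (auto simp: J_def energy_nonneg norm_square)
  have wp: "w p > 0" by (rule w_pos[OF p])
  have "(\<integral>\<^sup>+z\<in>ball 0 1. ennreal ((cmod (deriv f z))\<^sup>2 * ((1 - (cmod z)\<^sup>2) / (cmod (p - z))\<^sup>2)) \<partial>lborel) \<le>
    (\<integral>\<^sup>+z. ennreal (indicator (ball 0 1) z *\<^sub>R (1 / w p * ((cmod (deriv f z))\<^sup>2 * poisson \<mu> z))) \<partial>lborel)"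
  proof (rule nn_integral_mono)
    fix z
    show "ennreal ((cmod (deriv f z))\<^sup>2 * ((1 - (cmod z)\<^sup>2) / (cmod (p - z))\<^sup>2)) * indicator (ball 0 1) z \<le>
       ennreal (indicator (ball 0 1) z *\<^sub>R (1 / w p * ((cmod (deriv f z))\<^sup>2 * poisson \<mu> z)))"
    proof (cases "z \<in> ball 0 1")
      case True
      \<comment> \<open>Poisson summands are nonnegative, so discarding all atoms but p bounds the
        local integral at p by 1 / w p times the full energy.\<close>
      have "w p * ((1 - (cmod z)\<^sup>2) / (cmod (p - z))\<^sup>2) \<le> poisson \<mu> z"
        using True p finite_Z poisson_eq[of z]
          member_le_sum[of p Z "\<lambda>p. w p * ((1 - (cmod z)\<^sup>2) / (cmod (p - z))\<^sup>2)"] poisson_summand_nonneg[of z] by simp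
      then have "(1 - (cmod z)\<^sup>2) / (cmod (p - z))\<^sup>2 \<le> 1 / w p * poisson \<mu> z"
        using wp by (simp add: pos_le_divide_eq mult.commute)
      then have "(cmod (deriv f z))\<^sup>2 * ((1 - (cmod z)\<^sup>2) / (cmod (p - z))\<^sup>2) \<le> (cmod (deriv f z))\<^sup>2 * (1 / w p * poisson \<mu> z)"
        by (rule mult_left_mono) simp
      then show ?thesis using True by (simp add: ennreal_leI mult_ac)
    qed simp
  qed
  also have "\<dots> = ennreal (LINT z:ball 0 1|lborel. 1 / w p * ((cmod (deriv f z))\<^sup>2 * poisson \<mu> z))"
    unfolding set_lebesgue_integral_def
  proof (rule nn_integral_eq_integral)
    show "integrable lborel (\<lambda>z. indicator (ball 0 1) z *\<^sub>R (1 / w p * ((cmod (deriv f z))\<^sup>2 * poisson \<mu> z)))"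
      using set_integrable_mult_right[OF energy_integrable(1)[OF f], of "1 / w p"] unfolding set_integrable_def by simp
    show "AE z in lborel. 0 \<le> indicator (ball 0 1) z *\<^sub>R (1 / w p * ((cmod (deriv f z))\<^sup>2 * poisson \<mu> z))"
      using wp poisson_nonneg by (auto simp: indicator_def)
  qed
  also have "\<dots> = ennreal (J / w p)" by (simp add: J_def)
  finally have le: "(\<integral>\<^sup>+z\<in>ball 0 1. ennreal ((cmod (deriv f z))\<^sup>2 * ((1 - (cmod z)\<^sup>2) / (cmod (p - z))\<^sup>2)) \<partial>lborel) \<le> ennreal (J / w p)" .
  define E where "E = 1 + cmod (p - z) / sqrt (1 - cmod z)"
  have E: "E \<ge> 1" using z by (simp add: E_def)
  have "cmod (f z - f 0) \<le> 4 * sqrt (J / w p) * E"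
    using evaluation_bound_of_local_dirichlet_integral[OF D_holomorphic[OF f] Z_unit[OF p] _ le z] J wp unfolding E_def by simp
  also have "sqrt (J / w p) \<le> N f / sqrt (w p)"
    using wp N_nonneg[of f] real_sqrt_le_mono[OF J(2)] by (simp add: real_sqrt_divide divide_right_mono)
  finally have 1: "cmod (f z - f 0) \<le> 4 * (N f / sqrt (w p)) * E"
    using E by (simp add: mult_right_mono)
  have "(cmod (f 0))\<^sup>2 \<le> (N f)\<^sup>2" using J by (simp add: norm_square J_def)
  then have "cmod (f 0) \<le> N f" using N_nonneg power2_le_imp_le by blast
  also have "\<dots> \<le> N f * E" using E N_nonneg[of f] mult_left_mono[of 1 E "N f"] by simp
  finally have "cmod (f z) \<le> N f * E + 4 * (N f / sqrt (w p)) * E"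
    using 1 norm_triangle_ineq2[of "f z" "f 0"] by linarith
  then show ?thesis unfolding E_def[symmetric] by (simp add: algebra_simps)
qed

lemma N_eq_0: "f \<in> D \<Longrightarrow> N f = 0 \<Longrightarrow> f = (\<lambda>z. 0)"
proof
  fix z assume f: "f \<in> D" "N f = 0"
  obtain p where "p \<in> Z" using Z_nonempty by blast
  then show "f z = 0"
    using evaluation_bound[OF f(1), of p z] f D_outside[OF f(1), of z] by (cases "cmod z < 1") auto
qed

text \<open>Norm-bounded subsets of the space are locally bounded, which is the hypothesis of
  Montel's theorem.\<close>

lemma locally_bounded_evaluation:
  assumes "compact K" "K \<subseteq> ball 0 1"
  shows "\<exists>B. \<forall>f\<in>D. \<forall>z\<in>K. cmod (f z) \<le> B * N f"
proof -
  obtain p where p: "p \<in> Z" using Z_nonempty by blast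
  have "continuous_on K (\<lambda>z. (1 + 4 / sqrt (w p)) * (1 + cmod (p - z) / sqrt (1 - cmod z)))"
    using assms(2) by (intro continuous_intros) auto
  then have "bounded ((\<lambda>z. (1 + 4 / sqrt (w p)) * (1 + cmod (p - z) / sqrt (1 - cmod z))) ` K)"
    using assms(1) compact_continuous_image compact_imp_bounded by blast
  then obtain B where B: "\<And>z. z \<in> K \<Longrightarrow> (1 + 4 / sqrt (w p)) * (1 + cmod (p - z) / sqrt (1 - cmod z)) \<le> B"
    by (auto simp: bounded_iff) (meson abs_le_D1)
  show ?thesis
  proof (intro exI ballI)
    fix f z assume f: "f \<in> D" and z: "z \<in> K"
    then have "cmod (f z) \<le> (1 + 4 / sqrt (w p)) * (1 + cmod (p - z) / sqrt (1 - cmod z)) * N f"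
      using assms(2) by (intro evaluation_bound[OF f p]) auto
    also have "\<dots> \<le> B * N f" by (intro mult_right_mono B z N_nonneg)
    finally show "cmod (f z) \<le> B * N f" .
  qed
qed

text \<open>The multiple of this minimizer that represents evaluation at \<open>l\<close> is the kernel; compactness (Montel and
  Fatou) replaces completeness of the space.\<close>

lemma exists_minimal_norm:
  assumes l: "cmod l < 1"
  shows "\<exists>f\<in>D. f l = 1 \<and> (\<forall>g\<in>D. g l = 1 \<longrightarrow> (N f)\<^sup>2 \<le> (N g)\<^sup>2)"
proof -
  define S where "S = {(N g)\<^sup>2 | g. g \<in> D \<and> g l = 1}"
  define m where "m = Inf S"
  have bdd: "bdd_below S" by (rule bdd_belowI[of _ 0]) (auto simp: S_def)
  have "S \<noteq> {}" using D_one l by (auto simp: S_def intro!: exI[of _ "\<lambda>z. indicator (ball 0 1) z"])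
  then have "\<exists>f. f \<in> D \<and> f l = 1 \<and> (N f)\<^sup>2 < m + 1 / real (Suc n)" for n
    using cInf_lessD[of S "m + 1 / real (Suc n)"] by (force simp: S_def m_def)
  then obtain F where F: "\<And>n. F n \<in> D" "\<And>n. F n l = 1" "\<And>n. (N (F n))\<^sup>2 < m + 1 / real (Suc n)"
    by metis
  define H where "H = {f \<in> D. (N f)\<^sup>2 \<le> m + 1}"
  have FH: "F n \<in> H" for n
  proof -
    have "1 / real (Suc n) \<le> 1" by simp
    then have "(N (F n))\<^sup>2 \<le> m + 1" using F(3)[of n] by linarith
    then show ?thesis using F(1) by (simp add: H_def)
  qed
  obtain g r where g: "g holomorphic_on ball 0 1" and r: "strict_mono (r :: nat \<Rightarrow> nat)"
    and lim: "\<And>x. x \<in> ball 0 1 \<Longrightarrow> (\<lambda>n. F (r n) x) \<longlonglongrightarrow> g x"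
    and ulim: "\<And>K. compact K \<Longrightarrow> K \<subseteq> ball 0 1 \<Longrightarrow> uniform_limit K (F \<circ> r) g sequentially"
  proof (rule Montel[of "ball 0 1" H F])
    show "h holomorphic_on ball 0 1" if "h \<in> H" for h
      using that D_holomorphic by (simp add: H_def)
    show "\<exists>B. \<forall>h\<in>H. \<forall>z\<in>K. cmod (h z) \<le> B" if K: "compact K" "K \<subseteq> ball 0 1" for K
    proof -
      obtain B where B: "\<And>f z. f \<in> D \<Longrightarrow> z \<in> K \<Longrightarrow> cmod (f z) \<le> B * N f"
        using locally_bounded_evaluation[OF K] by blast
      have "cmod (h z) \<le> \<bar>B\<bar> * sqrt (m + 1)" if h: "h \<in> H" and z: "z \<in> K" for h z
      proof -
        have "cmod (h z) \<le> B * N h" using B h z by (simp add: H_def)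
        also have "\<dots> \<le> \<bar>B\<bar> * N h" by (intro mult_right_mono N_nonneg) simp
        also have "\<dots> \<le> \<bar>B\<bar> * sqrt (m + 1)"
          using h by (intro mult_left_mono real_le_rsqrt) (auto simp: H_def)
        finally show ?thesis .
      qed
      then show ?thesis by blast
    qed
  qed (use FH in auto)
  \<comment> \<open>Montel's theorem controls the limit on the disc only; membership in the space
    also asks for the value 0 outside.\<close>
  define f where "f z = (if z \<in> ball 0 1 then g z else 0)" for z
  have hol_f: "f holomorphic_on ball 0 1"
    by (rule holomorphic_transform[OF g]) (simp add: f_def)
  \<comment> \<open>Locally uniform convergence passes to derivatives, so the energy integrands
    converge pointwise, as Fatou's lemma requires.\<close>
  have lim_deriv: "(\<lambda>n. deriv (F (r n)) z) \<longlonglongrightarrow> deriv f z" if z: "z \<in> ball 0 1" for z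
  proof -
    obtain e where e: "e > 0" "cball z e \<subseteq> ball 0 1"
      using z open_contains_cball[of "ball (0::complex) 1"] by blast
    have sub: "ball z e \<subseteq> ball 0 1" using e by auto
    have "uniform_limit (ball z e) (\<lambda>n. F (r n)) g sequentially"
      using uniform_limit_on_subset[OF ulim[OF compact_cball e(2)], of "ball z e"] by (simp add: o_def)
    then have "(\<lambda>n. deriv (F (r n)) z) \<longlonglongrightarrow> deriv g z"
    proof (rule deriv_complex_uniform_limit)
      show "\<forall>\<^sub>F n in sequentially. F (r n) holomorphic_on ball z e"
        by (intro always_eventually allI holomorphic_on_subset[OF D_holomorphic[OF F(1)] sub])
    qed (use e in auto)
    moreover have "deriv f z = deriv g z"
      by (rule complex_derivative_transform_within_open[OF hol_f g]) (use z in \<open>auto simp: f_def\<close>)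
    ultimately show ?thesis by simp
  qed
  define J where "J h = (LINT z:ball 0 1|lborel. (cmod (deriv h z))\<^sup>2 * poisson \<mu> z)" for h
  let ?u = "\<lambda>h z. ennreal ((cmod (deriv h z))\<^sup>2 * poisson \<mu> z) * indicator (ball 0 1) z"
  have meas: "?u h \<in> borel_measurable lborel" if "h \<in> D" for h
  proof -
    have "(\<lambda>z. ennreal (indicator (ball 0 1) z *\<^sub>R ((cmod (deriv h z))\<^sup>2 * poisson \<mu> z))) \<in> borel_measurable lborel"
      using energy_measurable[OF D_holomorphic[OF that]] unfolding set_borel_measurable_def by (rule measurable_compose) simp
    also have "(\<lambda>z. ennreal (indicator (ball 0 1) z *\<^sub>R ((cmod (deriv h z))\<^sup>2 * poisson \<mu> z))) = ?u h"
      by (auto simp: indicator_def)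
    finally show ?thesis .
  qed
  have lim_u: "(\<lambda>n. ?u (F (r n)) z) \<longlonglongrightarrow> ?u f z" for z
  proof (cases "z \<in> ball 0 1")
    case True
    then show ?thesis by (auto intro!: tendsto_ennrealI tendsto_intros lim_deriv)
  qed simp
  \<comment> \<open>The value at 0 is split off from the norm because it converges; only the energy
    can drop in the limit, and there Fatou's inequality has the right direction.\<close>
  have lim0: "(\<lambda>n. m + 1 / real (Suc (r n)) - (cmod (F (r n) 0))\<^sup>2) \<longlonglongrightarrow> m + 0 - (cmod (g 0))\<^sup>2"
  proof (intro tendsto_intros lim)
    show "(\<lambda>n. 1 / real (Suc (r n))) \<longlonglongrightarrow> 0"
      using LIMSEQ_subseq_LIMSEQ[OF lim_inverse_n' r] LIMSEQ_subseq_LIMSEQ[OF LIMSEQ_inverse_real_of_nat r]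
      by (simp add: o_def inverse_eq_divide)
  qed simp
  have J_le: "J (F n) \<le> m + 1 / real (Suc n) - (cmod (F n 0))\<^sup>2" for n
    using F(3)[of n] by (simp add: norm_square J_def)
  have J_nonneg: "J h \<ge> 0" for h unfolding J_def by (rule energy_nonneg)
  have nonneg: "0 \<le> m - (cmod (g 0))\<^sup>2"
  proof -
    have "0 \<le> m + 0 - (cmod (g 0))\<^sup>2"
      by (rule LIMSEQ_le_const[OF lim0]) (use J_le J_nonneg order_trans in blast)
    then show ?thesis by simp
  qed
  have "(\<integral>\<^sup>+z. ?u f z \<partial>lborel) = (\<integral>\<^sup>+z. liminf (\<lambda>n. ?u (F (r n)) z) \<partial>lborel)"
    using lim_imp_Liminf[OF sequentially_bot lim_u] by simp
  also have "\<dots> \<le> liminf (\<lambda>n. \<integral>\<^sup>+z. ?u (F (r n)) z \<partial>lborel)"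
    by (intro nn_integral_liminf meas F(1))
  also have "\<dots> = liminf (\<lambda>n. ennreal (J (F (r n))))"
    unfolding J_def energy_integrable(2)[OF F(1)] ..
  also have "\<dots> \<le> liminf (\<lambda>n. ennreal (m + 1 / real (Suc (r n)) - (cmod (F (r n) 0))\<^sup>2))"
    by (intro Liminf_mono always_eventually allI ennreal_leI J_le)
  also have "\<dots> = ennreal (m - (cmod (g 0))\<^sup>2)"
    using lim_imp_Liminf[OF sequentially_bot tendsto_ennrealI[OF lim0]] by simp
  finally have le: "(\<integral>\<^sup>+z. ?u f z \<partial>lborel) \<le> ennreal (m - (cmod (g 0))\<^sup>2)" .
  have fD: "f \<in> D"
    using hol_f le_less_trans[OF le ennreal_less_top] by (auto simp: dirichlet_space_def f_def)
  have "J f \<le> m - (cmod (g 0))\<^sup>2"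
    using le nonneg unfolding energy_integrable(2)[OF fD] J_def by simp
  then have Nf: "(N f)\<^sup>2 \<le> m" by (simp add: norm_square J_def f_def)
  have fl: "f l = 1"
  proof -
    have "(\<lambda>n. 1) \<longlonglongrightarrow> g l" using lim[of l] l F(2) by simp
    then have "g l = 1" using LIMSEQ_unique[OF tendsto_const] by metis
    then show ?thesis using l by (simp add: f_def)
  qed
  have "m \<le> (N h)\<^sup>2" if "h \<in> D" "h l = 1" for h
    unfolding m_def by (rule cInf_lower[OF _ bdd]) (use that in \<open>auto simp: S_def\<close>)
  then show ?thesis using fD fl Nf order_trans by blast
qed

lemma inner_zero_right: "IP h (\<lambda>z. 0) = 0"
  by (simp add: dirichlet_inner_def)

lemma inner_cmult_right: "g \<in> D \<Longrightarrow> h \<in> D \<Longrightarrow> IP h (\<lambda>z. c * g z) = cnj c * IP h g"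
  using inner_lincomb_right[OF D_zero, of g h c] by (simp add: inner_zero_right)

text \<open>Perturbing the minimizer f by multiples of any h with h(l) = 0 shows that f is
  orthogonal to h. Applied to h = F - F(l) f this gives the inner product of F and f as F(l) times
  the squared norm of f, so dividing f by that number represents evaluation.\<close>

lemma kernel_unique_existence:
  assumes l: "cmod l < 1"
  shows "\<exists>!k. k \<in> D \<and> (\<forall>f\<in>D. f l = IP f k)"
proof (rule ex_ex1I)
  obtain f where f: "f \<in> D" "f l = 1" and min: "\<And>g. g \<in> D \<Longrightarrow> g l = 1 \<Longrightarrow> (N f)\<^sup>2 \<le> (N g)\<^sup>2"
    using exists_minimal_norm[OF l] by blast
  have "N f \<noteq> 0" using N_eq_0[OF f(1)] f(2) by auto
  have orth: "IP h f = 0" if h: "h \<in> D" "h l = 0" for h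
  proof -
    have "(cmod (IP f h))\<^sup>2 \<le> 0 * (N h)\<^sup>2"
    proof (rule square_le_of_nonneg_quadratic)
      fix c
      have "(N f)\<^sup>2 \<le> (N (\<lambda>z. f z + c * h z))\<^sup>2"
        by (intro min D_lincomb f h) (simp add: f h)
      then show "0 \<le> 0 + 2 * Re (cnj c * IP f h) + (cmod c)\<^sup>2 * (N h)\<^sup>2"
        unfolding norm_square_lincomb[OF f(1) h(1)] by linarith
    qed simp
    then show ?thesis using inner_commute[of h f] by simp
  qed
  show "\<exists>k. k \<in> D \<and> (\<forall>f\<in>D. f l = IP f k)"
  proof (intro exI conjI ballI)
    show "(\<lambda>z. complex_of_real (1 / (N f)\<^sup>2) * f z) \<in> D" by (intro D_cmult f)
    fix F assume F: "F \<in> D"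
    have "IP (\<lambda>z. F z + (- F l) * f z) f = 0"
      by (rule orth[OF D_lincomb[OF F f(1)]]) (simp add: f)
    then have "IP F f = F l * complex_of_real ((N f)\<^sup>2)"
      unfolding inner_lincomb_left[OF F f(1) f(1)] inner_self by simp
    then show "F l = IP F (\<lambda>z. complex_of_real (1 / (N f)\<^sup>2) * f z)"
      using \<open>N f \<noteq> 0\<close> by (subst inner_cmult_right[OF f(1) F]) simp
  qed
  fix k k' assume k: "k \<in> D \<and> (\<forall>f\<in>D. f l = IP f k)" and k': "k' \<in> D \<and> (\<forall>f\<in>D. f l = IP f k')"
  let ?d = "\<lambda>z. k z + (- 1) * k' z"
  have d: "?d \<in> D" by (intro D_lincomb) (use k k' in auto)
  have "IP ?d ?d = IP ?d k + cnj (- 1) * IP ?d k'"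
    by (rule inner_lincomb_right) (use k k' d in auto)
  also have "\<dots> = 0" using k k' d by (metis add.right_inverse complex_cnj_minus complex_cnj_one mult_1 mult_minus_left)
  finally have "N ?d = 0" unfolding inner_self by simp
  then have "?d = (\<lambda>z. 0)" by (rule N_eq_0[OF d])
  then show "k = k'" by (auto simp: fun_eq_iff)
qed

section \<open>Reproducing kernels and duality\<close>

abbreviation "ker \<equiv> dirichlet_kernel \<mu>"

lemma kernel_in_D: "cmod l < 1 \<Longrightarrow> ker l \<in> D"
  and kernel_reproducing: "cmod l < 1 \<Longrightarrow> f \<in> D \<Longrightarrow> IP f (ker l) = f l"
  using theI'[OF kernel_unique_existence[of l]] unfolding dirichlet_kernel_def[symmetric] by auto

lemma kernel_norm_pos:
  assumes "cmod l < 1"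
  shows "N (ker l) > 0"
proof -
  have "N (ker l) \<noteq> 0"
  proof
    assume "N (ker l) = 0"
    then have "ker l = (\<lambda>z. 0)" by (rule N_eq_0[OF kernel_in_D[OF assms]])
    then show False
      using kernel_reproducing[OF assms D_one] assms by (simp add: inner_zero_right)
  qed
  then show ?thesis using N_nonneg[of "ker l"] by simp
qed

text \<open>The squared kernel norm is the value of the kernel at its own point; the evaluation
  bound applied to the kernel itself then loses one power of the norm.\<close>

lemma kernel_norm_le:
  assumes l: "cmod l < 1" and p: "p \<in> Z"
  shows "N (ker l) \<le> (1 + 4 / sqrt (w p)) * (1 + cmod (p - l) / sqrt (1 - cmod l))"
proof -
  have "complex_of_real ((N (ker l))\<^sup>2) = ker l l"
    using kernel_reproducing[OF l kernel_in_D[OF l]] by (simp add: inner_self)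
  then have "(N (ker l))\<^sup>2 = cmod (ker l l)"
    by (metis abs_of_nonneg norm_of_real zero_le_power2)
  also have "\<dots> \<le> (1 + 4 / sqrt (w p)) * (1 + cmod (p - l) / sqrt (1 - cmod l)) * N (ker l)"
    by (rule evaluation_bound[OF kernel_in_D[OF l] p l])
  finally show ?thesis using kernel_norm_pos[OF l] by (simp add: power2_eq_square)
qed

lemma normalized_kernel_in_D: "cmod l < 1 \<Longrightarrow> normalized_kernel \<mu> l \<in> D"
  using D_cmult[OF kernel_in_D, of l "1 / complex_of_real (N (ker l))"] by (simp add: normalized_kernel_def)

lemma inner_normalized_kernel:
  "cmod l < 1 \<Longrightarrow> f \<in> D \<Longrightarrow> IP f (normalized_kernel \<mu> l) = f l / complex_of_real (N (ker l))"
  using inner_cmult_right[OF kernel_in_D, of l f "1 / complex_of_real (N (ker l))"] kernel_reproducing[of l f]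
  by (simp add: normalized_kernel_def)

lemma inner_kernel_combination:
  assumes F: "finite F" and l: "\<And>n. n \<in> F \<Longrightarrow> cmod (lam n) < 1" and f: "f \<in> D"
  shows "IP f (\<lambda>z. \<Sum>n\<in>F. a n * normalized_kernel \<mu> (lam n) z) =
    (\<Sum>n\<in>F. cnj (a n) * (f (lam n) / complex_of_real (N (ker (lam n)))))"
  using inner_sum_right[OF F, of "\<lambda>n. normalized_kernel \<mu> (lam n)" f a] normalized_kernel_in_D l f
  by (simp add: inner_normalized_kernel)

text \<open>Take as coefficients the inner products of f with the normalized kernels. The pairing of
  f with this combination is the sum s on the left, so Cauchy-Schwarz and the Bessel bound give s^2
  \<le> B s times the squared norm of f.\<close>

lemma bessel_imp_sum_evaluation_le:
  assumes F: "finite F" and l: "\<And>n. n \<in> F \<Longrightarrow> cmod (lam n) < 1" and f: "f \<in> D"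
    and bessel: "\<And>a. (N (\<lambda>z. \<Sum>n\<in>F. a n * normalized_kernel \<mu> (lam n) z))\<^sup>2 \<le> B * (\<Sum>n\<in>F. (cmod (a n))\<^sup>2)"
    and B: "B > 0"
  shows "(\<Sum>n\<in>F. (cmod (f (lam n)) / N (ker (lam n)))\<^sup>2) \<le> B * (N f)\<^sup>2"
proof -
  define a where "a n = f (lam n) / complex_of_real (N (ker (lam n)))" for n
  let ?x = "\<lambda>z. \<Sum>n\<in>F. a n * normalized_kernel \<mu> (lam n) z"
  let ?s = "\<Sum>n\<in>F. (cmod (a n))\<^sup>2"
  have x: "?x \<in> D" by (intro D_sum F normalized_kernel_in_D l)
  have "IP f ?x = of_real ?s"
    by (subst inner_kernel_combination[of F lam f a, OF F l f])
       (simp_all only: a_def[symmetric] of_real_sum complex_norm_square mult.commute)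
  then have "?s\<^sup>2 \<le> (N f)\<^sup>2 * (N ?x)\<^sup>2"
    using cauchy_schwarz[OF f x] by (simp only: norm_of_real power2_abs)
  also have "\<dots> \<le> (N f)\<^sup>2 * (B * ?s)"
    by (intro mult_left_mono bessel) simp
  finally have "?s * ?s \<le> (B * (N f)\<^sup>2) * ?s" by (simp add: power2_eq_square mult_ac)
  moreover have "?s \<ge> 0" by (intro sum_nonneg) simp
  ultimately have "?s \<le> B * (N f)\<^sup>2" using B by (cases "?s = 0") (auto simp: mult_le_cancel_right)
  moreover have "?s = (\<Sum>n\<in>F. (cmod (f (lam n)) / N (ker (lam n)))\<^sup>2)"
    using N_nonneg by (intro sum.cong refl) (simp add: a_def norm_divide)
  ultimately show ?thesis by simp
qed

text \<open>Pairing the interpolating f with the kernel combination reproduces the sum of the |a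
  n|^2; Cauchy-Schwarz then forces the combination to be large because f is small.\<close>

lemma interpolation_imp_lower_bound:
  assumes F: "finite F" and l: "\<And>n. n \<in> F \<Longrightarrow> cmod (lam n) < 1" and f: "f \<in> D"
    and interp: "\<And>n. n \<in> F \<Longrightarrow> f (lam n) = a n * complex_of_real (N (ker (lam n)))"
    and le: "(N f)\<^sup>2 \<le> C * (\<Sum>n\<in>F. (cmod (a n))\<^sup>2)"
  shows "(\<Sum>n\<in>F. (cmod (a n))\<^sup>2) \<le> C * (N (\<lambda>z. \<Sum>n\<in>F. a n * normalized_kernel \<mu> (lam n) z))\<^sup>2"
proof -
  let ?x = "\<lambda>z. \<Sum>n\<in>F. a n * normalized_kernel \<mu> (lam n) z"
  let ?s = "\<Sum>n\<in>F. (cmod (a n))\<^sup>2"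
  have x: "?x \<in> D" by (intro D_sum F normalized_kernel_in_D l)
  have "IP f ?x = (\<Sum>n\<in>F. cnj (a n) * a n)"
  proof (subst inner_kernel_combination[of F lam f a, OF F l f])
    show "(\<Sum>n\<in>F. cnj (a n) * (f (lam n) / complex_of_real (N (ker (lam n))))) = (\<Sum>n\<in>F. cnj (a n) * a n)"
    proof (intro sum.cong refl)
      fix n assume n: "n \<in> F"
      then show "cnj (a n) * (f (lam n) / complex_of_real (N (ker (lam n)))) = cnj (a n) * a n"
        using kernel_norm_pos[OF l[OF n]] by (simp add: interp)
    qed
  qed
  also have "\<dots> = of_real ?s" unfolding of_real_sum complex_norm_square by (simp add: mult.commute)
  finally have "?s\<^sup>2 \<le> (N f)\<^sup>2 * (N ?x)\<^sup>2"
    using cauchy_schwarz[OF f x] by (simp only: norm_of_real power2_abs)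
  also have "\<dots> \<le> (C * ?s) * (N ?x)\<^sup>2"
    by (intro mult_right_mono le) simp
  finally have *: "?s * ?s \<le> (C * (N ?x)\<^sup>2) * ?s" by (simp add: power2_eq_square mult_ac)
  have s: "?s \<ge> 0" by (intro sum_nonneg) simp
  show ?thesis
  proof (cases "?s = 0")
    case True
    then have "a n = 0" if "n \<in> F" for n using F that by (simp add: sum_nonneg_eq_0_iff)
    then have "?x = (\<lambda>z. 0)" by simp
    then have "N ?x = 0" using inner_self[of ?x] by (simp add: inner_zero_right)
    then show ?thesis using True by simp
  next
    case False
    then show ?thesis using * s by (simp add: mult_le_cancel_right)
  qed
qed

section \<open>Comparison with the Hardy space\<close>

definition "q z = (\<Prod>p\<in>Z. z - p)"

text \<open>At the atom p nearest to z every other factor of q satisfies |z - p'| \<ge> |p' - p| /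
  2, because the triangle through z has its shorter side at p.\<close>

lemma exists_close_atom:
  "\<exists>c>0. \<forall>z. \<exists>p\<in>Z. cmod (p - z) \<le> c * cmod (q z)"
proof -
  define d where "d p = (\<Prod>p'\<in>Z - {p}. cmod (p' - p) / 2)" for p
  have d: "d p > 0" for p unfolding d_def by (intro prod_pos) auto
  \<comment> \<open>Which atom is nearest depends on z; the sum over all atoms dominates every
    single 1 / d p.\<close>
  define c where "c = (\<Sum>p\<in>Z. 1 / d p)"
  have "c > 0" unfolding c_def using d by (intro sum_pos finite_Z Z_nonempty) auto
  moreover have "\<exists>p\<in>Z. cmod (p - z) \<le> c * cmod (q z)" for z
  proof -
    define p where "p = arg_min_on (\<lambda>p. cmod (p - z)) Z"
    have p: "p \<in> Z" unfolding p_def by (intro arg_min_if_finite finite_Z Z_nonempty)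
    have min: "cmod (p - z) \<le> cmod (p' - z)" if "p' \<in> Z" for p'
      unfolding p_def using arg_min_least[OF finite_Z Z_nonempty that, of "\<lambda>p. cmod (p - z)"] .
    have "d p \<le> (\<Prod>p'\<in>Z - {p}. cmod (z - p'))"
      unfolding d_def
    proof (intro prod_mono conjI)
      fix p' assume "p' \<in> Z - {p}"
      then have "cmod (p - z) \<le> cmod (p' - z)" using min by simp
      moreover have "cmod (p' - p) \<le> cmod (p' - z) + cmod (p - z)"
        using norm_triangle_ineq4[of "p' - z" "p - z"] by simp
      ultimately show "cmod (p' - p) / 2 \<le> cmod (z - p')" by (simp add: norm_minus_commute)
    qed simp
    then have "cmod (z - p) * d p \<le> cmod (z - p) * (\<Prod>p'\<in>Z - {p}. cmod (z - p'))"
      by (rule mult_left_mono) simp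
    also have "\<dots> = cmod (q z)"
      unfolding q_def prod_norm[symmetric] using prod.remove[OF finite_Z p, of "\<lambda>p'. cmod (z - p')"] by simp
    finally have "cmod (p - z) \<le> 1 / d p * cmod (q z)"
      using d[of p] by (simp add: pos_le_divide_eq norm_minus_commute)
    also have "\<dots> \<le> c * cmod (q z)"
      unfolding c_def using d by (intro mult_right_mono member_le_sum p finite_Z) (auto intro: less_imp_le)
    finally show ?thesis using p by blast
  qed
  ultimately show ?thesis by blast
qed

text \<open>For each atom p one factor z - p of q is spent on the Poisson denominator, and the
  others are at most 2 on the circle, which gives 4^(card Z) after squaring. The summand 1 in the
  constant pays for the value at 0, where |q| = 1.\<close>

lemma multiplier:
  assumes g: "g \<in> disc_algebra"
  defines "f \<equiv> \<lambda>z. if z \<in> ball 0 1 then q z * g z else 0"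
  shows "f \<in> D" and "(N f)\<^sup>2 \<le> (1 + pi * 4 ^ card Z * (\<Sum>p\<in>Z. w p)) * circle_mean (\<lambda>z. (cmod (g z))\<^sup>2)"
proof -
  define M where "M = circle_mean (\<lambda>z. (cmod (g z))\<^sup>2)"
  have cg: "continuous_on (sphere 0 1) g" by (rule disc_algebra_continuous_on_sphere[OF g])
  have M: "M \<ge> 0" unfolding M_def by (intro circle_mean_nonneg continuous_intros cg) auto
  have qg: "(\<lambda>z. q z * g z) \<in> disc_algebra"
    unfolding q_def by (intro disc_algebra_intros g)
  then have hol_qg: "(\<lambda>z. q z * g z) holomorphic_on ball 0 1" by (simp add: disc_algebra_def)
  have hol_f: "f holomorphic_on ball 0 1"
    by (rule holomorphic_transform[OF hol_qg]) (simp add: f_def)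
  have deriv_f: "deriv f z = deriv (\<lambda>z. q z * g z) z" if "z \<in> ball 0 1" for z
    by (rule complex_derivative_transform_within_open[OF hol_f hol_qg]) (use that in \<open>auto simp: f_def\<close>)
  let ?v = "\<lambda>p z. ennreal ((cmod (deriv (\<lambda>z. q z * g z) z))\<^sup>2 * ((1 - (cmod z)\<^sup>2) / (cmod (p - z))\<^sup>2)) * indicator (ball 0 1) z"
  have le: "(\<integral>\<^sup>+z. ?v p z \<partial>lborel) \<le> ennreal (pi * (4 ^ card Z * M))" if p: "p \<in> Z" for p
  proof -
    define G where "G z = (\<Prod>p'\<in>Z - {p}. z - p') * g z" for z
    have G: "G \<in> disc_algebra" unfolding G_def by (intro disc_algebra_intros g)
    have "(\<lambda>z. q z * g z) = (\<lambda>z. (z - p) * G z)"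
      unfolding q_def G_def prod.remove[OF finite_Z p] by (simp add: mult.assoc)
    then have "(\<integral>\<^sup>+z. ?v p z \<partial>lborel) \<le> ennreal (pi * circle_mean (\<lambda>z. (cmod (G z))\<^sup>2))"
      using nn_integral_linear_factor_le[OF G Z_unit[OF p]] by simp
    also have "circle_mean (\<lambda>z. (cmod (G z))\<^sup>2) \<le> circle_mean (\<lambda>z. 4 ^ card Z * (cmod (g z))\<^sup>2)"
    proof (rule circle_mean_mono)
      fix z :: complex assume z: "cmod z = 1"
      have "(\<Prod>p'\<in>Z - {p}. cmod (z - p')) \<le> (\<Prod>p'\<in>Z - {p}. 2)"
      proof (intro prod_mono conjI)
        fix p' assume "p' \<in> Z - {p}"
        then show "cmod (z - p') \<le> 2" using z Z_unit[of p'] norm_triangle_ineq4[of z p'] by simp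
      qed simp
      also have "\<dots> = 2 ^ (card Z - 1)" using p finite_Z by simp
      also have "\<dots> \<le> 2 ^ card Z" by (intro power_increasing) auto
      finally have "cmod (G z) \<le> 2 ^ card Z * cmod (g z)"
        by (simp add: G_def norm_mult prod_norm[symmetric] mult_right_mono)
      then have "(cmod (G z))\<^sup>2 \<le> (2 ^ card Z * cmod (g z))\<^sup>2" by (intro power_mono) auto
      also have "\<dots> = 4 ^ card Z * (cmod (g z))\<^sup>2"
      proof -
        have "(4::real) ^ card Z = 2 ^ card Z * 2 ^ card Z"
          using power_mult_distrib[of "2::real" 2 "card Z"] by simp
        then show ?thesis by (simp only: power2_eq_square mult_ac)
      qed
      finally show "(cmod (G z))\<^sup>2 \<le> 4 ^ card Z * (cmod (g z))\<^sup>2" .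
    qed (intro continuous_intros cg disc_algebra_continuous_on_sphere[OF G])+
    also have "\<dots> = 4 ^ card Z * M" unfolding M_def by (rule circle_mean_cmult_real)
    finally show ?thesis by (simp add: ennreal_leI)
  qed
  have meas: "?v p \<in> borel_measurable lborel" if p: "p \<in> Z" for p
  proof -
    have "continuous_on (ball 0 1) (\<lambda>z. (cmod (deriv (\<lambda>z. q z * g z) z))\<^sup>2 * ((1 - (cmod z)\<^sup>2) / (cmod (p - z))\<^sup>2))"
      using Z_unit[OF p] holomorphic_on_imp_continuous_on[OF holomorphic_deriv[OF hol_qg open_ball]]
      by (intro continuous_intros) auto
    then have "(\<lambda>z. indicator (ball 0 1) z *\<^sub>R ((cmod (deriv (\<lambda>z. q z * g z) z))\<^sup>2 * ((1 - (cmod z)\<^sup>2) / (cmod (p - z))\<^sup>2))) \<in> borel_measurable lborel"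
      unfolding set_borel_measurable_def[symmetric] by (rule set_borel_measurable_continuous_on) simp
    then have "(\<lambda>z. ennreal (indicator (ball 0 1) z *\<^sub>R ((cmod (deriv (\<lambda>z. q z * g z) z))\<^sup>2 * ((1 - (cmod z)\<^sup>2) / (cmod (p - z))\<^sup>2)))) \<in> borel_measurable lborel"
      by (rule measurable_compose) simp
    also have "(\<lambda>z. ennreal (indicator (ball 0 1) z *\<^sub>R ((cmod (deriv (\<lambda>z. q z * g z) z))\<^sup>2 * ((1 - (cmod z)\<^sup>2) / (cmod (p - z))\<^sup>2)))) = ?v p"
      by (auto simp: indicator_def)
    finally show ?thesis .
  qed
  have "(\<integral>\<^sup>+z\<in>ball 0 1. ennreal ((cmod (deriv f z))\<^sup>2 * poisson \<mu> z) \<partial>lborel) = (\<integral>\<^sup>+z. (\<Sum>p\<in>Z. ennreal (w p) * ?v p z) \<partial>lborel)"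
  proof (rule nn_integral_cong)
    fix z
    show "ennreal ((cmod (deriv f z))\<^sup>2 * poisson \<mu> z) * indicator (ball 0 1) z = (\<Sum>p\<in>Z. ennreal (w p) * ?v p z)"
    proof (cases "z \<in> ball 0 1")
      case True
      then have "(cmod (deriv f z))\<^sup>2 * poisson \<mu> z =
          (\<Sum>p\<in>Z. w p * ((cmod (deriv (\<lambda>z. q z * g z) z))\<^sup>2 * ((1 - (cmod z)\<^sup>2) / (cmod (p - z))\<^sup>2)))"
        by (simp add: deriv_f poisson_eq sum_distrib_left mult_ac)
      moreover have nonneg: "0 \<le> (cmod (deriv (\<lambda>z. q z * g z) z))\<^sup>2 * ((1 - (cmod z)\<^sup>2) / (cmod (p - z))\<^sup>2)" for p
        using True abs_square_le_1[of "cmod z"] by simp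
      have "ennreal (\<Sum>p\<in>Z. w p * ((cmod (deriv (\<lambda>z. q z * g z) z))\<^sup>2 * ((1 - (cmod z)\<^sup>2) / (cmod (p - z))\<^sup>2))) =
          (\<Sum>p\<in>Z. ennreal (w p * ((cmod (deriv (\<lambda>z. q z * g z) z))\<^sup>2 * ((1 - (cmod z)\<^sup>2) / (cmod (p - z))\<^sup>2))))"
        using w_pos by (intro sum_ennreal[symmetric] mult_nonneg_nonneg[OF _ nonneg]) (auto intro: less_imp_le)
      moreover have "\<dots> = (\<Sum>p\<in>Z. ennreal (w p) * ?v p z)"
        using True by (intro sum.cong refl, subst ennreal_mult''[OF nonneg]) simp
      ultimately show ?thesis using True by simp
    qed simp
  qed
  also have "\<dots> = (\<Sum>p\<in>Z. ennreal (w p) * (\<integral>\<^sup>+z. ?v p z \<partial>lborel))"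
  proof -
    have "(\<integral>\<^sup>+z. (\<Sum>p\<in>Z. ennreal (w p) * ?v p z) \<partial>lborel) = (\<Sum>p\<in>Z. \<integral>\<^sup>+z. ennreal (w p) * ?v p z \<partial>lborel)"
      by (intro nn_integral_sum borel_measurable_times_ennreal borel_measurable_const meas)
    also have "\<dots> = (\<Sum>p\<in>Z. ennreal (w p) * (\<integral>\<^sup>+z. ?v p z \<partial>lborel))"
      by (intro sum.cong refl nn_integral_cmult meas)
    finally show ?thesis .
  qed
  also have "\<dots> \<le> (\<Sum>p\<in>Z. ennreal (w p) * ennreal (pi * (4 ^ card Z * M)))"
    by (intro sum_mono mult_left_mono le) auto
  also have "\<dots> = (\<Sum>p\<in>Z. ennreal (w p * (pi * (4 ^ card Z * M))))"
    using M by (intro sum.cong refl) (simp add: ennreal_mult'')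
  also have "\<dots> = ennreal (\<Sum>p\<in>Z. w p * (pi * (4 ^ card Z * M)))"
    using M w_pos by (intro sum_ennreal) (simp add: less_imp_le)
  also have "(\<Sum>p\<in>Z. w p * (pi * (4 ^ card Z * M))) = pi * 4 ^ card Z * (\<Sum>p\<in>Z. w p) * M"
    by (simp only: sum_distrib_right[symmetric]) (simp only: mult_ac)
  finally have fin: "(\<integral>\<^sup>+z\<in>ball 0 1. ennreal ((cmod (deriv f z))\<^sup>2 * poisson \<mu> z) \<partial>lborel) \<le> ennreal (pi * 4 ^ card Z * (\<Sum>p\<in>Z. w p) * M)" .
  show fD: "f \<in> D"
    using hol_f le_less_trans[OF fin ennreal_less_top] by (auto simp: dirichlet_space_def f_def)
  have "0 \<le> pi * 4 ^ card Z * (\<Sum>p\<in>Z. w p) * M"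
    using M w_pos by (intro mult_nonneg_nonneg sum_nonneg) (auto intro: less_imp_le)
  then have "(LINT z:ball 0 1|lborel. (cmod (deriv f z))\<^sup>2 * poisson \<mu> z) \<le> pi * 4 ^ card Z * (\<Sum>p\<in>Z. w p) * M"
    using fin unfolding energy_integrable(2)[OF fD] by simp
  moreover have "(cmod (f 0))\<^sup>2 \<le> M"
  proof -
    have "cmod (q 0) = 1" unfolding q_def prod_norm[symmetric] using Z_unit by simp
    then show ?thesis using bessel_coefficients[OF g, of 1] by (simp add: f_def norm_mult M_def)
  qed
  ultimately show "(N f)\<^sup>2 \<le> (1 + pi * 4 ^ card Z * (\<Sum>p\<in>Z. w p)) * M"
    unfolding norm_square by (simp add: distrib_right)
qed

lemma norm_square_cmult: "f \<in> D \<Longrightarrow> (N (\<lambda>z. c * f z))\<^sup>2 = (cmod c)\<^sup>2 * (N f)\<^sup>2"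
proof -
  assume f: "f \<in> D"
  have z: "(N (\<lambda>z. 0))\<^sup>2 = 0" using inner_self[of "\<lambda>z. 0"] by (simp add: inner_zero_right)
  have "IP (\<lambda>z. 0) f = 0" using inner_commute[of "\<lambda>z. 0" f] by (simp add: inner_zero_right)
  then show ?thesis using norm_square_lincomb[OF D_zero f, of c] z by simp
qed

lemma kernel_norm_dichotomy:
  obtains C1 C2 where "C1 > 0" "C2 > 0"
    "\<And>l. cmod l < 1 \<Longrightarrow> N (ker l) > C1 \<Longrightarrow> N (ker l) * sqrt (1 - (cmod l)\<^sup>2) \<le> C2 * cmod (q l)"
proof -
  obtain c where c: "c > 0" "\<And>z. \<exists>p\<in>Z. cmod (p - z) \<le> c * cmod (q z)"
    using exists_close_atom by blast
  define C where "C = (\<Sum>p\<in>Z. 1 + 4 / sqrt (w p))"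
  have pos: "0 < 1 + 4 / sqrt (w p)" if "p \<in> Z" for p
    using w_pos[OF that] by (simp add: add_pos_pos)
  have C: "C > 0" unfolding C_def by (intro sum_pos finite_Z Z_nonempty pos)
  show thesis
  \<comment> \<open>The kernel bound has the form C + X. A norm above 2 C makes C less than half of
    it, so the norm is at most 2 X. The other factor 2 stems from 1 - |l|^2 \<le> 4 (1 - |l|),
    rounded up so that the root is clean.\<close>
  proof (rule that[of "2 * C" "4 * C * c"])
    fix l assume l: "cmod l < 1" and large: "N (ker l) > 2 * C"
    obtain p where p: "p \<in> Z" "cmod (p - l) \<le> c * cmod (q l)" using c(2) by blast
    define s where "s = sqrt (1 - cmod l)"
    have s: "s > 0" using l by (simp add: s_def)
    have "1 - (cmod l)\<^sup>2 = (1 - cmod l) * (1 + cmod l)" by (simp add: power2_eq_square algebra_simps)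
    also have "\<dots> \<le> (1 - cmod l) * 4" using l by (intro mult_left_mono) auto
    finally have "sqrt (1 - (cmod l)\<^sup>2) \<le> sqrt ((1 - cmod l) * 4)" by (rule real_sqrt_le_mono)
    also have "\<dots> = 2 * s" unfolding s_def real_sqrt_mult by simp
    finally have s2: "sqrt (1 - (cmod l)\<^sup>2) \<le> 2 * s" .
    have "N (ker l) \<le> (1 + 4 / sqrt (w p)) * (1 + cmod (p - l) / s)"
      unfolding s_def by (rule kernel_norm_le[OF l p(1)])
    also have "\<dots> \<le> C * (1 + c * cmod (q l) / s)"
    proof (intro mult_mono)
      show "1 + 4 / sqrt (w p) \<le> C"
        unfolding C_def using p finite_Z pos by (intro member_le_sum[of p Z "\<lambda>p. 1 + 4 / sqrt (w p)"]) (auto intro: less_imp_le)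
      show "1 + cmod (p - l) / s \<le> 1 + c * cmod (q l) / s"
        using p s by (simp add: divide_right_mono)
    qed (use C s in auto)
    finally have "N (ker l) \<le> C + C * c * cmod (q l) / s" by (simp add: distrib_left)
    then have "N (ker l) \<le> 2 * (C * c * cmod (q l) / s)" using large by linarith
    then have "N (ker l) * s \<le> 2 * C * c * cmod (q l)" using s by (simp add: field_simps)
    moreover have "N (ker l) * sqrt (1 - (cmod l)\<^sup>2) \<le> N (ker l) * (2 * s)"
      by (intro mult_left_mono s2 N_nonneg)
    ultimately show "N (ker l) * sqrt (1 - (cmod l)\<^sup>2) \<le> 4 * C * c * cmod (q l)" by simp
  qed (use C c in auto)
qed

lemma riesz_sequence_singleton:
  assumes "cmod (lam n) < 1"
  shows "riesz_sequence \<mu> {n} (\<lambda>n. normalized_kernel \<mu> (lam n))"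
proof -
  have "normalized_kernel \<mu> (lam n) = (\<lambda>z. 1 / complex_of_real (N (ker (lam n))) * ker (lam n) z)"
    by (simp add: normalized_kernel_def)
  then have "(N (normalized_kernel \<mu> (lam n)))\<^sup>2 = 1"
    using kernel_norm_pos[OF assms] norm_square_cmult[OF kernel_in_D[OF assms]]
    by (simp only:) (simp add: norm_divide power_divide)
  then have *: "(N (\<lambda>z. a n * normalized_kernel \<mu> (lam n) z))\<^sup>2 = (cmod (a n))\<^sup>2" for a
    using norm_square_cmult[OF normalized_kernel_in_D[OF assms]] by simp
  have "(N (\<lambda>z. 0))\<^sup>2 = 0" using inner_self[of "\<lambda>z. 0"] by (simp add: inner_zero_right)
  then have "(N (\<lambda>z. \<Sum>n\<in>F. a n * normalized_kernel \<mu> (lam n) z))\<^sup>2 = (\<Sum>n\<in>F. (cmod (a n))\<^sup>2)" if "F \<subseteq> {n}" for F a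
    using that * by (auto simp: subset_singleton_iff)
  then show ?thesis unfolding riesz_sequence_def
    by (intro exI[of _ 1] conjI zero_less_one) auto
qed

section \<open>The partition into Riesz sequences\<close>

lemma feichtinger:
  fixes lam :: "nat \<Rightarrow> complex"
  assumes lam: "\<forall>n\<ge>1. lam n \<in> ball 0 1"
    and bessel: "bessel_sequence \<mu> {1..} (\<lambda>n. normalized_kernel \<mu> (lam n))"
  shows "\<exists>(r::nat) (J :: nat \<Rightarrow> nat set).
    (\<Union>j\<in>{1..r}. J j) = {1..} \<and> disjoint_family_on J {1..r} \<and>
    (\<forall>j\<in>{1..r}. riesz_sequence \<mu> (J j) (\<lambda>n. normalized_kernel \<mu> (lam n)))"
proof -
  have l: "cmod (lam n) < 1" if "n \<ge> 1" for n using lam that by simp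
  obtain B where B: "B > 0" and bes: "\<And>F (a :: nat \<Rightarrow> complex). finite F \<Longrightarrow> F \<subseteq> {1..} \<Longrightarrow>
      (N (\<lambda>z. \<Sum>n\<in>F. a n * normalized_kernel \<mu> (lam n) z))\<^sup>2 \<le> B * (\<Sum>n\<in>F. (cmod (a n))\<^sup>2)"
    using bessel unfolding bessel_sequence_def by blast
  have carleson: "(\<Sum>n\<in>F. (cmod (f (lam n)) / N (ker (lam n)))\<^sup>2) \<le> B * (N f)\<^sup>2"
    if "finite F" "F \<subseteq> {1..}" "f \<in> D" for F f
    using that l by (intro bessel_imp_sum_evaluation_le[OF _ _ _ bes B]) auto
  obtain C1 C2 where C1: "C1 > 0" and C2: "C2 > 0" and dich:
    "\<And>l. cmod l < 1 \<Longrightarrow> N (ker l) > C1 \<Longrightarrow> N (ker l) * sqrt (1 - (cmod l)\<^sup>2) \<le> C2 * cmod (q l)"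
    using kernel_norm_dichotomy by blast
  define E where "E = {n. n \<ge> 1 \<and> N (ker (lam n)) \<le> C1}"
  define S where "S = {1..} - E"
  have finite_E: "finite E"
  \<comment> \<open>For the constant 1 each exceptional index contributes at least 1 / C1^2 to a sum
    bounded by B times its squared norm, which limits the cardinality of every finite
    subset.\<close>
  proof (rule conjunct1[OF finite_if_finite_subsets_card_bdd[where C="nat \<lfloor>C1\<^sup>2 * (B * (N (indicator (ball 0 1)))\<^sup>2)\<rfloor>"]])
    fix F assume F: "F \<subseteq> E" "finite F"
    have "real (card F) * (1 / C1)\<^sup>2 = (\<Sum>n\<in>F. (1 / C1)\<^sup>2)" by simp
    also have "\<dots> \<le> (\<Sum>n\<in>F. (cmod (indicator (ball 0 1) (lam n)) / N (ker (lam n)))\<^sup>2)"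
    proof (rule sum_mono)
      fix n assume "n \<in> F"
      then have n: "n \<ge> 1" "N (ker (lam n)) \<le> C1" using F by (auto simp: E_def)
      have "1 / C1 \<le> 1 / N (ker (lam n))"
        using kernel_norm_pos[OF l[OF n(1)]] n(2) by (intro divide_left_mono) auto
      then have "(1 / C1)\<^sup>2 \<le> (1 / N (ker (lam n)))\<^sup>2" using C1 by (intro power_mono) auto
      then show "(1 / C1)\<^sup>2 \<le> (cmod (indicator (ball 0 1) (lam n)) / N (ker (lam n)))\<^sup>2"
        using l[OF n(1)] by simp
    qed
    also have "\<dots> \<le> B * (N (indicator (ball 0 1)))\<^sup>2"
      using F D_one by (intro carleson) (auto simp: E_def)
    finally have "real (card F) \<le> C1\<^sup>2 * (B * (N (indicator (ball 0 1)))\<^sup>2)"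
      using C1 by (simp add: power_divide pos_divide_le_eq mult.commute)
    then show "card F \<le> nat \<lfloor>C1\<^sup>2 * (B * (N (indicator (ball 0 1)))\<^sup>2)\<rfloor>"
      by (simp add: le_nat_floor)
  qed
  have S: "n \<ge> 1" "cmod (lam n) < 1" "N (ker (lam n)) * sqrt (1 - (cmod (lam n))\<^sup>2) \<le> C2 * cmod (q (lam n))" if "n \<in> S" for n
    using that l[of n] dich[of "lam n"] by (auto simp: S_def E_def)
  define Cm where "Cm = 1 + pi * 4 ^ card Z * (\<Sum>p\<in>Z. w p)"
  have Cm: "Cm \<ge> 1" unfolding Cm_def using w_pos by (simp add: sum_nonneg less_imp_le)
  \<comment> \<open>The three factors are the costs of passing from Szego weights to kernel norms
    (C2^2), of the Bessel condition (B), and of multiplication by q (Cm).\<close>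
  define C where "C = C2\<^sup>2 * (B * Cm)"
  have C: "C \<ge> 0" using B Cm by (simp add: C_def)
  have szego_carleson: "(\<Sum>n\<in>F. (1 - (cmod (lam n))\<^sup>2) * (cmod (g (lam n)))\<^sup>2) \<le> C * circle_mean (\<lambda>z. (cmod (g z))\<^sup>2)"
    if F: "finite F" "F \<subseteq> S" and g: "g \<in> disc_algebra" for F g
  proof -
    let ?f = "\<lambda>z. if z \<in> ball 0 1 then q z * g z else 0"
    have "(\<Sum>n\<in>F. (1 - (cmod (lam n))\<^sup>2) * (cmod (g (lam n)))\<^sup>2) \<le> (\<Sum>n\<in>F. C2\<^sup>2 * (cmod (?f (lam n)) / N (ker (lam n)))\<^sup>2)"
    proof (rule sum_mono)
      fix n assume "n \<in> F"
      then have n: "n \<in> S" using F by auto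
      have Np: "N (ker (lam n)) > 0" by (rule kernel_norm_pos[OF S(2)[OF n]])
      have "sqrt (1 - (cmod (lam n))\<^sup>2) \<le> C2 * cmod (q (lam n)) / N (ker (lam n))"
        using S(3)[OF n] Np by (simp add: pos_le_divide_eq mult.commute)
      then have "(sqrt (1 - (cmod (lam n))\<^sup>2) * cmod (g (lam n)))\<^sup>2 \<le> (C2 * cmod (q (lam n)) / N (ker (lam n)) * cmod (g (lam n)))\<^sup>2"
        using one_minus_square_pos[OF S(2)[OF n]] by (intro power_mono mult_right_mono) auto
      then show "(1 - (cmod (lam n))\<^sup>2) * (cmod (g (lam n)))\<^sup>2 \<le> C2\<^sup>2 * (cmod (?f (lam n)) / N (ker (lam n)))\<^sup>2"
        using one_minus_square_pos[OF S(2)[OF n]] S(2)[OF n]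
        by (simp add: power_mult_distrib power_divide norm_mult)
    qed
    also have "\<dots> = C2\<^sup>2 * (\<Sum>n\<in>F. (cmod (?f (lam n)) / N (ker (lam n)))\<^sup>2)"
      by (rule sum_distrib_left[symmetric])
    also have "\<dots> \<le> C2\<^sup>2 * (B * (N ?f)\<^sup>2)"
      using F S(1) by (intro mult_left_mono carleson multiplier(1)[OF g]) auto
    also have "\<dots> \<le> C2\<^sup>2 * (B * (Cm * circle_mean (\<lambda>z. (cmod (g z))\<^sup>2)))"
      using multiplier(2)[OF g] B unfolding Cm_def by (intro mult_left_mono) auto
    finally show ?thesis by (simp add: C_def mult.assoc)
  qed
  \<comment> \<open>The threshold 1/2 serves twice: a neighbour adds more than 1/2 to a sum bounded
    by C, so there are at most 2 C of them, and for points that are not neighbours rho^2 \<ge> 1/2,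
    as \<open>exp_le_prod\<close> demands.\<close>
  define R where "R m n \<longleftrightarrow> (cmod (blaschke (lam m) (lam n)))\<^sup>2 < 1 / 2" for m n
  have "\<exists>col. (\<forall>n\<in>S. col n \<le> nat \<lfloor>2 * C\<rfloor>) \<and> (\<forall>m\<in>S. \<forall>n\<in>S. m \<noteq> n \<longrightarrow> R m n \<longrightarrow> col m \<noteq> (col n :: nat))"
  proof (rule bounded_degree_colouring)
    show "R n m" if "R m n" for m n using that by (simp add: R_def blaschke_norm_commute)
    fix n F assume n: "n \<in> S" and F: "finite F" "F \<subseteq> {m \<in> S. R n m}"
    have "real (card F) * (1 / 2) = (\<Sum>m\<in>F. 1 / 2)" by simp
    also have "\<dots> \<le> (\<Sum>m\<in>F. 1 - (cmod (blaschke (lam n) (lam m)))\<^sup>2)"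
    proof (rule sum_mono)
      fix m assume "m \<in> F"
      then have "R n m" using F by auto
      then show "1 / 2 \<le> 1 - (cmod (blaschke (lam n) (lam m)))\<^sup>2" by (simp add: R_def)
    qed
    also have "\<dots> \<le> C"
      using F S(2) n by (intro sum_one_minus_blaschke_le szego_carleson) auto
    finally show "card F \<le> nat \<lfloor>2 * C\<rfloor>" by (simp add: le_nat_floor)
  qed
  then obtain col :: "nat \<Rightarrow> nat" where col: "\<And>n. n \<in> S \<Longrightarrow> col n \<le> nat \<lfloor>2 * C\<rfloor>"
    and sep: "\<And>m n. m \<in> S \<Longrightarrow> n \<in> S \<Longrightarrow> m \<noteq> n \<Longrightarrow> R m n \<Longrightarrow> col m \<noteq> col n"
    by blast
  have riesz_S: "riesz_sequence \<mu> {n \<in> S. col n = i} (\<lambda>n. normalized_kernel \<mu> (lam n))" for i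
  proof -
    define \<delta> where "\<delta> = exp (- C)"
    \<comment> \<open>The three constants of the interpolation estimate; the added 1 makes
      \<open>A\<close> positive from \<open>C \<ge> 0\<close>.\<close>
    define A where "A = Cm * (C / \<delta>\<^sup>2 * C2\<^sup>2) + 1"
    have A: "A > 0" unfolding A_def using Cm C by (intro add_nonneg_pos mult_nonneg_nonneg) auto
    have lower: "(\<Sum>n\<in>F. (cmod (a n))\<^sup>2) \<le> A * (N (\<lambda>z. \<Sum>n\<in>F. a n * normalized_kernel \<mu> (lam n) z))\<^sup>2"
      if F: "finite F" "F \<subseteq> {n \<in> S. col n = i}" for F and a :: "nat \<Rightarrow> complex"
    proof -
      have FS: "n \<in> S" if "n \<in> F" for n using F that by auto
      have lF: "cmod (lam n) < 1" if "n \<in> F" for n using S(2)[OF FS[OF that]] .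
      have \<delta>_le: "\<delta> \<le> (\<Prod>m\<in>F - {n}. cmod (blaschke (lam m) (lam n)))" if n: "n \<in> F" for n
        unfolding \<delta>_def blaschke_norm_commute[of _ "lam n"]
      proof (rule exp_le_prod)
        fix m assume m: "m \<in> F - {n}"
        then have "\<not> R n m" using sep[of n m] F n by auto
        then show "1 / 2 \<le> (cmod (blaschke (lam n) (lam m)))\<^sup>2" by (simp add: R_def)
        show "(cmod (blaschke (lam n) (lam m)))\<^sup>2 \<le> 1"
        proof -
          have "0 \<le> (1 - (cmod (lam m))\<^sup>2) * (cmod (szego (lam n) (lam m)))\<^sup>2"
            using one_minus_square_pos[OF lF[of m]] m by simp
          then show ?thesis using one_minus_blaschke_square[OF lF[OF n] lF[of m]] m by simp
        qed
      next
        show "(\<Sum>m\<in>F - {n}. 1 - (cmod (blaschke (lam n) (lam m)))\<^sup>2) \<le> C"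
          using F n lF by (intro sum_one_minus_blaschke_le szego_carleson) auto
      qed (use F in auto)
      \<comment> \<open>Scaled so that q g takes the value a n times the kernel norm at
        \<open>lam n\<close>. The quotient in front of a n has modulus at most C2 by the choice of
        \<open>S\<close>.\<close>
      define b where "b n = complex_of_real (N (ker (lam n)) * sqrt (1 - (cmod (lam n))\<^sup>2)) / q (lam n) * a n" for n
      obtain g where g: "g \<in> disc_algebra"
        and gb: "\<And>n. n \<in> F \<Longrightarrow> complex_of_real (sqrt (1 - (cmod (lam n))\<^sup>2)) * g (lam n) = b n"
        and gC: "circle_mean (\<lambda>z. (cmod (g z))\<^sup>2) \<le> C / \<delta>\<^sup>2 * (\<Sum>n\<in>F. (cmod (b n))\<^sup>2)"
        using szego_interpolation[OF F(1) lF szego_carleson[OF F(1)] C _ \<delta>_le, of b] FS by (auto simp: \<delta>_def)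
      have qnz: "q (lam n) \<noteq> 0" if "n \<in> F" for n
      proof
        assume "q (lam n) = 0"
        then have "N (ker (lam n)) * sqrt (1 - (cmod (lam n))\<^sup>2) \<le> 0" using S(3)[OF FS[OF that]] by simp
        moreover have "0 < N (ker (lam n)) * sqrt (1 - (cmod (lam n))\<^sup>2)"
          using kernel_norm_pos[OF lF[OF that]] one_minus_square_pos[OF lF[OF that]] by (intro mult_pos_pos) auto
        ultimately show False by linarith
      qed
      have b_le: "cmod (b n) \<le> C2 * cmod (a n)" if n: "n \<in> F" for n
      proof -
        have "cmod (b n) = N (ker (lam n)) * sqrt (1 - (cmod (lam n))\<^sup>2) / cmod (q (lam n)) * cmod (a n)"
          unfolding b_def norm_mult norm_divide norm_of_real
          using N_nonneg[of "ker (lam n)"] one_minus_square_pos[OF lF[OF n]] by simp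
        also have "\<dots> \<le> C2 * cmod (a n)"
          using S(3)[OF FS[OF n]] qnz[OF n] by (intro mult_right_mono) (auto simp: pos_divide_le_eq)
        finally show ?thesis .
      qed
      let ?f = "\<lambda>z. if z \<in> ball 0 1 then q z * g z else 0"
      have "(\<Sum>n\<in>F. (cmod (a n))\<^sup>2) \<le> (Cm * (C / \<delta>\<^sup>2 * C2\<^sup>2)) * (N (\<lambda>z. \<Sum>n\<in>F. a n * normalized_kernel \<mu> (lam n) z))\<^sup>2"
      proof (rule interpolation_imp_lower_bound[OF F(1) lF multiplier(1)[OF g]])
        show "?f (lam n) = a n * complex_of_real (N (ker (lam n)))" if n: "n \<in> F" for n
        proof -
          have s: "complex_of_real (sqrt (1 - (cmod (lam n))\<^sup>2)) \<noteq> 0"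
            using one_minus_square_pos[OF lF[OF n]] by simp
          have "complex_of_real (sqrt (1 - (cmod (lam n))\<^sup>2)) * (q (lam n) * g (lam n)) = q (lam n) * b n"
            using gb[OF n] by (metis mult.left_commute)
          also have "\<dots> = complex_of_real (sqrt (1 - (cmod (lam n))\<^sup>2)) * (a n * complex_of_real (N (ker (lam n))))"
            using qnz[OF n] by (simp add: b_def)
          finally have "q (lam n) * g (lam n) = a n * complex_of_real (N (ker (lam n)))"
            by (rule mult_left_cancel[OF s, THEN iffD1])
          then show ?thesis using lF[OF n] by simp
        qed
        have "(N ?f)\<^sup>2 \<le> Cm * circle_mean (\<lambda>z. (cmod (g z))\<^sup>2)"
          unfolding Cm_def by (rule multiplier(2)[OF g])
        also have "\<dots> \<le> Cm * (C / \<delta>\<^sup>2 * (\<Sum>n\<in>F. (cmod (b n))\<^sup>2))"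
          using Cm by (intro mult_left_mono gC) auto
        also have "\<dots> \<le> Cm * (C / \<delta>\<^sup>2 * (\<Sum>n\<in>F. (C2 * cmod (a n))\<^sup>2))"
          using Cm C b_le by (intro mult_left_mono sum_mono power_mono) auto
        also have "\<dots> = Cm * (C / \<delta>\<^sup>2 * C2\<^sup>2) * (\<Sum>n\<in>F. (cmod (a n))\<^sup>2)"
          by (simp add: power_mult_distrib sum_distrib_left[symmetric])
        finally show "(N ?f)\<^sup>2 \<le> Cm * (C / \<delta>\<^sup>2 * C2\<^sup>2) * (\<Sum>n\<in>F. (cmod (a n))\<^sup>2)" .
      qed
      also have "\<dots> \<le> A * (N (\<lambda>z. \<Sum>n\<in>F. a n * normalized_kernel \<mu> (lam n) z))\<^sup>2"
        by (intro mult_right_mono) (auto simp: A_def)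
      finally show ?thesis .
    qed
    show ?thesis unfolding riesz_sequence_def
    proof (rule exI[of _ "1 / A"], intro exI[of _ B] conjI allI impI)
      fix F and a :: "nat \<Rightarrow> complex"
      assume F: "finite F \<and> F \<subseteq> {n \<in> S. col n = i}"
      then show "1 / A * (\<Sum>n\<in>F. (cmod (a n))\<^sup>2) \<le> (N (\<lambda>z. \<Sum>n\<in>F. a n * normalized_kernel \<mu> (lam n) z))\<^sup>2"
        using lower[of F a] A by (simp add: pos_divide_le_eq mult.commute)
      show "(N (\<lambda>z. \<Sum>n\<in>F. a n * normalized_kernel \<mu> (lam n) z))\<^sup>2 \<le> B * (\<Sum>n\<in>F. (cmod (a n))\<^sup>2)"
        using F by (intro bes) (auto simp: S_def)
    qed (use A B in auto)
  qed
  obtain h where h: "bij_betw h E {0..<card E}" using ex_bij_betw_finite_nat[OF finite_E] by blast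
  \<comment> \<open>Colours run from 0 to the floor of 2 C, hence the + 1. Labels from
    \<open>K\<close> onwards are reserved for the exceptional indices, one label each.\<close>
  define K where "K = nat \<lfloor>2 * C\<rfloor> + 1"
  define label where "label n = (if n \<in> E then K + h n else col n)" for n
  \<comment> \<open>\<open>Suc\<close> moves the labels to the index range starting at 1. Some
    colour classes may be empty, and the empty family is a Riesz sequence.\<close>
  define J where "J j = {n. n \<ge> 1 \<and> Suc (label n) = j}" for j
  have "label n < K + card E" if "n \<ge> 1" for n
  proof (cases "n \<in> E")
    case True
    then have "h n \<in> {0..<card E}" using h by (auto simp: bij_betw_def)
    then show ?thesis using True by (simp add: label_def)
  next
    case False
    then show ?thesis using col[of n] that by (simp add: label_def S_def K_def)
  qed
  then have "(\<Union>j\<in>{1..K + card E}. J j) = {1..}" by (auto simp: J_def Suc_le_eq)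
  moreover have "disjoint_family_on J {1..K + card E}"
    by (auto simp: disjoint_family_on_def J_def)
  moreover have "riesz_sequence \<mu> (J j) (\<lambda>n. normalized_kernel \<mu> (lam n))" if "j \<in> {1..K + card E}" for j
  proof (cases "j \<le> K")
    case True
    then have "J j = {n \<in> S. col n = j - 1}"
      using that by (auto simp: J_def S_def E_def label_def)
    then show ?thesis using riesz_S by simp
  next
    case False
    then have "j - 1 - K \<in> {0..<card E}" using that by auto
    then obtain e where e: "e \<in> E" "h e = j - 1 - K" using h by (metis bij_betw_imp_surj_on imageE)
    have "J j = {e}"
    proof (intro set_eqI iffI)
      fix n assume "n \<in> J j"
      then have n: "n \<ge> 1" "Suc (label n) = j" by (auto simp: J_def)
      have "n \<in> E"
      proof (rule ccontr)
        assume "n \<notin> E"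
        then show False using n False col[of n] by (simp add: label_def S_def K_def)
      qed
      moreover from this have "h n = h e" using n e False by (simp add: label_def)
      ultimately show "n \<in> {e}" using h e by (auto simp: bij_betw_def inj_on_def)
    next
      fix n assume "n \<in> {e}"
      then show "n \<in> J j" using e False by (auto simp: J_def label_def E_def)
    qed
    then show ?thesis using riesz_sequence_singleton[of lam e] l e by (simp add: E_def)
  qed
  ultimately show ?thesis by blast
qed

end

section \<open>From the measure to its atoms\<close>

lemma finite_sum_of_point_masses_imp_point_mass_measure:
  assumes "finite_sum_of_point_masses \<mu>"
  obtains Z where "point_mass_measure \<mu> Z (\<lambda>p. measure \<mu> {p})"
proof -
  obtain N c \<zeta> where sets: "sets \<mu> = sets (restrict_space borel (sphere (0::complex) 1))"
    and N: "(N::nat) \<ge> 1" and c: "\<And>j. j \<in> {1..N} \<Longrightarrow> c j > (0::real)"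
    and \<zeta>: "\<And>j. j \<in> {1..N} \<Longrightarrow> \<zeta> j \<in> sphere (0::complex) 1"
    and em: "\<And>A. A \<in> sets \<mu> \<Longrightarrow> emeasure \<mu> A = (\<Sum>j=1..N. ennreal (c j) * indicator A (\<zeta> j))"
    using assms unfolding finite_sum_of_point_masses_def by metis
  \<comment> \<open>Taking the image removes repetitions among the \<open>\<zeta> j\<close>; the
    mass of the singleton {p} collects all the c j that belong to p.\<close>
  define Z where "Z = \<zeta> ` {1..N}"
  have fin: "finite Z" by (simp add: Z_def)
  have space: "space \<mu> = sphere 0 1"
    using sets_eq_imp_space_eq[OF sets] by (simp add: space_restrict_space)
  have in_sets: "A \<in> sets \<mu>" if "A \<in> sets borel" "A \<subseteq> sphere 0 1" for A
    unfolding sets sets_restrict_space using that by (auto intro!: image_eqI[of _ _ A])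
  have single: "{p} \<in> sets \<mu>" if "p \<in> Z" for p
    using that \<zeta> by (intro in_sets) (auto simp: Z_def)
  have em': "emeasure \<mu> A = ennreal (\<Sum>j=1..N. c j * indicator A (\<zeta> j))" if "A \<in> sets \<mu>" for A
  proof -
    have "emeasure \<mu> A = (\<Sum>j=1..N. ennreal (c j * indicator A (\<zeta> j)))"
      unfolding em[OF that] by (intro sum.cong refl) (auto simp: indicator_def)
    also have "\<dots> = ennreal (\<Sum>j=1..N. c j * indicator A (\<zeta> j))"
      using c by (intro sum_ennreal) (auto simp: indicator_def less_imp_le)
    finally show ?thesis .
  qed
  have pos: "measure \<mu> {p} > 0" if p: "p \<in> Z" for p
  proof -
    obtain j where j: "j \<in> {1..N}" "p = \<zeta> j" using p by (auto simp: Z_def)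
    have "0 < c j * indicator {p} (\<zeta> j)" using c[OF j(1)] j by simp
    also have "\<dots> \<le> (\<Sum>j=1..N. c j * indicator {p} (\<zeta> j))"
      using j c by (intro member_le_sum[of j "{1..N}" "\<lambda>j. c j * indicator {p} (\<zeta> j)"]) (auto simp: indicator_def less_imp_le)
    finally show ?thesis unfolding measure_def em'[OF single[OF p]] by simp
  qed
  \<comment> \<open>The measure is concentrated on \<open>Z\<close>, so under the Poisson integral
    the kernel may be replaced by a finite sum of multiples of indicators of atoms.\<close>
  have AE_Z: "AE x in \<mu>. x \<in> Z"
  proof (rule AE_I[where N="sphere 0 1 - Z"])
    show "{x \<in> space \<mu>. x \<notin> Z} \<subseteq> sphere 0 1 - Z" by (auto simp: space)
    show S: "sphere 0 1 - Z \<in> sets \<mu>"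
      using fin by (intro in_sets sets.Diff) (auto intro: borel_closed finite_imp_closed)
    show "emeasure \<mu> (sphere 0 1 - Z) = 0"
      unfolding em[OF S] by (intro sum.neutral) (auto simp: Z_def)
  qed
  have "poisson \<mu> z = (\<Sum>p\<in>Z. measure \<mu> {p} * ((1 - (cmod z)\<^sup>2) / (cmod (p - z))\<^sup>2))" for z
  proof -
    let ?F = "\<lambda>p. (1 - (cmod z)\<^sup>2) / (cmod (p - z))\<^sup>2"
    have meas: "?F \<in> borel_measurable \<mu>"
      unfolding measurable_cong_sets[OF sets refl] by (intro measurable_restrict_space1) measurable
    have "poisson \<mu> z = (LINT p|\<mu>. (\<Sum>a\<in>Z. ?F a * indicator {a} p))"
      unfolding poisson_def
    proof (rule integral_cong_AE[OF meas])
      show "(\<lambda>p. \<Sum>a\<in>Z. ?F a * indicator {a} p) \<in> borel_measurable \<mu>"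
        using single by (intro borel_measurable_sum borel_measurable_times borel_measurable_const borel_measurable_indicator)
      show "AE p in \<mu>. ?F p = (\<Sum>a\<in>Z. ?F a * indicator {a} p)"
        using AE_Z
      proof eventually_elim
        case (elim p)
        have "(\<Sum>a\<in>Z. ?F a * indicator {a} p) = (\<Sum>a\<in>Z. if p = a then ?F a else 0)"
          by (intro sum.cong refl) (auto simp: indicator_def)
        then show ?case using elim fin by (simp add: sum.delta')
      qed
    qed
    also have "\<dots> = (\<Sum>a\<in>Z. LINT p|\<mu>. ?F a * indicator {a} p)"
      using single em' by (intro Bochner_Integration.integral_sum integrable_mult_right integrable_real_indicator) auto
    also have "\<dots> = (\<Sum>a\<in>Z. measure \<mu> {a} * ?F a)"
      using single sets.sets_into_space by (intro sum.cong refl) (simp add: Int_absorb2)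
    finally show ?thesis .
  qed
  moreover have "Z \<noteq> {}" using N by (auto simp: Z_def)
  moreover have "cmod p = 1" if "p \<in> Z" for p using that \<zeta> by (auto simp: Z_def)
  ultimately have "point_mass_measure \<mu> Z (\<lambda>p. measure \<mu> {p})"
    using fin pos by unfold_locales auto
  then show thesis by (rule that)
qed

theorem corollary4p2:
  fixes \<mu> :: "complex measure" and lam :: "nat \<Rightarrow> complex"
  assumes "finite_sum_of_point_masses \<mu>"
    and "\<forall>n\<ge>1. lam n \<in> ball 0 1"
    and "bessel_sequence \<mu> {1..} (\<lambda>n. normalized_kernel \<mu> (lam n))"
  shows "\<exists>(r::nat) (J :: nat \<Rightarrow> nat set).
    (\<Union>j\<in>{1..r}. J j) = {1..} \<and> disjoint_family_on J {1..r} \<and>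
    (\<forall>j\<in>{1..r}. riesz_sequence \<mu> (J j) (\<lambda>n. normalized_kernel \<mu> (lam n)))"
proof -
  obtain Z where "point_mass_measure \<mu> Z (\<lambda>p. measure \<mu> {p})"
    using finite_sum_of_point_masses_imp_point_mass_measure[OF assms(1)] .
  then interpret point_mass_measure \<mu> Z "\<lambda>p. measure \<mu> {p}" .
  show ?thesis using assms(2,3) by (rule feichtinger)
qed

end
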